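(* Let $M$ be an oriented smooth $4$-manifold with a Riemannian metric $g$ and a compatible almost-complex structure $J$ with fundamental form $\omega$, and let $\varphi\in\Gamma(\mathcal{W}^{+})$ be a nowhere-zero self-dual spinor field of the induced $Spin^{\mathbb{C}}$-structure. Then the form $\varphi^{*}\omega$ is symplectic if and only if there is a unitary connection $A$ on $K^*$ such that the connection $\widetilde\nabla^{A}$ on $T_M=\mathcal{W}^-$, viewed through $\varphi:(T_M,\nabla)\to(T_M,\widetilde\nabla^{A})$, simultaneously is a closest match to $\nabla$ (i.e. $\mathcal{B}^{A}\varphi$ is minimal) and has its torsion minimized (i.e. $\mathrm{Alt}\,\mathcal{B}^{A}\varphi$ is minimal), minimality being point-wise among all unitary connections on $K^*$.
   Context: Compatible means $J$ is $g$-orthogonal and induces the orientation; $\omega(v,w)=g(Jv,w)$ and $(\varphi^*\omega)(v,w)=\omega(\varphi v,\varphi w)$. $\nabla$ is the Levi-Civita connection of $g$ and $K^*=\det_{\mathbb{C}}(T_M,J)$. Symplectic means non-degenerate and closed. For the $Spin^{\mathbb{C}}$-structure induced by $J$, one identifies $\mathcal{W}^-=(T_M,J)$ and $\mathcal{W}^+=PSO^+(T_M)\subset\mathrm{Hom}(T_M,T_M)$, the rank-$4$ real bundle of fiber maps which, under an orientation-preserving isometry $T_M|_x\cong\mathbb{H}$ (oriented by $1,i,j,k$), are left multiplications by quaternions; complex structure $i\varphi=J\circ\varphi$. Spinorial connections. In a U(2)-chart (local isometric orientation-preserving trivialization $T_M|_U\cong U\times\mathbb{H}$ in which $J$ is left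 multiplication by $i$; it also trivializes $K^*$ by the frame $1\wedge_{\mathbb{C}}j$), write $\nabla v=\partial v+\mathfrak{a}_+v-v\,\mathfrak{a}_-$ with $\mathfrak{a}_\pm$ $\mathrm{Im}\,\mathbb{H}$-valued $1$-forms, and a unitary connection $A$ on $K^*$ as $Az=\partial z+2i\alpha z$ with $\alpha$ a real $1$-form. Then $\widetilde\nabla^{A}w=\partial w+i\alpha w-w\,\mathfrak{a}_-$ is the induced connection on $\mathcal{W}^-=T_M$. $(\mathcal{B}^{A}\varphi)_XY=\widetilde\nabla^{A}_X(\varphi Y)-\varphi(\nabla_XY)$, a section of $T_M^*\otimes T_M^*\otimes T_M$, and $(\mathrm{Alt}\,\mathcal{B}^A\varphi)_XY=\frac12((\mathcal{B}^A\varphi)_XY-(\mathcal{B}^A\varphi)_YX)$. "Minimal" means that at every point $x$ the norm of the tensor at $x$ is minimal as $A$ varies over all unitary connections on $K^*$, for the norm from $\langle T_1,T_2\rangle=\sum_{j,k}g(T_1(e_j,e_k),T_2(e_j,e_k))$ ($\{e_k\}$ a $g$-orthonormal basis). *)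

theory Defs
  imports "HOL-Analysis.Analysis"
begin

section \<open>Smooth maps between vector spaces\<close>

primrec Ck_on :: "nat \<Rightarrow> 'e::euclidean_space set \<Rightarrow> ('e \<Rightarrow> 'b::real_normed_vector) \<Rightarrow> bool" where
  "Ck_on 0 S f \<longleftrightarrow> continuous_on S f"
| "Ck_on (Suc k) S f \<longleftrightarrow>
     (\<forall>x\<in>S. f differentiable at x) \<and> (\<forall>v. Ck_on k S (\<lambda>x. frechet_derivative f (at x) v))"

text \<open>Only used for open sets.\<close>

definition smooth_on :: "'e::euclidean_space set \<Rightarrow> ('e \<Rightarrow> 'b::real_normed_vector) \<Rightarrow> bool" where
  "smooth_on S f \<longleftrightarrow> (\<forall>k. Ck_on k S f)"


section \<open>Quaternions\<close>

text \<open>The quaternions are Euclidean 4-space with the orthonormal, positively oriented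
  basis 1, i, j, k, in this order.\<close>

type_synonym quat = "real^4"

definition qone :: quat where "qone = axis 1 1"
definition qi :: quat where "qi = axis 2 1"
definition qj :: quat where "qj = axis 3 1"

definition qmul :: "quat \<Rightarrow> quat \<Rightarrow> quat" where
  "qmul x y = vector
    [x$1 * y$1 - x$2 * y$2 - x$3 * y$3 - x$4 * y$4,
     x$1 * y$2 + x$2 * y$1 + x$3 * y$4 - x$4 * y$3,
     x$1 * y$3 - x$2 * y$4 + x$3 * y$1 + x$4 * y$2,
     x$1 * y$4 + x$2 * y$3 - x$3 * y$2 + x$4 * y$1]"

definition imquat :: "quat set" where
  "imquat = {x. x$1 = 0}"


section \<open>Oriented smooth 4-manifolds\<close>

record 'a chart =
  chart_dom :: "'a set"
  coord :: "'a \<Rightarrow> real^4"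

record 'a manifold =
  top_space :: "'a topology"
  atlas :: "'a chart set"

abbreviation param :: "'a chart \<Rightarrow> real^4 \<Rightarrow> 'a" where
  "param c \<equiv> inv_into (chart_dom c) (coord c)"

definition transition :: "'a chart \<Rightarrow> 'a chart \<Rightarrow> real^4 \<Rightarrow> real^4" where
  "transition c c' x = coord c' (param c x)"

definition jac :: "'a chart \<Rightarrow> 'a chart \<Rightarrow> 'a \<Rightarrow> real^4 \<Rightarrow> real^4" where
  "jac c c' p = frechet_derivative (transition c c') (at (coord c p))"

definition is_chart :: "'a topology \<Rightarrow> 'a chart \<Rightarrow> bool" where
  "is_chart X c \<longleftrightarrow> openin X (chart_dom c) \<and> open (coord c ` chart_dom c) \<and>
     homeomorphic_map (subtopology X (chart_dom c)) (top_of_set (coord c ` chart_dom c)) (coord c)"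

text \<open>The smooth structure and the orientation are those of an oriented atlas, which need not
  be maximal; every chart of the atlas is positively oriented.\<close>

definition oriented_manifold4 :: "'a manifold \<Rightarrow> bool" where
  "oriented_manifold4 M \<longleftrightarrow>
     Hausdorff_space (top_space M) \<and> second_countable (top_space M) \<and>
     (\<forall>c\<in>atlas M. is_chart (top_space M) c) \<and>
     (\<Union>c\<in>atlas M. chart_dom c) = topspace (top_space M) \<and>
     (\<forall>c\<in>atlas M. \<forall>c'\<in>atlas M.
        smooth_on (coord c ` (chart_dom c \<inter> chart_dom c')) (transition c c') \<and>
        (\<forall>p\<in>chart_dom c \<inter> chart_dom c'. det (matrix (jac c c' p)) > 0))"

text \<open>A vector or tensor at a point p is given by its components in every chart c around p,
  subject to the transformation law of its type. Thus the tangent space at p is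
  real^4 in each chart, with vectors transforming by \<open>jac c c' p\<close>.\<close>

type_synonym ('a, 'b) field = "'a chart \<Rightarrow> 'a \<Rightarrow> 'b"

type_synonym 'a endo_field = "('a, real^4 \<Rightarrow> real^4) field"
type_synonym 'a form2_field = "('a, real^4 \<Rightarrow> real^4 \<Rightarrow> real) field"
type_synonym 'a tensor12_field = "('a, real^4 \<Rightarrow> real^4 \<Rightarrow> real^4) field"

definition smooth_field :: "'a manifold \<Rightarrow> 'a set \<Rightarrow> ('a, 'b::real_normed_vector) field \<Rightarrow> bool" where
  "smooth_field M U F \<longleftrightarrow>
     (\<forall>c\<in>atlas M. smooth_on (coord c ` (U \<inter> chart_dom c)) (\<lambda>x. F c (param c x)))"

definition smooth_function :: "'a manifold \<Rightarrow> 'a set \<Rightarrow> ('a \<Rightarrow> 'b::real_normed_vector) \<Rightarrow> bool" where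
  "smooth_function M U f \<longleftrightarrow> smooth_field M U (\<lambda>c. f)"

text \<open>\<open>pd c f p u\<close> is the derivative at p, in the direction with components u in the chart c.\<close>

definition pd :: "'a chart \<Rightarrow> ('a \<Rightarrow> 'b::real_normed_vector) \<Rightarrow> 'a \<Rightarrow> real^4 \<Rightarrow> 'b" where
  "pd c f p u = frechet_derivative (\<lambda>x. f (param c x)) (at (coord c p)) u"


section \<open>Metric, almost-complex structure, Levi-Civita connection\<close>

definition riemannian_metric :: "'a manifold \<Rightarrow> 'a form2_field \<Rightarrow> bool" where
  "riemannian_metric M g \<longleftrightarrow>
     (\<forall>c\<in>atlas M. \<forall>p\<in>chart_dom c. bilinear (g c p) \<and>
        (\<forall>v w. g c p v w = g c p w v) \<and> (\<forall>v. v \<noteq> 0 \<longrightarrow> g c p v v > 0)) \<and>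
     (\<forall>c\<in>atlas M. \<forall>c'\<in>atlas M. \<forall>p\<in>chart_dom c \<inter> chart_dom c'. \<forall>v w.
        g c' p (jac c c' p v) (jac c c' p w) = g c p v w) \<and>
     (\<forall>v w. smooth_field M (topspace (top_space M)) (\<lambda>c p. g c p v w))"

definition endomorphism_field :: "'a manifold \<Rightarrow> 'a endo_field \<Rightarrow> bool" where
  "endomorphism_field M F \<longleftrightarrow>
     (\<forall>c\<in>atlas M. \<forall>p\<in>chart_dom c. linear (F c p)) \<and>
     (\<forall>c\<in>atlas M. \<forall>c'\<in>atlas M. \<forall>p\<in>chart_dom c \<inter> chart_dom c'. \<forall>v.
        F c' p (jac c c' p v) = jac c c' p (F c p v)) \<and>
     (\<forall>v. smooth_field M (topspace (top_space M)) (\<lambda>c p. F c p v))"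

text \<open>J induces the orientation: every basis of the form (v, Jv, w, Jw) is positive.\<close>

definition compatible_acs :: "'a manifold \<Rightarrow> 'a form2_field \<Rightarrow> 'a endo_field \<Rightarrow> bool" where
  "compatible_acs M g J \<longleftrightarrow>
     endomorphism_field M J \<and>
     (\<forall>c\<in>atlas M. \<forall>p\<in>chart_dom c.
        (\<forall>v. J c p (J c p v) = - v) \<and>
        (\<forall>v w. g c p (J c p v) (J c p w) = g c p v w) \<and>
        (\<forall>v w. det (vector [v, J c p v, w, J c p w] :: real^4^4) \<noteq> 0 \<longrightarrow>
               det (vector [v, J c p v, w, J c p w] :: real^4^4) > 0))"

definition fundamental_form :: "'a form2_field \<Rightarrow> 'a endo_field \<Rightarrow> 'a form2_field" where
  "fundamental_form g J c p v w = g c p (J c p v) w"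

definition pullback :: "'a endo_field \<Rightarrow> 'a form2_field \<Rightarrow> 'a form2_field" where
  "pullback \<phi> \<eta> c p v w = \<eta> c p (\<phi> c p v) (\<phi> c p w)"

definition closed_form2 :: "'a manifold \<Rightarrow> 'a form2_field \<Rightarrow> bool" where
  "closed_form2 M \<eta> \<longleftrightarrow> (\<forall>c\<in>atlas M. \<forall>p\<in>chart_dom c. \<forall>u v w.
     pd c (\<lambda>x. \<eta> c x v w) p u + pd c (\<lambda>x. \<eta> c x w u) p v + pd c (\<lambda>x. \<eta> c x u v) p w = 0)"

definition symplectic :: "'a manifold \<Rightarrow> 'a form2_field \<Rightarrow> bool" where
  "symplectic M \<eta> \<longleftrightarrow>
     (\<forall>c\<in>atlas M. \<forall>p\<in>chart_dom c. \<forall>v. v \<noteq> 0 \<longrightarrow> (\<exists>w. \<eta> c p v w \<noteq> 0)) \<and> closed_form2 M \<eta>"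

text \<open>A connection on the tangent bundle is given by its Christoffel symbols in each chart, with
  their usual inhomogeneous transformation law.\<close>

definition affine_connection :: "'a manifold \<Rightarrow> 'a tensor12_field \<Rightarrow> bool" where
  "affine_connection M \<Gamma> \<longleftrightarrow>
     (\<forall>c\<in>atlas M. \<forall>p\<in>chart_dom c. bilinear (\<Gamma> c p)) \<and>
     (\<forall>c\<in>atlas M. \<forall>c'\<in>atlas M. \<forall>p\<in>chart_dom c \<inter> chart_dom c'. \<forall>u v.
        pd c (\<lambda>x. jac c c' x v) p u + \<Gamma> c' p (jac c c' p u) (jac c c' p v)
          = jac c c' p (\<Gamma> c p u v)) \<and>
     (\<forall>u v. smooth_field M (topspace (top_space M)) (\<lambda>c p. \<Gamma> c p u v))"

text \<open>The covariant derivative at p in direction u of the vector field with components Y in c.\<close>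

definition covd ::
  "'a tensor12_field \<Rightarrow> 'a chart \<Rightarrow> ('a \<Rightarrow> real^4) \<Rightarrow> 'a \<Rightarrow> real^4 \<Rightarrow> real^4" where
  "covd \<Gamma> c Y p u = pd c Y p u + \<Gamma> c p u (Y p)"

text \<open>Torsion and metricity are tensorial, so it suffices to impose their vanishing on the fields
  with constant components in c, which commute with each other.\<close>

definition levi_civita :: "'a manifold \<Rightarrow> 'a form2_field \<Rightarrow> 'a tensor12_field \<Rightarrow> bool" where
  "levi_civita M g \<Gamma> \<longleftrightarrow> affine_connection M \<Gamma> \<and>
     (\<forall>c\<in>atlas M. \<forall>p\<in>chart_dom c. \<forall>u v w.
        covd \<Gamma> c (\<lambda>_. v) p u = covd \<Gamma> c (\<lambda>_. u) p v \<and>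
        pd c (\<lambda>x. g c x v w) p u = g c p (covd \<Gamma> c (\<lambda>_. v) p u) w + g c p v (covd \<Gamma> c (\<lambda>_. w) p u))"


section \<open>Self-dual spinors and U(2)-charts\<close>

definition oriented_isometry ::
  "'a form2_field \<Rightarrow> 'a chart \<Rightarrow> 'a \<Rightarrow> (real^4 \<Rightarrow> quat) \<Rightarrow> bool" where
  "oriented_isometry g c p L \<longleftrightarrow>
     linear L \<and> (\<forall>v w. L v \<bullet> L w = g c p v w) \<and> det (matrix L) > 0"

text \<open>Sections of PSO+. The condition does not depend on the isometry L, since SO(4) normalizes
  the left multiplications.\<close>

definition plus_spinor :: "'a manifold \<Rightarrow> 'a form2_field \<Rightarrow> 'a endo_field \<Rightarrow> bool" where
  "plus_spinor M g \<phi> \<longleftrightarrow> endomorphism_field M \<phi> \<and>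
     (\<forall>c\<in>atlas M. \<forall>p\<in>chart_dom c.
        \<exists>L q. oriented_isometry g c p L \<and> (\<forall>v. L (\<phi> c p v) = qmul q (L v)))"

definition nowhere_zero :: "'a manifold \<Rightarrow> 'a endo_field \<Rightarrow> bool" where
  "nowhere_zero M \<phi> \<longleftrightarrow> (\<forall>c\<in>atlas M. \<forall>p\<in>chart_dom c. \<exists>v. \<phi> c p v \<noteq> 0)"

text \<open>The trivialization E over the open set U is a quaternion-valued 1-form on U.\<close>

definition u2_chart ::
  "'a manifold \<Rightarrow> 'a form2_field \<Rightarrow> 'a endo_field \<Rightarrow> 'a set \<Rightarrow> ('a, real^4 \<Rightarrow> quat) field \<Rightarrow> bool" where
  "u2_chart M g J U E \<longleftrightarrow> openin (top_space M) U \<and>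
     (\<forall>c\<in>atlas M. \<forall>p\<in>U \<inter> chart_dom c.
        oriented_isometry g c p (E c p) \<and> (\<forall>v. E c p (J c p v) = qmul qi (E c p v))) \<and>
     (\<forall>c\<in>atlas M. \<forall>c'\<in>atlas M. \<forall>p\<in>U \<inter> chart_dom c \<inter> chart_dom c'. \<forall>v.
        E c' p (jac c c' p v) = E c p v) \<and>
     (\<forall>v. smooth_field M U (\<lambda>c p. E c p v))"


section \<open>The bundle K* and its unitary connections\<close>

text \<open>The second complex exterior power of (real^4, J) is realized inside the real bivectors
  (antisymmetric matrices) by mapping the complex wedge product of v and w to the bivector
  \<open>v \<and> w - Jv \<and> Jw\<close>, which is complex bilinear in v, w when i acts on the image as left
  multiplication by the matrix of J.\<close>

type_synonym 'a ksection = "('a, real^4^4) field"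

definition bivector :: "real^4 \<Rightarrow> real^4 \<Rightarrow> real^4^4" where
  "bivector v w = (\<chi> i j. v$i * w$j - w$i * v$j)"

definition cwedge :: "'a endo_field \<Rightarrow> 'a chart \<Rightarrow> 'a \<Rightarrow> real^4 \<Rightarrow> real^4 \<Rightarrow> real^4^4" where
  "cwedge J c p v w = bivector v w - bivector (J c p v) (J c p w)"

definition kstar :: "'a endo_field \<Rightarrow> 'a chart \<Rightarrow> 'a \<Rightarrow> (real^4^4) set" where
  "kstar J c p = span {cwedge J c p v w | v w. True}"

definition kscale :: "'a endo_field \<Rightarrow> 'a chart \<Rightarrow> 'a \<Rightarrow> complex \<Rightarrow> real^4^4 \<Rightarrow> real^4^4" where
  "kscale J c p z \<beta> = Re z *\<^sub>R \<beta> + Im z *\<^sub>R (matrix (J c p) ** \<beta>)"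

text \<open>The real part of the Hermitian metric; the factor makes the complex wedge product of a
  unitary frame a unit vector.\<close>

definition kinner :: "'a form2_field \<Rightarrow> 'a chart \<Rightarrow> 'a \<Rightarrow> real^4^4 \<Rightarrow> real^4^4 \<Rightarrow> real" where
  "kinner g c p \<beta> \<gamma> = (1/4) * (\<Sum>i\<in>UNIV. \<Sum>j\<in>UNIV. \<Sum>k\<in>UNIV. \<Sum>l\<in>UNIV.
     \<beta>$i$j * \<gamma>$k$l * g c p (axis i 1) (axis k 1) * g c p (axis j 1) (axis l 1))"

definition bivector_law :: "'a chart \<Rightarrow> 'a chart \<Rightarrow> 'a \<Rightarrow> real^4^4 \<Rightarrow> real^4^4" where
  "bivector_law c c' p \<beta> = matrix (jac c c' p) ** \<beta> ** transpose (matrix (jac c c' p))"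

definition kstar_section :: "'a manifold \<Rightarrow> 'a endo_field \<Rightarrow> 'a set \<Rightarrow> 'a ksection \<Rightarrow> bool" where
  "kstar_section M J U s \<longleftrightarrow>
     (\<forall>c\<in>atlas M. \<forall>p\<in>U \<inter> chart_dom c. s c p \<in> kstar J c p) \<and>
     (\<forall>c\<in>atlas M. \<forall>c'\<in>atlas M. \<forall>p\<in>U \<inter> chart_dom c \<inter> chart_dom c'.
        s c' p = bivector_law c c' p (s c p)) \<and>
     smooth_field M U s"

definition kstar_form1 ::
  "'a manifold \<Rightarrow> 'a endo_field \<Rightarrow> 'a set \<Rightarrow> ('a, real^4 \<Rightarrow> real^4^4) field \<Rightarrow> bool" where
  "kstar_form1 M J U \<theta> \<longleftrightarrow>
     (\<forall>c\<in>atlas M. \<forall>p\<in>U \<inter> chart_dom c. linear (\<theta> c p) \<and> (\<forall>u. \<theta> c p u \<in> kstar J c p)) \<and>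
     (\<forall>c\<in>atlas M. \<forall>c'\<in>atlas M. \<forall>p\<in>U \<inter> chart_dom c \<inter> chart_dom c'. \<forall>u.
        \<theta> c' p (jac c c' p u) = bivector_law c c' p (\<theta> c p u)) \<and>
     (\<forall>u. smooth_field M U (\<lambda>c p. \<theta> c p u))"

text \<open>A covariant derivative is an operator on the local sections of K*. Sections are total
  functions, so a section over U has irrelevant values off U; locality makes \<open>A s\<close> over U
  independent of them and compatible with restriction.\<close>

type_synonym 'a kconnection = "'a ksection \<Rightarrow> ('a, real^4 \<Rightarrow> real^4^4) field"

definition unitary_connection ::
  "'a manifold \<Rightarrow> 'a form2_field \<Rightarrow> 'a endo_field \<Rightarrow> 'a kconnection \<Rightarrow> bool" where
  "unitary_connection M g J A \<longleftrightarrow>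
     (\<forall>U s. openin (top_space M) U \<and> kstar_section M J U s \<longrightarrow>
        kstar_form1 M J U (A s) \<and>
        (\<forall>f::'a \<Rightarrow> complex. smooth_function M U f \<longrightarrow>
           (\<forall>c\<in>atlas M. \<forall>p\<in>U \<inter> chart_dom c. \<forall>u.
              A (\<lambda>c p. kscale J c p (f p) (s c p)) c p u
                = kscale J c p (pd c f p u) (s c p) + kscale J c p (f p) (A s c p u)))) \<and>
     (\<forall>U s t. openin (top_space M) U \<and> kstar_section M J U s \<and> kstar_section M J U t \<longrightarrow>
        ((\<forall>c\<in>atlas M. \<forall>p\<in>U \<inter> chart_dom c. s c p = t c p) \<longrightarrow>
           (\<forall>c\<in>atlas M. \<forall>p\<in>U \<inter> chart_dom c. A s c p = A t c p)) \<and>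
        (\<forall>c\<in>atlas M. \<forall>p\<in>U \<inter> chart_dom c. \<forall>u.
           A (\<lambda>c p. s c p + t c p) c p u = A s c p u + A t c p u \<and>
           pd c (\<lambda>x. kinner g c x (s c x) (t c x)) p u
             = kinner g c p (A s c p u) (t c p) + kinner g c p (s c p) (A t c p u)))"


section \<open>Spinorial connections\<close>

text \<open>The values a, b at the point p and the direction u of the connection forms
  \<open>\<aa>\<^sub>+, \<aa>\<^sub>-\<close> of the connection in the trivialization E. A field v with constant components in
  c has the quaternionic expression \<open>E v\<close>; these fields determine the connection.\<close>

definition conn_forms ::
  "'a tensor12_field \<Rightarrow> ('a, real^4 \<Rightarrow> quat) field \<Rightarrow> 'a chart \<Rightarrow> 'a \<Rightarrow> real^4 \<Rightarrow> quat \<Rightarrow> quat \<Rightarrow> bool" where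
  "conn_forms \<Gamma> E c p u a b \<longleftrightarrow> a \<in> imquat \<and> b \<in> imquat \<and>
     (\<forall>v. E c p (covd \<Gamma> c (\<lambda>_. v) p u)
            = pd c (\<lambda>x. E c x v) p u + qmul a (E c p v) - qmul (E c p v) b)"

text \<open>The frame \<open>1 \<and> j\<close> of K* (complex wedge) over the U(2)-chart E.\<close>

definition kframe :: "'a endo_field \<Rightarrow> ('a, real^4 \<Rightarrow> quat) field \<Rightarrow> 'a ksection" where
  "kframe J E c p = cwedge J c p (inv (E c p) qone) (inv (E c p) qj)"

definition det_conn_form ::
  "'a endo_field \<Rightarrow> 'a kconnection \<Rightarrow> ('a, real^4 \<Rightarrow> quat) field \<Rightarrow> 'a chart \<Rightarrow> 'a \<Rightarrow> real^4 \<Rightarrow> real \<Rightarrow> bool" where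
  "det_conn_form J A E c p u \<alpha> \<longleftrightarrow>
     A (kframe J E) c p u = kscale J c p (2 * \<i> * complex_of_real \<alpha>) (kframe J E c p)"

text \<open>The covariant derivative at p, in direction u, of the section of \<open>W\<^sup>- = TM\<close> with
  components w in the chart c: the vector z that is given in every U(2)-chart around p by
  \<open>\<partial>w + i\<alpha>w - w\<aa>\<^sub>-\<close>.\<close>

definition spin_covd ::
  "'a manifold \<Rightarrow> 'a form2_field \<Rightarrow> 'a endo_field \<Rightarrow> 'a tensor12_field \<Rightarrow> 'a kconnection \<Rightarrow>
   'a chart \<Rightarrow> ('a \<Rightarrow> real^4) \<Rightarrow> 'a \<Rightarrow> real^4 \<Rightarrow> real^4" where
  "spin_covd M g J \<Gamma> A c w p u = (THE z. \<forall>U E a b \<alpha>.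
     u2_chart M g J U E \<and> p \<in> U \<and> conn_forms \<Gamma> E c p u a b \<and> det_conn_form J A E c p u \<alpha> \<longrightarrow>
     E c p z = pd c (\<lambda>x. E c x (w x)) p u + \<alpha> *\<^sub>R qmul qi (E c p (w p)) - qmul (E c p (w p)) b)"

text \<open>The expression is tensorial in Y, so its value on a vector v at p is computed with the field Y
  that has constant components v in the chart c.\<close>

definition spin_B ::
  "'a manifold \<Rightarrow> 'a form2_field \<Rightarrow> 'a endo_field \<Rightarrow> 'a tensor12_field \<Rightarrow> 'a endo_field \<Rightarrow>
   'a kconnection \<Rightarrow> 'a tensor12_field" where
  "spin_B M g J \<Gamma> \<phi> A c p u v =
     spin_covd M g J \<Gamma> A c (\<lambda>x. \<phi> c x v) p u - \<phi> c p (covd \<Gamma> c (\<lambda>_. v) p u)"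

definition alt_part :: "'a tensor12_field \<Rightarrow> 'a tensor12_field" where
  "alt_part T c p u v = (1/2) *\<^sub>R (T c p u v - T c p v u)"

text \<open>The inner product does not depend on the choice of the orthonormal basis.\<close>

definition tensor_inner :: "'a form2_field \<Rightarrow> 'a chart \<Rightarrow> 'a \<Rightarrow>
    (real^4 \<Rightarrow> real^4 \<Rightarrow> real^4) \<Rightarrow> (real^4 \<Rightarrow> real^4 \<Rightarrow> real^4) \<Rightarrow> real" where
  "tensor_inner g c p T1 T2 =
     (let e = (SOME e :: 4 \<Rightarrow> real^4. \<forall>j k. g c p (e j) (e k) = (if j = k then 1 else 0))
      in \<Sum>j\<in>UNIV. \<Sum>k\<in>UNIV. g c p (T1 (e j) (e k)) (T2 (e j) (e k)))"

definition tensor_norm :: "'a form2_field \<Rightarrow> 'a chart \<Rightarrow> 'a \<Rightarrow> (real^4 \<Rightarrow> real^4 \<Rightarrow> real^4) \<Rightarrow> real" where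
  "tensor_norm g c p T = sqrt (tensor_inner g c p T T)"

definition pointwise_minimal ::
  "'a manifold \<Rightarrow> 'a form2_field \<Rightarrow> 'a endo_field \<Rightarrow> ('a kconnection \<Rightarrow> 'a tensor12_field) \<Rightarrow>
   'a kconnection \<Rightarrow> bool" where
  "pointwise_minimal M g J T A \<longleftrightarrow>
     (\<forall>c\<in>atlas M. \<forall>p\<in>chart_dom c. \<forall>A'. unitary_connection M g J A' \<longrightarrow>
        tensor_norm g c p (T A c p) \<le> tensor_norm g c p (T A' c p))"

definition closest_match ::
  "'a manifold \<Rightarrow> 'a form2_field \<Rightarrow> 'a endo_field \<Rightarrow> 'a tensor12_field \<Rightarrow> 'a endo_field \<Rightarrow>
   'a kconnection \<Rightarrow> bool" where
  "closest_match M g J \<Gamma> \<phi> A \<longleftrightarrow> pointwise_minimal M g J (spin_B M g J \<Gamma> \<phi>) A"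

definition torsion_minimized ::
  "'a manifold \<Rightarrow> 'a form2_field \<Rightarrow> 'a endo_field \<Rightarrow> 'a tensor12_field \<Rightarrow> 'a endo_field \<Rightarrow>
   'a kconnection \<Rightarrow> bool" where
  "torsion_minimized M g J \<Gamma> \<phi> A \<longleftrightarrow>
     pointwise_minimal M g J (\<lambda>A'. alt_part (spin_B M g J \<Gamma> \<phi> A')) A"

end

(* Every unitary connection on K* has the form A0 + 2i eta, where A0 is the projection of the
   Levi-Civita connection to K* and eta is a real 1-form, and then B^A phi = B^{A0} phi + eta (x) J phi.
   Completing squares, the norms of B^A phi and of its alternation have unique minimizers eta1 and
   eta2. Both are given by chart-independent formulas in g, J, the Levi-Civita connection and phi,
   so they are global smooth 1-forms, and neither partitions of unity nor bump functions are needed: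
   a common minimizer A exists iff eta1 = eta2.

   In a U(2)-chart phi is left multiplication by a quaternion function q, and phi^* omega corresponds
   to the skew endomorphism s = conj(q) i q. For the minimizer eta1 the quaternion conj(q) i B^A phi is
   imaginary and equals half of nabla s. The condition eta1 = eta2 then says that
   sum_k (nabla_{e_k} s) e_k = 0, which for the self-dual form phi^* omega is the vanishing of d;
   non-degeneracy is automatic. *)
theory Submission
  imports Defs
begin

section \<open>Calculus: k times differentiable maps on open sets, up to the chain rule\<close>

section \<open>Calculus of smooth maps\<close>

text \<open>Why eta1 = eta2 is a divergence equation: put T = conj(q) i B^{A0} phi / (4|q|^2), a
  1-form with values in left multiplications. Split T_u = T'_u + (t1(u)/4) id with T' imaginary, so
  that t1 is the trace over the vector slot, and let t2 be the contraction of the form slot with the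
  output. Then eta1 = t1. In the alternation the quadratic term of eta has weight 3 where the full
  norm has 4, which gives eta2 = 4/3 (t1 - t2). Hence eta1 = eta2 iff t2 = t1/4, i.e. iff the
  contraction of T' vanishes, and T' is nabla s divided by 8|q|^2. The obstacle is that
  \<open>spin_covd\<close> is a definite description over all U(2)-charts, while the minimizers have
  to be formulas in arbitrary charts. Two expressions bridge the gap: (1/2) J nabla J is the
  j,k-part of the left connection form, and trace(phi)/2 - phi is multiplication by conj(q).
  U(2)-charts then serve only for verification at a point.\<close>

lemma Ck_on_subset: "Ck_on k S f \<Longrightarrow> T \<subseteq> S \<Longrightarrow> Ck_on k T f"
  by (induction k arbitrary: f) (auto intro: continuous_on_subset)

text \<open>Derivatives at points of an open set see only the values on that set; this is what makes
  the arbitrary values of fields outside a chart harmless.\<close>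

lemma Ck_on_cong:
  assumes "open S" "\<And>x. x \<in> S \<Longrightarrow> f x = g x" "Ck_on k S f"
  shows "Ck_on k S g"
  using assms(2,3)
proof (induction k arbitrary: f g)
  case 0
  then show ?case by (metis Ck_on.simps(1) continuous_on_cong)
next
  case (Suc k)
  have d: "(g has_derivative frechet_derivative f (at x)) (at x)" if "x \<in> S" for x
    by (rule has_derivative_transform_within_open[OF _ \<open>open S\<close> that Suc.prems(1)])
      (use Suc.prems(2) that in \<open>auto simp: frechet_derivative_works\<close>)
  moreover have "Ck_on k S (\<lambda>x. frechet_derivative g (at x) v)" for v
    by (rule Suc.IH[of "\<lambda>x. frechet_derivative f (at x) v"])
      (use Suc.prems(2) in \<open>auto simp: frechet_derivative_at[OF d]\<close>)
  ultimately show ?case by (auto simp: differentiable_def)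
qed

text \<open>Replaces the chosen \<open>frechet_derivative\<close> by any explicit derivative, the
  form in which all closure rules below are proved.\<close>

lemma Ck_on_SucI:
  assumes "open S" "\<And>x. x \<in> S \<Longrightarrow> (f has_derivative f' x) (at x)"
    and "\<And>v. Ck_on k S (\<lambda>x. f' x v)"
  shows "Ck_on (Suc k) S f"
proof -
  have "Ck_on k S (\<lambda>x. frechet_derivative f (at x) v)" for v
    by (rule Ck_on_cong[OF assms(1) _ assms(3)[of v]])
      (simp add: frechet_derivative_at[OF assms(2)])
  then show ?thesis using assms(2) by (auto simp: differentiable_def)
qed

lemma Ck_on_SucD: "Ck_on (Suc k) S f \<Longrightarrow> Ck_on k S f"
proof (induction k arbitrary: f)
  case 0
  then show ?case
    by (auto intro!: continuous_at_imp_continuous_on differentiable_imp_continuous_within)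
qed auto

lemma Ck_on_const: "Ck_on k S (\<lambda>_. a)"
  by (induction k arbitrary: a) auto

lemma Ck_on_add:
  assumes "open S" "Ck_on k S f" "Ck_on k S g"
  shows "Ck_on k S (\<lambda>x. f x + g x)"
  using assms(2,3)
proof (induction k arbitrary: f g)
  case 0 then show ?case by (auto intro: continuous_on_add)
next
  case (Suc k)
  show ?case
    by (rule Ck_on_SucI[OF assms(1),
          where f' = "\<lambda>x v. frechet_derivative f (at x) v + frechet_derivative g (at x) v"])
      (use Suc in \<open>auto intro!: has_derivative_add simp: frechet_derivative_works[symmetric]\<close>)
qed

lemma Ck_on_bilinear:
  assumes h: "bounded_bilinear h" and "open S" "Ck_on k S f" "Ck_on k S g"
  shows "Ck_on k S (\<lambda>x. h (f x) (g x))"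
  using assms(3,4)
proof (induction k arbitrary: f g)
  case 0 then show ?case by (auto intro: bounded_bilinear.continuous_on[OF h])
next
  case (Suc k)
  show ?case
  proof (rule Ck_on_SucI[OF assms(2)])
    fix x assume "x \<in> S"
    then show "((\<lambda>x. h (f x) (g x)) has_derivative
      (\<lambda>v. h (f x) (frechet_derivative g (at x) v) + h (frechet_derivative f (at x) v) (g x))) (at x)"
      using Suc.prems by (intro bounded_bilinear.FDERIV[OF h]) (auto simp: frechet_derivative_works[symmetric])
  next
    fix v
    show "Ck_on k S (\<lambda>x. h (f x) (frechet_derivative g (at x) v) + h (frechet_derivative f (at x) v) (g x))"
      using Suc.prems Ck_on_SucD[OF Suc.prems(1)] Ck_on_SucD[OF Suc.prems(2)]
      by (intro Ck_on_add assms Suc.IH) auto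
  qed
qed

lemma Ck_on_linear:
  assumes h: "bounded_linear h" and "open S" "Ck_on k S f"
  shows "Ck_on k S (\<lambda>x. h (f x))"
  using assms(3)
proof (induction k arbitrary: f)
  case 0 then show ?case by (auto intro: bounded_linear.continuous_on[OF h])
next
  case (Suc k)
  show ?case
    by (rule Ck_on_SucI[OF assms(2), where f' = "\<lambda>x v. h (frechet_derivative f (at x) v)"])
      (use Suc in \<open>auto intro!: bounded_linear.has_derivative[OF h]
          simp: frechet_derivative_works[symmetric]\<close>)
qed

lemma Ck_on_sum:
  assumes "open S" "\<And>i. i \<in> I \<Longrightarrow> Ck_on k S (f i)"
  shows "Ck_on k S (\<lambda>x. \<Sum>i\<in>I. f i x)"
  using assms(2) by (induction I rule: infinite_finite_induct) (auto intro: Ck_on_const Ck_on_add assms)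

lemma Ck_on_compose:
  fixes f :: "'d::euclidean_space \<Rightarrow> 'b::real_normed_vector" and g :: "'e::euclidean_space \<Rightarrow> 'd"
  assumes "open S" "g ` S \<subseteq> T" "Ck_on k T f" "Ck_on k S g"
  shows "Ck_on k S (\<lambda>x. f (g x))"
  using assms(3,4)
proof (induction k arbitrary: f)
  case 0 then show ?case using assms(2) by (auto intro: continuous_on_compose2)
next
  case (Suc k)
  show ?case
  proof (rule Ck_on_SucI[OF assms(1)])
    fix x assume x: "x \<in> S"
    have f: "(f has_derivative frechet_derivative f (at (g x))) (at (g x))"
      using Suc.prems assms(2) x by (auto simp: frechet_derivative_works[symmetric])
    have g: "(g has_derivative frechet_derivative g (at x)) (at x)"
      using Suc.prems x by (auto simp: frechet_derivative_works[symmetric])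
    interpret l: linear "frechet_derivative f (at (g x))"
      using f by (rule has_derivative_linear)
    \<comment> \<open>The chain rule evaluates the derivative of \<open>f\<close> along a direction
      that varies with \<open>x\<close>, whereas \<open>Ck_on\<close> speaks of fixed directions.
      Expansion in the basis leaves products of functions covered by the induction
      hypothesis.\<close>
    have rep: "frechet_derivative f (at (g x)) w = (\<Sum>b\<in>Basis. (w \<bullet> b) *\<^sub>R frechet_derivative f (at (g x)) b)" for w
      by (subst euclidean_representation[of w, symmetric]) (simp add: l.sum l.scale)
    have "((\<lambda>x. f (g x)) has_derivative
        (\<lambda>v. frechet_derivative f (at (g x)) (frechet_derivative g (at x) v))) (at x)"
      using diff_chain_at[OF g f] by (simp add: o_def)
    then show "((\<lambda>x. f (g x)) has_derivative
        (\<lambda>v. \<Sum>b\<in>Basis. (frechet_derivative g (at x) v \<bullet> b) *\<^sub>R frechet_derivative f (at (g x)) b)) (at x)"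
      by (simp only: rep[symmetric])
  next
    fix v
    show "Ck_on k S (\<lambda>x. \<Sum>b\<in>Basis. (frechet_derivative g (at x) v \<bullet> b) *\<^sub>R frechet_derivative f (at (g x)) b)"
      using Suc.prems Ck_on_SucD[OF Suc.prems(2)]
      by (intro Ck_on_sum Ck_on_bilinear[OF bounded_bilinear_scaleR] assms
          Ck_on_linear[OF bounded_linear_inner_left] Suc.IH) auto
  qed
qed

text \<open>The derivative is a polynomial in \<open>inverse\<close> itself, so the induction
  closes.\<close>

lemma Ck_on_inverse: "Ck_on k (- {0::real}) inverse"
proof (induction k)
  case 0 then show ?case by (auto intro!: continuous_intros)
next
  case (Suc k)
  show ?case
  proof (rule Ck_on_SucI)
    fix x :: real assume "x \<in> - {0}"
    then show "(inverse has_derivative (\<lambda>v. - (v * (inverse x * inverse x)))) (at x)"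
      using has_derivative_inverse'[of x UNIV] by (auto simp: mult_ac)
  next
    fix v :: real
    show "Ck_on k (- {0}) (\<lambda>x. - (v * (inverse x * inverse x)))"
      by (intro Ck_on_linear[OF bounded_linear_minus[OF bounded_linear_ident]]
          Ck_on_linear[OF bounded_linear_mult_right] Ck_on_bilinear[OF bounded_bilinear_mult] Suc) auto
  qed (simp add: open_Compl)
qed

text \<open>Square roots enter through the normalization of frame vectors. The derivative is
  \<open>inverse\<close> composed with \<open>sqrt\<close>, so again the induction closes.\<close>

lemma Ck_on_sqrt: "Ck_on k {0<..} sqrt"
proof (induction k)
  case 0 then show ?case by (auto intro!: continuous_intros)
next
  case (Suc k)
  show ?case
  proof (rule Ck_on_SucI)
    fix x :: real assume "x \<in> {0<..}"
    then show "(sqrt has_derivative (\<lambda>v. (v / 2) * inverse (sqrt x))) (at x)"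
      by (auto intro!: derivative_eq_intros simp: field_simps)
  next
    fix v :: real
    show "Ck_on k {0<..} (\<lambda>x. (v / 2) * inverse (sqrt x))"
      by (rule Ck_on_linear[OF bounded_linear_mult_right _ Ck_on_compose[OF _ _ Ck_on_inverse Suc]]) auto
  qed simp
qed

lemma smooth_on_differentiable: "smooth_on S f \<Longrightarrow> x \<in> S \<Longrightarrow> f differentiable (at x)"
  unfolding smooth_on_def by (metis Ck_on.simps(2))

lemma smooth_on_derivative: "smooth_on S f \<Longrightarrow> smooth_on S (\<lambda>x. frechet_derivative f (at x) v)"
  unfolding smooth_on_def by (metis Ck_on.simps(2))

lemma smooth_on_continuous: "smooth_on S f \<Longrightarrow> continuous_on S f"
  unfolding smooth_on_def by (metis Ck_on.simps(1))


section \<open>Smooth functions on chart domains and their directional derivatives\<close>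

section \<open>Smooth functions in a chart\<close>

text \<open>Openness of the domain and injectivity of the chart are part of the notion, so that they
  need not be supplied to the closure rules.\<close>

definition chart_open :: "'a chart \<Rightarrow> 'a set \<Rightarrow> bool" where
  "chart_open c U \<longleftrightarrow> open (coord c ` (U \<inter> chart_dom c)) \<and> inj_on (coord c) (chart_dom c)"

definition smooth_in :: "'a chart \<Rightarrow> 'a set \<Rightarrow> ('a \<Rightarrow> 'b::real_normed_vector) \<Rightarrow> bool" where
  "smooth_in c U f \<longleftrightarrow> chart_open c U \<and>
     smooth_on (coord c ` (U \<inter> chart_dom c)) (\<lambda>x. f (param c x))"

lemma param_coord [simp]: "chart_open c U \<Longrightarrow> p \<in> chart_dom c \<Longrightarrow> param c (coord c p) = p"
  by (auto simp: chart_open_def)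

lemma smooth_in_cong:
  assumes "smooth_in c U f" "\<And>p. p \<in> U \<inter> chart_dom c \<Longrightarrow> f p = g p"
  shows "smooth_in c U g"
proof -
  have co: "chart_open c U" using assms by (auto simp: smooth_in_def)
  have eq: "f (param c x) = g (param c x)" if "x \<in> coord c ` (U \<inter> chart_dom c)" for x
    using that assms(2) co by auto
  have op: "open (coord c ` (U \<inter> chart_dom c))" using co by (simp add: chart_open_def)
  have "Ck_on k (coord c ` (U \<inter> chart_dom c)) (\<lambda>x. f (param c x))" for k
    using assms(1) unfolding smooth_in_def smooth_on_def by blast
  from Ck_on_cong[OF op eq this] show ?thesis
    using co unfolding smooth_in_def smooth_on_def by blast
qed

lemma smooth_in_subset: "smooth_in c U f \<Longrightarrow> V \<subseteq> U \<Longrightarrow> chart_open c V \<Longrightarrow> smooth_in c V f"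
  unfolding smooth_in_def smooth_on_def
  by (meson Ck_on_subset image_mono Int_mono order_refl)

lemma smooth_in_const: "chart_open c U \<Longrightarrow> smooth_in c U (\<lambda>_. a)"
  by (auto simp: smooth_in_def smooth_on_def Ck_on_const)

lemma smooth_in_add: "smooth_in c U f \<Longrightarrow> smooth_in c U g \<Longrightarrow> smooth_in c U (\<lambda>p. f p + g p)"
  by (auto simp: smooth_in_def smooth_on_def chart_open_def intro: Ck_on_add)

lemma smooth_in_linear:
  "bounded_linear h \<Longrightarrow> smooth_in c U f \<Longrightarrow> smooth_in c U (\<lambda>p. h (f p))"
  by (auto simp: smooth_in_def smooth_on_def chart_open_def intro: Ck_on_linear)

lemma smooth_in_bilinear:
  "bounded_bilinear h \<Longrightarrow> smooth_in c U f \<Longrightarrow> smooth_in c U g \<Longrightarrow> smooth_in c U (\<lambda>p. h (f p) (g p))"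
  by (auto simp: smooth_in_def smooth_on_def chart_open_def intro: Ck_on_bilinear)

lemmas smooth_in_mult = smooth_in_bilinear[OF bounded_bilinear_mult]
lemmas smooth_in_scaleR = smooth_in_bilinear[OF bounded_bilinear_scaleR]
lemmas smooth_in_inner = smooth_in_bilinear[OF bounded_bilinear_inner]
lemmas smooth_in_nth = smooth_in_linear[OF bounded_linear_vec_nth]
lemmas smooth_in_minus = smooth_in_linear[OF bounded_linear_minus[OF bounded_linear_ident]]

lemma smooth_in_diff: "smooth_in c U f \<Longrightarrow> smooth_in c U g \<Longrightarrow> smooth_in c U (\<lambda>p. f p - g p)"
  using smooth_in_add[of c U f "\<lambda>p. - g p"] smooth_in_minus[of c U g] by simp

lemma smooth_in_sum:
  assumes "chart_open c U" "\<And>i. i \<in> I \<Longrightarrow> smooth_in c U (f i)"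
  shows "smooth_in c U (\<lambda>p. \<Sum>i\<in>I. f i p)"
  using assms(2)
  by (induction I rule: infinite_finite_induct) (auto intro: smooth_in_const smooth_in_add assms)

lemma smooth_in_prod:
  fixes f :: "'i \<Rightarrow> 'a \<Rightarrow> real"
  assumes "chart_open c U" "\<And>i. i \<in> I \<Longrightarrow> smooth_in c U (f i)"
  shows "smooth_in c U (\<lambda>p. \<Prod>i\<in>I. f i p)"
  using assms(2)
  by (induction I rule: infinite_finite_induct) (auto intro: smooth_in_const smooth_in_mult assms)

lemma smooth_in_real_compose:
  assumes "\<And>k. Ck_on k T (h::real \<Rightarrow> real)" "smooth_in c U f" "\<And>p. p \<in> U \<inter> chart_dom c \<Longrightarrow> f p \<in> T"
  shows "smooth_in c U (\<lambda>p. h (f p))"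
proof -
  have co: "chart_open c U" using assms by (auto simp: smooth_in_def)
  have im: "(\<lambda>x. f (param c x)) ` coord c ` (U \<inter> chart_dom c) \<subseteq> T"
    using assms(3) co by auto
  have op: "open (coord c ` (U \<inter> chart_dom c))" using co by (simp add: chart_open_def)
  have "Ck_on k (coord c ` (U \<inter> chart_dom c)) (\<lambda>x. f (param c x))" for k
    using assms(2) unfolding smooth_in_def smooth_on_def by blast
  from Ck_on_compose[OF op im assms(1) this] show ?thesis
    using co unfolding smooth_in_def smooth_on_def by blast
qed

lemma smooth_in_inverse:
  fixes f :: "'a \<Rightarrow> real"
  shows "smooth_in c U f \<Longrightarrow> (\<And>p. p \<in> U \<inter> chart_dom c \<Longrightarrow> f p \<noteq> 0) \<Longrightarrow> smooth_in c U (\<lambda>p. inverse (f p))"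
  by (rule smooth_in_real_compose[OF Ck_on_inverse]) auto

lemma smooth_in_sqrt:
  "smooth_in c U f \<Longrightarrow> (\<And>p. p \<in> U \<inter> chart_dom c \<Longrightarrow> f p > 0) \<Longrightarrow> smooth_in c U (\<lambda>p. sqrt (f p))"
  by (rule smooth_in_real_compose[OF Ck_on_sqrt]) auto

lemma smooth_in_divide:
  fixes f :: "'a \<Rightarrow> real"
  assumes "smooth_in c U f" "smooth_in c U g" "\<And>p. p \<in> U \<inter> chart_dom c \<Longrightarrow> g p \<noteq> 0"
  shows "smooth_in c U (\<lambda>p. f p / g p)"
  using smooth_in_mult[OF assms(1) smooth_in_inverse[OF assms(2,3)]] by (simp add: divide_inverse)

lemma smooth_in_vec:
  fixes f :: "'a \<Rightarrow> ('b::euclidean_space)^'n"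
  assumes "\<And>i. smooth_in c U (\<lambda>p. f p $ i)"
  shows "smooth_in c U f"
proof -
  have eq: "f p = (\<Sum>i\<in>UNIV. axis i (f p $ i))" for p
    by (simp add: vec_eq_iff axis_def if_distrib cong: if_cong)
  have "bounded_linear (axis i :: 'b \<Rightarrow> 'b^'n)" for i
    by (auto intro!: linear_conv_bounded_linear[THEN iffD1] linearI simp: vec_eq_iff axis_def)
  then have "smooth_in c U (\<lambda>p. \<Sum>i\<in>UNIV. axis i (f p $ i))"
    using assms by (intro smooth_in_sum smooth_in_linear[where h="axis _"]) (auto simp: smooth_in_def)
  then show ?thesis by (simp flip: eq)
qed

lemma bounded_bilinear_matrix_mult: "bounded_bilinear ((**) :: real^'n^'m \<Rightarrow> real^'k^'n \<Rightarrow> real^'k^'m)"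
  unfolding bilinear_conv_bounded_bilinear[symmetric] bilinear_def
  by (auto intro!: linearI simp: matrix_matrix_mult_def vec_eq_iff sum.distrib algebra_simps sum_distrib_left)

lemma bounded_bilinear_matrix_vector_mult: "bounded_bilinear ((*v) :: real^'n^'m \<Rightarrow> real^'n \<Rightarrow> real^'m)"
  unfolding bilinear_conv_bounded_bilinear[symmetric] bilinear_def
  by (auto intro!: linearI simp: matrix_vector_mult_def vec_eq_iff sum.distrib algebra_simps sum_distrib_left)

lemmas matrix_vector_mult_scaleR_left = bounded_bilinear.scaleR_left[OF bounded_bilinear_matrix_vector_mult]
lemmas matrix_vector_mult_minus_left = bounded_bilinear.minus_left[OF bounded_bilinear_matrix_vector_mult]

lemma bounded_linear_transpose: "bounded_linear (transpose :: real^'n^'m \<Rightarrow> real^'m^'n)"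
  by (auto intro!: linear_conv_bounded_linear[THEN iffD1] linearI simp: transpose_def vec_eq_iff)

lemma bounded_linear_trace: "bounded_linear (trace :: real^'n^'n \<Rightarrow> real)"
  by (auto intro!: linear_conv_bounded_linear[THEN iffD1] linearI simp: trace_def sum.distrib sum_distrib_left)

lemmas smooth_in_matrix_mult = smooth_in_bilinear[OF bounded_bilinear_matrix_mult]
lemmas smooth_in_matrix_vector_mult = smooth_in_bilinear[OF bounded_bilinear_matrix_vector_mult]
lemmas smooth_in_transpose = smooth_in_linear[OF bounded_linear_transpose]
lemmas smooth_in_trace = smooth_in_linear[OF bounded_linear_trace]

lemma smooth_in_det:
  fixes f :: "'a \<Rightarrow> real^'n^'n"
  assumes "smooth_in c U f"
  shows "smooth_in c U (\<lambda>p. det (f p))"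
  unfolding det_def using assms
  by (intro smooth_in_sum smooth_in_mult smooth_in_const smooth_in_prod smooth_in_nth) (auto simp: smooth_in_def)

lemma smooth_in_matrix:
  fixes f :: "'a \<Rightarrow> real^'n \<Rightarrow> real^'m"
  assumes "\<And>v. smooth_in c U (\<lambda>p. f p v)"
  shows "smooth_in c U (\<lambda>p. matrix (f p))"
  unfolding matrix_def by (intro smooth_in_vec) (simp add: smooth_in_nth[OF assms])

lemma matrix_inv_cancel:
  fixes A :: "real^'n^'n"
  assumes "det A \<noteq> 0"
  shows "A ** matrix_inv A = mat 1" "matrix_inv A ** A = mat 1"
  using someI_ex[of "\<lambda>B. A ** B = mat 1 \<and> B ** A = mat 1"] assms
  unfolding invertible_det_nz[symmetric] invertible_def matrix_inv_def by auto

text \<open>Cramer's rule: as a quotient of determinants the inverse is visibly smooth. The same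
  formula later yields the cofactor identities of a rotation.\<close>

lemma matrix_inv_component:
  fixes A :: "real^'n^'n"
  assumes "det A \<noteq> 0"
  shows "matrix_inv A $ k $ l = det (\<chi> i j. if j = k then axis l 1 $ i else A $ i $ j) / det A"
proof -
  have "A ** matrix_inv A = mat 1"
    using assms by (rule matrix_inv_cancel)
  then have "A *v (matrix_inv A *v axis l 1) = axis l 1"
    by (simp add: matrix_vector_mul_assoc)
  then have "matrix_inv A *v axis l 1 = (\<chi> k. det (\<chi> i j. if j = k then axis l 1 $ i else A $ i $ j) / det A)"
    using cramer[OF assms] by blast
  then have "(matrix_inv A *v axis l 1) $ k = det (\<chi> i j. if j = k then axis l 1 $ i else A $ i $ j) / det A"
    by simp
  moreover have "(matrix_inv A *v axis l 1) $ k = matrix_inv A $ k $ l"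
    by (simp add: matrix_vector_mult_basis column_def)
  ultimately show ?thesis by simp
qed

lemma smooth_in_matrix_inv:
  fixes f :: "'a \<Rightarrow> real^'n^'n"
  assumes f: "smooth_in c U f" and nz: "\<And>p. p \<in> U \<inter> chart_dom c \<Longrightarrow> det (f p) \<noteq> 0"
  shows "smooth_in c U (\<lambda>p. matrix_inv (f p))"
proof (intro smooth_in_vec)
  fix k l
  have co: "chart_open c U" using f by (auto simp: smooth_in_def)
  have "smooth_in c U (\<lambda>p. (\<chi> i j. if j = k then axis l 1 $ i else f p $ i $ j) :: real^'n^'n)"
  proof (intro smooth_in_vec)
    fix i j
    show "smooth_in c U (\<lambda>p. (\<chi> i j. if j = k then axis l 1 $ i else f p $ i $ j) $ i $ j)"
      by (cases "j = k") (auto intro!: smooth_in_const[OF co] smooth_in_nth f)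
  qed
  then have "smooth_in c U (\<lambda>p. det (\<chi> i j. if j = k then axis l 1 $ i else f p $ i $ j) / det (f p))"
    by (intro smooth_in_divide smooth_in_det f nz)
  then show "smooth_in c U (\<lambda>p. matrix_inv (f p) $ k $ l)"
    by (rule smooth_in_cong) (simp add: matrix_inv_component nz)
qed

lemma smooth_in_Complex:
  "smooth_in c U f \<Longrightarrow> smooth_in c U g \<Longrightarrow> smooth_in c U (\<lambda>p. Complex (f p) (g p))"
  unfolding Complex_eq
  by (intro smooth_in_add smooth_in_linear[OF bounded_linear_of_real]
      smooth_in_linear[OF bounded_linear_mult_right])


subsection \<open>Derivatives in a chart\<close>

lemma pd_has_derivative:
  assumes "smooth_in c U f" "p \<in> U" "p \<in> chart_dom c"
  shows "((\<lambda>x. f (param c x)) has_derivative pd c f p) (at (coord c p))"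
proof -
  have "(\<lambda>x. f (param c x)) differentiable at (coord c p)"
    using assms unfolding smooth_in_def by (blast intro: smooth_on_differentiable)
  then show ?thesis unfolding pd_def frechet_derivative_works .
qed

lemma pd_eqI:
  "((\<lambda>x. f (param c x)) has_derivative f') (at (coord c p)) \<Longrightarrow> pd c f p = f'"
  unfolding pd_def by (metis frechet_derivative_at)

lemma linear_pd: "smooth_in c U f \<Longrightarrow> p \<in> U \<Longrightarrow> p \<in> chart_dom c \<Longrightarrow> linear (pd c f p)"
  by (rule has_derivative_linear[OF pd_has_derivative])

lemma smooth_in_pd:
  assumes "smooth_in c U f"
  shows "smooth_in c U (\<lambda>p. pd c f p u)"
proof -
  have co: "chart_open c U" using assms by (auto simp: smooth_in_def)
  let ?S = "coord c ` (U \<inter> chart_dom c)"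
  have 1: "smooth_on ?S (\<lambda>x. frechet_derivative (\<lambda>x. f (param c x)) (at x) u)"
    using assms by (auto simp: smooth_in_def intro: smooth_on_derivative)
  have eq: "frechet_derivative (\<lambda>x. f (param c x)) (at x) u = pd c f (param c x) u" if "x \<in> ?S" for x
    using that co by (auto simp: pd_def)
  have op: "open ?S" using co by (simp add: chart_open_def)
  have "Ck_on k ?S (\<lambda>x. frechet_derivative (\<lambda>x. f (param c x)) (at x) u)" for k
    using 1 unfolding smooth_on_def by blast
  from Ck_on_cong[OF op eq this] show ?thesis
    using co unfolding smooth_in_def smooth_on_def by blast
qed

lemma pd_cong:
  assumes "smooth_in c U f" "p \<in> U" "p \<in> chart_dom c" "\<And>x. x \<in> U \<Longrightarrow> x \<in> chart_dom c \<Longrightarrow> f x = g x"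
  shows "pd c g p = pd c f p"
proof (rule pd_eqI, rule has_derivative_transform_within_open[OF pd_has_derivative[OF assms(1-3)]])
  have co: "chart_open c U" using assms by (auto simp: smooth_in_def)
  show "open (coord c ` (U \<inter> chart_dom c))" using co by (simp add: chart_open_def)
  show "coord c p \<in> coord c ` (U \<inter> chart_dom c)" using assms by auto
  show "\<And>x. x \<in> coord c ` (U \<inter> chart_dom c) \<Longrightarrow> f (param c x) = g (param c x)"
    using co assms(4) by auto
qed

lemma pd_const [simp]: "pd c (\<lambda>_. a) p u = 0"
  by (simp add: pd_def)

context
  fixes c :: "'a chart" and U p
  assumes p: "p \<in> U" "p \<in> chart_dom c"
begin

lemma pd_add: "smooth_in c U f \<Longrightarrow> smooth_in c U g \<Longrightarrow> pd c (\<lambda>x. f x + g x) p u = pd c f p u + pd c g p u"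
  by (rule fun_cong[OF pd_eqI[OF has_derivative_add[OF pd_has_derivative[OF _ p] pd_has_derivative[OF _ p]]]])

lemma pd_linear: "bounded_linear h \<Longrightarrow> smooth_in c U f \<Longrightarrow> pd c (\<lambda>x. h (f x)) p u = h (pd c f p u)"
  by (rule fun_cong[OF pd_eqI[OF bounded_linear.has_derivative[OF _ pd_has_derivative[OF _ p]]]])

lemma pd_bilinear:
  assumes "bounded_bilinear h" "smooth_in c U f" "smooth_in c U g"
  shows "pd c (\<lambda>x. h (f x) (g x)) p u = h (pd c f p u) (g p) + h (f p) (pd c g p u)"
proof -
  have co: "chart_open c U" using assms by (auto simp: smooth_in_def)
  show ?thesis
    using pd_eqI[OF bounded_bilinear.FDERIV[OF assms(1) pd_has_derivative[OF assms(2) p] pd_has_derivative[OF assms(3) p]]]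
    by (simp add: param_coord[OF co p(2)] add.commute)
qed

lemmas pd_scaleR = pd_bilinear[OF bounded_bilinear_scaleR]
lemmas pd_inner = pd_bilinear[OF bounded_bilinear_inner]
lemmas pd_matrix_mult = pd_bilinear[OF bounded_bilinear_matrix_mult]
lemmas pd_matrix_vector_mult = pd_bilinear[OF bounded_bilinear_matrix_vector_mult]
lemmas pd_transpose = pd_linear[OF bounded_linear_transpose]
lemmas pd_nth = pd_linear[OF bounded_linear_vec_nth]
lemmas pd_minus = pd_linear[OF bounded_linear_minus[OF bounded_linear_ident]]

end

lemma matrix_mult_linear: "linear f \<Longrightarrow> matrix f *v x = f x"
  for f :: "real^'n \<Rightarrow> real^'m"
  by (rule fun_cong[OF matrix_vector_mul(2)])

lemma pd_matrix:
  fixes f :: "'a \<Rightarrow> real^'n \<Rightarrow> real^'m"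
  assumes "\<And>v. smooth_in c U (\<lambda>p. f p v)" "p \<in> U" "p \<in> chart_dom c"
    "\<And>x. x \<in> U \<Longrightarrow> x \<in> chart_dom c \<Longrightarrow> linear (f x)"
  shows "pd c (\<lambda>x. f x v) p u = pd c (\<lambda>x. matrix (f x)) p u *v v"
proof -
  have co: "chart_open c U" using assms by (auto simp: smooth_in_def)
  have "pd c (\<lambda>x. f x v) p u = pd c (\<lambda>x. matrix (f x) *v v) p u"
    by (rule fun_cong[OF pd_cong[symmetric, OF assms(1-3)]]) (simp add: assms(4) matrix_mult_linear)
  also have "\<dots> = pd c (\<lambda>x. matrix (f x)) p u *v v"
    by (subst pd_matrix_vector_mult[where U=U])
      (use assms(1-3) co in \<open>auto intro!: smooth_in_matrix smooth_in_const simp: bounded_bilinear.zero_right[OF bounded_bilinear_matrix_vector_mult]\<close>)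
  finally show ?thesis .
qed


section \<open>Matrix algebra: products, transposes, the entrywise inner product, 4x4
  determinants\<close>

section \<open>Matrix algebra\<close>

lemma matrix_mult_scaleR_left: "(r *\<^sub>R A) ** B = r *\<^sub>R (A ** (B :: real^'k^'n))"
  by (rule bounded_bilinear.scaleR_left[OF bounded_bilinear_matrix_mult])

lemma matrix_mult_scaleR_right: "A ** (r *\<^sub>R B) = r *\<^sub>R (A ** (B :: real^'k^'n))"
  by (rule bounded_bilinear.scaleR_right[OF bounded_bilinear_matrix_mult])

lemma matrix_mult_minus_left: "(- A) ** B = - (A ** (B :: real^'k^'n))"
  by (rule bounded_bilinear.minus_left[OF bounded_bilinear_matrix_mult])

lemma matrix_mult_minus_right: "A ** (- B) = - (A ** (B :: real^'k^'n))"
  by (rule bounded_bilinear.minus_right[OF bounded_bilinear_matrix_mult])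

lemma matrix_mult_diff_left: "(A - A') ** B = A ** B - A' ** (B :: real^'k^'n)"
  by (rule bounded_bilinear.diff_left[OF bounded_bilinear_matrix_mult])

lemma matrix_mult_diff_right: "A ** (B - B') = A ** B - A ** (B' :: real^'k^'n)"
  by (rule bounded_bilinear.diff_right[OF bounded_bilinear_matrix_mult])

lemma matrix_mult_add_left: "(A + A') ** B = A ** B + A' ** (B :: real^'k^'n)"
  by (rule bounded_bilinear.add_left[OF bounded_bilinear_matrix_mult])

lemma matrix_mult_zero_left [simp]: "0 ** B = (0 :: real^'k^'n)"
  by (rule bounded_bilinear.zero_left[OF bounded_bilinear_matrix_mult])

lemma matrix_mult_zero_right [simp]: "A ** 0 = (0 :: real^'k^'n)"
  by (rule bounded_bilinear.zero_right[OF bounded_bilinear_matrix_mult])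

lemmas matrix_ring = matrix_add_ldistrib matrix_mult_add_left matrix_mult_scaleR_left
  matrix_mult_scaleR_right matrix_mult_minus_left matrix_mult_minus_right matrix_mult_diff_left
  matrix_mult_diff_right matrix_mul_assoc[symmetric]

lemma transpose_add: "transpose (A + B) = transpose A + transpose (B :: real^'n^'m)"
  and transpose_diff: "transpose (A - B) = transpose A - transpose (B :: real^'n^'m)"
  and transpose_minus: "transpose (- A) = - transpose (A :: real^'n^'m)"
  by (simp_all add: transpose_def vec_eq_iff)

lemmas transpose_ring = transpose_add transpose_diff transpose_minus transpose_scalar matrix_transpose_mul

lemma trace_scaleR: "trace (r *\<^sub>R A) = r * trace (A :: real^'n^'n)"
  by (simp add: trace_def sum_distrib_left)

lemma inner_matrix_left: "(A ** X) \<bullet> Y = X \<bullet> (transpose A ** Y)"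
  for A :: "real^'n^'m" and X :: "real^'k^'n"
proof -
  have "(A ** X) \<bullet> Y = (\<Sum>i\<in>UNIV. \<Sum>k\<in>UNIV. \<Sum>j\<in>UNIV. A$i$j * X$j$k * Y$i$k)"
    by (simp add: inner_vec_def matrix_matrix_mult_def sum_distrib_right)
  also have "\<dots> = (\<Sum>i\<in>UNIV. \<Sum>j\<in>UNIV. \<Sum>k\<in>UNIV. A$i$j * X$j$k * Y$i$k)"
    by (intro sum.cong[OF refl] sum.swap)
  also have "\<dots> = (\<Sum>j\<in>UNIV. \<Sum>i\<in>UNIV. \<Sum>k\<in>UNIV. A$i$j * X$j$k * Y$i$k)"
    by (rule sum.swap)
  also have "\<dots> = (\<Sum>j\<in>UNIV. \<Sum>k\<in>UNIV. \<Sum>i\<in>UNIV. A$i$j * X$j$k * Y$i$k)"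
    by (intro sum.cong[OF refl] sum.swap)
  also have "\<dots> = X \<bullet> (transpose A ** Y)"
    by (simp add: inner_vec_def matrix_matrix_mult_def sum_distrib_left transpose_def mult_ac)
  finally show ?thesis .
qed

lemma inner_transpose: "transpose X \<bullet> transpose Y = X \<bullet> (Y :: real^'n^'m)"
  unfolding inner_vec_def transpose_def by (simp add: inner_real_def) (rule sum.swap)

lemma inner_matrix_right: "(X ** A) \<bullet> Y = X \<bullet> (Y ** transpose A)"
  for A :: "real^'n^'m" and X :: "real^'m^'k"
  using inner_matrix_left[of "transpose A" "transpose X" "transpose Y"]
  by (metis inner_transpose matrix_transpose_mul transpose_transpose)

lemma inner_matrix_vector: "(A *v x) \<bullet> y = x \<bullet> (transpose A *v y)" for A :: "real^'n^'m"
  by (metis dot_lmul_matrix inner_commute transpose_matrix_vector)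

lemma vector_4 [simp]:
  "(vector [x,y,z,w] :: ('a::zero)^4)$1 = x"
  "(vector [x,y,z,w] :: ('a::zero)^4)$2 = y"
  "(vector [x,y,z,w] :: ('a::zero)^4)$3 = z"
  "(vector [x,y,z,w] :: ('a::zero)^4)$4 = w"
  unfolding vector_def by simp_all

lemma det_4:
  "det (A::real^4^4) =
    A$1$1 * (A$2$2 * (A$3$3 * A$4$4 - A$3$4 * A$4$3) - A$2$3 * (A$3$2 * A$4$4 - A$3$4 * A$4$2)
      + A$2$4 * (A$3$2 * A$4$3 - A$3$3 * A$4$2))
  - A$1$2 * (A$2$1 * (A$3$3 * A$4$4 - A$3$4 * A$4$3) - A$2$3 * (A$3$1 * A$4$4 - A$3$4 * A$4$1)
      + A$2$4 * (A$3$1 * A$4$3 - A$3$3 * A$4$1))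
  + A$1$3 * (A$2$1 * (A$3$2 * A$4$4 - A$3$4 * A$4$2) - A$2$2 * (A$3$1 * A$4$4 - A$3$4 * A$4$1)
      + A$2$4 * (A$3$1 * A$4$2 - A$3$2 * A$4$1))
  - A$1$4 * (A$2$1 * (A$3$2 * A$4$3 - A$3$3 * A$4$2) - A$2$2 * (A$3$1 * A$4$3 - A$3$3 * A$4$1)
      + A$2$3 * (A$3$1 * A$4$2 - A$3$2 * A$4$1))"
proof -
  have f1234: "finite {2::4, 3, 4}" "1 \<notin> {2::4, 3, 4}" by auto
  have f234: "finite {3::4, 4}" "2 \<notin> {3::4, 4}" by auto
  have f34: "finite {4::4}" "3 \<notin> {4::4}" by auto
  show ?thesis
    unfolding det_def UNIV_4
    unfolding sum_over_permutations_insert[OF f1234]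
    unfolding sum_over_permutations_insert[OF f234]
    unfolding sum_over_permutations_insert[OF f34]
    unfolding permutes_sing
    by (simp add: sign_swap_id permutation_swap_id sign_compose sign_id swap_id_eq permutation_compose algebra_simps)
qed


section \<open>Quaternions as matrices, SO(4), and the determinant line over one point\<close>

section \<open>Quaternions\<close>

lemma qmul_nth:
  "qmul x y $ 1 = x$1 * y$1 - x$2 * y$2 - x$3 * y$3 - x$4 * y$4"
  "qmul x y $ 2 = x$1 * y$2 + x$2 * y$1 + x$3 * y$4 - x$4 * y$3"
  "qmul x y $ 3 = x$1 * y$3 - x$2 * y$4 + x$3 * y$1 + x$4 * y$2"
  "qmul x y $ 4 = x$1 * y$4 + x$2 * y$3 - x$3 * y$2 + x$4 * y$1"
  by (simp_all add: qmul_def)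

lemma axis_nth4:
  "axis (1::4) x $ 1 = x" "axis (1::4) x $ 2 = 0" "axis (1::4) x $ 3 = 0" "axis (1::4) x $ 4 = 0"
  "axis (2::4) x $ 1 = 0" "axis (2::4) x $ 2 = x" "axis (2::4) x $ 3 = 0" "axis (2::4) x $ 4 = 0"
  "axis (3::4) x $ 1 = 0" "axis (3::4) x $ 2 = 0" "axis (3::4) x $ 3 = x" "axis (3::4) x $ 4 = 0"
  "axis (4::4) x $ 1 = 0" "axis (4::4) x $ 2 = 0" "axis (4::4) x $ 3 = 0" "axis (4::4) x $ 4 = x"
  by (simp_all add: axis_def)

lemma linear_qmul_right: "linear (qmul x)" and linear_qmul_left: "linear (\<lambda>x. qmul x y)"
  by (auto intro!: linearI simp: vec_eq_iff forall_4 qmul_nth algebra_simps)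

definition lmul :: "quat \<Rightarrow> real^4^4" where "lmul q = matrix (qmul q)"
definition rmul :: "quat \<Rightarrow> real^4^4" where "rmul q = matrix (\<lambda>x. qmul x q)"
definition qcnj :: "quat \<Rightarrow> quat" where "qcnj q = vector [q$1, - q$2, - q$3, - q$4]"

lemma lmul_mult_vec [simp]: "lmul q *v v = qmul q v"
  by (simp add: lmul_def matrix_mult_linear linear_qmul_right)

lemma rmul_mult_vec [simp]: "rmul q *v v = qmul v q"
  by (simp add: rmul_def matrix_mult_linear linear_qmul_left)

lemma qcnj_nth: "qcnj q $ 1 = q$1" "qcnj q $ 2 = - q$2" "qcnj q $ 3 = - q$3" "qcnj q $ 4 = - q$4"
  by (simp_all add: qcnj_def)

lemmas quat_nth = qmul_nth qcnj_nth axis_nth4 qone_def qi_def qj_def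

lemma lmul_nth:
  "lmul q $ 1 = vector [q$1, - q$2, - q$3, - q$4]"
  "lmul q $ 2 = vector [q$2, q$1, - q$4, q$3]"
  "lmul q $ 3 = vector [q$3, q$4, q$1, - q$2]"
  "lmul q $ 4 = vector [q$4, - q$3, q$2, q$1]"
  by (simp_all add: lmul_def matrix_def vec_eq_iff forall_4 quat_nth)

lemma rmul_nth:
  "rmul q $ 1 = vector [q$1, - q$2, - q$3, - q$4]"
  "rmul q $ 2 = vector [q$2, q$1, q$4, - q$3]"
  "rmul q $ 3 = vector [q$3, - q$4, q$1, q$2]"
  "rmul q $ 4 = vector [q$4, q$3, - q$2, q$1]"
  by (simp_all add: rmul_def matrix_def vec_eq_iff forall_4 quat_nth)

lemma matrix_mult_nth4: "(A ** B) $ i $ j = A$i$1 * B$1$j + A$i$2 * B$2$j + A$i$3 * B$3$j + A$i$4 * B$4$j"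
  for A B :: "real^4^4"
  by (simp add: matrix_matrix_mult_def sum_4)

lemma matrix_vector_mult_nth4: "(A *v x) $ i = A$i$1 * x$1 + A$i$2 * x$2 + A$i$3 * x$3 + A$i$4 * x$4"
  for A :: "real^4^4"
  by (simp add: matrix_vector_mult_def sum_4)

lemma transpose_nth: "transpose A $ i $ j = A $ j $ i"
  by (simp add: transpose_def)

lemma mat_nth4:
  "mat (1::real) $ (1::4) = vector [1, 0, 0, 0]" "mat (1::real) $ (2::4) = vector [0, 1, 0, 0]"
  "mat (1::real) $ (3::4) = vector [0, 0, 1, 0]" "mat (1::real) $ (4::4) = vector [0, 0, 0, 1]"
  by (simp_all add: mat_def vec_eq_iff forall_4)

lemma lmul_mult: "lmul a ** lmul b = lmul (qmul a b)"
  by (simp add: vec_eq_iff forall_4 matrix_mult_nth4 lmul_nth quat_nth algebra_simps)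

lemma lmul_rmul: "lmul a ** rmul b = rmul b ** lmul a"
  by (simp add: vec_eq_iff forall_4 matrix_mult_nth4 lmul_nth rmul_nth algebra_simps)

lemma lmul_add: "lmul (a + b) = lmul a + lmul b"
  and lmul_diff: "lmul (a - b) = lmul a - lmul b"
  and lmul_scaleR: "lmul (r *\<^sub>R a) = r *\<^sub>R lmul a"
  and lmul_one: "lmul qone = mat 1"
  and transpose_lmul: "transpose (lmul a) = lmul (qcnj a)"
  by (simp_all add: vec_eq_iff forall_4 lmul_nth quat_nth transpose_nth mat_nth4)

lemma trace_lmul: "trace (lmul a) = 4 * a$1"
  by (simp add: trace_def sum_4 lmul_nth)

lemma qmul_assoc: "qmul (qmul x y) z = qmul x (qmul y z)"
  by (simp add: vec_eq_iff forall_4 qmul_nth algebra_simps)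

lemma qmul_one [simp]: "qmul qone x = x" "qmul x qone = x"
  by (simp_all add: vec_eq_iff forall_4 quat_nth)

lemma inner4: "x \<bullet> y = x$1 * y$1 + x$2 * y$2 + x$3 * y$3 + x$4 * y$4" for x y :: "real^4"
  by (simp add: inner_vec_def sum_4)

lemma qmul_qcnj: "qmul (qcnj q) q = (q \<bullet> q) *\<^sub>R qone" "qmul q (qcnj q) = (q \<bullet> q) *\<^sub>R qone"
  by (simp_all add: vec_eq_iff forall_4 quat_nth inner4 algebra_simps)

lemma qcnj_qcnj [simp]: "qcnj (qcnj q) = q"
  by (simp add: vec_eq_iff forall_4 qcnj_nth)

lemma det_lmul: "det (lmul q) = (q \<bullet> q)\<^sup>2"
  by (simp add: det_4 lmul_nth inner4 power2_eq_square algebra_simps)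

lemma imquat_iff: "a \<in> imquat \<longleftrightarrow> a$1 = 0"
  by (simp add: imquat_def)

text \<open>The splitting of so(4) into two copies of so(3), which is the source of the two
  connection forms. The entries (2,1) and (4,3) of the right side are \<open>a$2 - b$2\<close> and
  \<open>a$2 + b$2\<close>, so the witnesses are half sums and half differences; the other two pairs
  behave alike.\<close>

lemma skew_matrix_decompose:
  fixes W :: "real^4^4"
  assumes "transpose W = - W"
  obtains a b where "a \<in> imquat" "b \<in> imquat" "W = lmul a - rmul b"
proof -
  have s: "W $ j $ i = - W $ i $ j" for i j
    using assms by (metis transpose_nth vector_uminus_component)
  have d: "W $ i $ i = 0" for i using s[of i i] by simp
  let ?a = "vector [0, (W$2$1 + W$4$3) / 2, (W$3$1 + W$2$4) / 2, (W$4$1 + W$3$2) / 2] :: quat"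
  let ?b = "vector [0, (W$4$3 - W$2$1) / 2, (W$2$4 - W$3$1) / 2, (W$3$2 - W$4$1) / 2] :: quat"
  have "W = lmul ?a - rmul ?b"
    using s[of 1 2] s[of 1 3] s[of 1 4] s[of 2 3] s[of 2 4] s[of 3 4]
    by (simp add: vec_eq_iff forall_4 lmul_nth rmul_nth d field_simps)
  then show ?thesis by (intro that[of ?a ?b]) (auto simp: imquat_iff)
qed

subsection \<open>SO(4) normalizes the left multiplications\<close>

text \<open>Fixing 1, \<open>S\<close> restricts to a rotation of the imaginary quaternions. There
  the quaternion product consists of the inner product and the cross product, and a rotation
  preserves both.\<close>

lemma SO4_fixing_one_automorphism:
  fixes S :: "real^4^4"
  assumes orth: "transpose S ** S = mat 1" and det: "det S > 0" and one: "S *v qone = qone"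
  shows "S *v qmul v w = qmul (S *v v) (S *v w)"
proof -
  have orth': "S ** transpose S = mat 1" using orth matrix_left_right_inverse by blast
  have one': "transpose S *v qone = qone"
    by (metis one orth matrix_vector_mul_assoc matrix_vector_mul_lid)
  have c: "S$1$1 = 1" "S$2$1 = 0" "S$3$1 = 0" "S$4$1 = 0"
    using one by (simp_all add: vec_eq_iff forall_4 matrix_vector_mult_nth4 quat_nth)
  have r: "S$1$2 = 0" "S$1$3 = 0" "S$1$4 = 0"
    using one' by (simp_all del: transpose_matrix_vector
        add: vec_eq_iff forall_4 matrix_vector_mult_nth4 transpose_nth quat_nth)
  have "(det S)\<^sup>2 = 1"
    using orth by (metis det_I det_mul det_transpose power2_eq_square)
  then have det1: "det S = 1" using det by (simp add: power2_eq_1_iff)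
  have inv: "matrix_inv S = transpose S"
    by (metis det1 matrix_inv_cancel(2) matrix_mul_assoc matrix_mul_lid matrix_mul_rid orth' zero_neq_one)
  \<comment> \<open>The inverse is the transpose and the determinant is 1, so every entry equals its
    cofactor: this is compatibility with the cross product, written out in \<open>k\<close>.\<close>
  have cof: "S $ l $ k = det (\<chi> i j. if j = k then axis l 1 $ i else S $ i $ j)" for k l
    using matrix_inv_component[of S k l] det1 by (simp add: inv transpose_nth)
  have k: "S$2$2 = S$3$3 * S$4$4 - S$3$4 * S$4$3" "S$2$3 = S$3$4 * S$4$2 - S$3$2 * S$4$4"
    "S$2$4 = S$3$2 * S$4$3 - S$3$3 * S$4$2" "S$3$2 = S$4$3 * S$2$4 - S$4$4 * S$2$3"
    "S$3$3 = S$4$4 * S$2$2 - S$4$2 * S$2$4" "S$3$4 = S$4$2 * S$2$3 - S$4$3 * S$2$2"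
    "S$4$2 = S$2$3 * S$3$4 - S$2$4 * S$3$3" "S$4$3 = S$2$4 * S$3$2 - S$2$2 * S$3$4"
    "S$4$4 = S$2$2 * S$3$3 - S$2$3 * S$3$2"
    by (rule trans[OF cof], simp add: det_4 c r axis_nth4 algebra_simps)+
  have n: "S$2$2 * S$2$2 + S$3$2 * S$3$2 + S$4$2 * S$4$2 = 1"
    "S$2$3 * S$2$3 + S$3$3 * S$3$3 + S$4$3 * S$4$3 = 1"
    "S$2$4 * S$2$4 + S$3$4 * S$3$4 + S$4$4 * S$4$4 = 1"
    "S$2$2 * S$2$3 + S$3$2 * S$3$3 + S$4$2 * S$4$3 = 0"
    "S$2$2 * S$2$4 + S$3$2 * S$3$4 + S$4$2 * S$4$4 = 0"
    "S$2$3 * S$2$4 + S$3$3 * S$3$4 + S$4$3 * S$4$4 = 0"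
    using orth by (simp_all add: vec_eq_iff forall_4 matrix_mult_nth4 transpose_nth mat_nth4 c r)
  \<comment> \<open>The real component is grouped so that the inner products of the columns, known
    from \<open>n\<close>, appear as coefficients. The imaginary components below are grouped by the
    2x2 minors of \<open>k\<close>.\<close>
  have "qmul (S *v v) (S *v w) $ 1 = v$1 * w$1
      - (S$2$2 * S$2$2 + S$3$2 * S$3$2 + S$4$2 * S$4$2) * (v$2 * w$2)
      - (S$2$3 * S$2$3 + S$3$3 * S$3$3 + S$4$3 * S$4$3) * (v$3 * w$3)
      - (S$2$4 * S$2$4 + S$3$4 * S$3$4 + S$4$4 * S$4$4) * (v$4 * w$4)
      - (S$2$2 * S$2$3 + S$3$2 * S$3$3 + S$4$2 * S$4$3) * (v$2 * w$3 + v$3 * w$2)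
      - (S$2$2 * S$2$4 + S$3$2 * S$3$4 + S$4$2 * S$4$4) * (v$2 * w$4 + v$4 * w$2)
      - (S$2$3 * S$2$4 + S$3$3 * S$3$4 + S$4$3 * S$4$4) * (v$3 * w$4 + v$4 * w$3)"
    by (simp add: qmul_nth matrix_vector_mult_nth4 c r algebra_simps)
  then have 1: "qmul (S *v v) (S *v w) $ 1 = (S *v qmul v w) $ 1"
    unfolding n by (simp add: qmul_nth matrix_vector_mult_nth4 c r algebra_simps)
  have "qmul (S *v v) (S *v w) $ 2 = v$1 * (S *v w) $ 2 + (S *v v) $ 2 * w$1
      + (S$3$3 * S$4$4 - S$3$4 * S$4$3) * (v$3 * w$4 - v$4 * w$3)
      + (S$3$4 * S$4$2 - S$3$2 * S$4$4) * (v$4 * w$2 - v$2 * w$4)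
      + (S$3$2 * S$4$3 - S$3$3 * S$4$2) * (v$2 * w$3 - v$3 * w$2)"
    by (simp add: qmul_nth matrix_vector_mult_nth4 c r algebra_simps)
  then have 2: "qmul (S *v v) (S *v w) $ 2 = (S *v qmul v w) $ 2"
    unfolding k(1-3)[symmetric] by (simp add: qmul_nth matrix_vector_mult_nth4 c r algebra_simps)
  have "qmul (S *v v) (S *v w) $ 3 = v$1 * (S *v w) $ 3 + (S *v v) $ 3 * w$1
      + (S$4$3 * S$2$4 - S$4$4 * S$2$3) * (v$3 * w$4 - v$4 * w$3)
      + (S$4$4 * S$2$2 - S$4$2 * S$2$4) * (v$4 * w$2 - v$2 * w$4)
      + (S$4$2 * S$2$3 - S$4$3 * S$2$2) * (v$2 * w$3 - v$3 * w$2)"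
    by (simp add: qmul_nth matrix_vector_mult_nth4 c r algebra_simps)
  then have 3: "qmul (S *v v) (S *v w) $ 3 = (S *v qmul v w) $ 3"
    unfolding k(4-6)[symmetric] by (simp add: qmul_nth matrix_vector_mult_nth4 c r algebra_simps)
  have "qmul (S *v v) (S *v w) $ 4 = v$1 * (S *v w) $ 4 + (S *v v) $ 4 * w$1
      + (S$2$3 * S$3$4 - S$2$4 * S$3$3) * (v$3 * w$4 - v$4 * w$3)
      + (S$2$4 * S$3$2 - S$2$2 * S$3$4) * (v$4 * w$2 - v$2 * w$4)
      + (S$2$2 * S$3$3 - S$2$3 * S$3$2) * (v$2 * w$3 - v$3 * w$2)"
    by (simp add: qmul_nth matrix_vector_mult_nth4 c r algebra_simps)
  then have 4: "qmul (S *v v) (S *v w) $ 4 = (S *v qmul v w) $ 4"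
    unfolding k(7-9)[symmetric] by (simp add: qmul_nth matrix_vector_mult_nth4 c r algebra_simps)
  show ?thesis using 1 2 3 4 by (simp add: vec_eq_iff forall_4)
qed

text \<open>With r the image of 1, R is left multiplication by r after an element S that fixes 1,
  hence after an automorphism. Moving left multiplication by q across both factors gives the
  multiplier r (S q) conj(r).\<close>

lemma SO4_normalizes_lmul:
  fixes R :: "real^4^4"
  assumes orth: "transpose R ** R = mat 1" and det: "det R > 0"
  obtains q' where "R ** lmul q = lmul q' ** R"
proof -
  define r where "r = R *v qone"
  define S where "S = lmul (qcnj r) ** R"
  have "r \<bullet> r = qone \<bullet> ((transpose R ** R) *v qone)"
    unfolding r_def inner_matrix_vector matrix_vector_mul_assoc ..
  then have rr: "r \<bullet> r = 1" by (simp add: orth inner4 quat_nth)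
  have l: "lmul r ** lmul (qcnj r) = mat 1"
    by (simp add: lmul_mult qmul_qcnj rr lmul_one)
  have R: "R = lmul r ** S"
    unfolding S_def by (simp add: matrix_mul_assoc l)
  have "transpose S ** S = transpose R ** (lmul r ** lmul (qcnj r)) ** R"
    unfolding S_def by (simp add: transpose_ring transpose_lmul matrix_mul_assoc)
  then have "transpose S ** S = mat 1" by (simp add: l orth)
  moreover have "det S > 0"
  proof -
    have "qcnj r \<bullet> qcnj r = 1" using rr by (simp add: inner4 qcnj_nth)
    then show ?thesis using det by (simp add: S_def det_mul det_lmul)
  qed
  moreover have "S *v qone = qone"
    by (simp add: S_def matrix_vector_mul_assoc[symmetric] r_def[symmetric] qmul_qcnj rr)
  ultimately have S: "S *v qmul v w = qmul (S *v v) (S *v w)" for v w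
    by (rule SO4_fixing_one_automorphism)
  have "(R ** lmul q) *v v = (lmul (qmul (qmul r (S *v q)) (qcnj r)) ** R) *v v" for v
  proof -
    have "qmul (qcnj r) (qmul r x) = x" for x
      by (simp add: qmul_assoc[symmetric] qmul_qcnj rr)
    then show ?thesis
      by (simp add: R matrix_vector_mul_assoc[symmetric] S qmul_assoc)
  qed
  then show ?thesis using that by (metis matrix_eq)
qed

subsection \<open>The bivector model of the determinant line\<close>

text \<open>The frame 1 wedge j over the quaternions themselves. As a matrix it is left
  multiplication by -j, and every U(2)-chart conjugates \<open>kframe\<close> into it.\<close>

definition kref :: "real^4^4" where
  "kref = bivector qone qj - bivector (qmul qi qone) (qmul qi qj)"

lemma kref_nth:
  "kref $ 1 = vector [0, 0, 1, 0]" "kref $ 2 = vector [0, 0, 0, -1]"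
  "kref $ 3 = vector [-1, 0, 0, 0]" "kref $ 4 = vector [0, 1, 0, 0]"
  by (simp_all add: kref_def bivector_def vec_eq_iff forall_4 quat_nth)

text \<open>The two equations cut out a complex line. Its coordinates are read off in the entries
  (1,3) and (1,4), where \<open>kref\<close> has 1, 0 and its multiple by i has 0, 1.\<close>

lemma kref_span:
  assumes "transpose Z = - Z" "lmul qi ** Z ** transpose (lmul qi) = - Z"
  shows "Z = Z$1$3 *\<^sub>R kref + Z$1$4 *\<^sub>R (lmul qi ** kref)"
proof -
  have s: "Z $ j $ i = - Z $ i $ j" for i j
    using assms(1) by (metis transpose_nth vector_uminus_component)
  have d: "Z $ i $ i = 0" for i using s[of i i] by simp
  have e: "(lmul qi ** Z ** transpose (lmul qi)) $ i $ j = - Z $ i $ j" for i j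
    by (simp add: assms(2))
  have z: "Z$1$2 = 0" "Z$3$4 = 0" "Z$2$4 = - Z$1$3" "Z$2$3 = Z$1$4"
    using e[of 1 2] e[of 3 4] e[of 1 3] e[of 1 4] s[of 2 1] s[of 4 3]
    by (simp_all add: lmul_nth matrix_mult_nth4 transpose_nth quat_nth)
  show ?thesis
    by (simp add: vec_eq_iff forall_4 lmul_nth kref_nth d matrix_mult_nth4 quat_nth z
        s[of 2 1] s[of 3 1] s[of 4 1] s[of 3 2] s[of 4 2] s[of 4 3])
qed

text \<open>The value 4 is what the factor 1/4 in \<open>kinner\<close> compensates.\<close>

lemma kref_inner: "kref \<bullet> kref = 4" "kref \<bullet> (lmul qi ** kref) = 0"
  by (simp_all add: inner_vec_def sum_4 lmul_nth kref_nth matrix_mult_nth4 quat_nth)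

text \<open>Since \<open>kref\<close> is left multiplication by -j, it commutes with right
  multiplications, and \<open>b\<close> drops out. The commutator of \<open>a\<close> with -j
  consists of \<open>2 * a$2\<close> times the rotated frame and of a multiple of i; the projection
  removes the latter.\<close>

lemma kref_connection:
  assumes "a \<in> imquat" "b \<in> imquat" "W = lmul a - rmul b" "Z = W ** kref + kref ** transpose W"
  shows "(1/2) *\<^sub>R (Z - lmul qi ** Z ** transpose (lmul qi)) = (2 * a$2) *\<^sub>R (lmul qi ** kref)"
  using assms(1,2)
  by (simp add: assms(3,4) vec_eq_iff forall_4 lmul_nth rmul_nth kref_nth matrix_mult_nth4
      transpose_nth quat_nth imquat_iff algebra_simps)


section \<open>Identities at a point: the derivative of conj(q) i q, and closedness as a divergence
  equation\<close>

subsection \<open>Pointwise identities behind the theorem\<close>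

text \<open>A quaternion minus its conjugate is twice its imaginary part, and \<sigma> is this
  difference for conj(q) i \<beta>. Indeed the terms of \<beta> that contain \<open>a\<close> add up
  to \<open>a$2\<close> i q - q a: the first contributes a real number to conj(q) i \<beta>, the
  second the commutator of \<open>a\<close> with \<open>s\<close>.\<close>

lemma quat_derivative_identity:
  fixes q dq a :: quat
  assumes "a \<in> imquat"
    and "\<beta> = dq + (qmul a q - qmul q a) - (1/2) *\<^sub>R qmul (qmul qi (qmul a qi - qmul qi a)) q"
    and "s = qmul (qcnj q) (qmul qi q)"
    and "\<sigma> = qmul (qcnj dq) (qmul qi q) + qmul (qcnj q) (qmul qi dq) + (qmul a s - qmul s a)"
  shows "2 *\<^sub>R qmul (qcnj q) (qmul qi \<beta>) = \<sigma> + (2 * qmul (qcnj q) (qmul qi \<beta>) $ 1) *\<^sub>R qone" "\<sigma>$1 = 0"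
  using assms(1) unfolding assms(2-4)
  by (simp_all add: vec_eq_iff forall_4 quat_nth imquat_iff algebra_simps)

text \<open>Left multiplication by an imaginary quaternion represents a self-dual 2-form, and for
  self-dual forms the exterior derivative and the divergence are exchanged by the Hodge star. In
  coordinates both conditions become the same four scalar equations.\<close>

lemma self_dual_closed_iff:
  fixes \<sigma> :: "real^4 \<Rightarrow> quat"
  assumes lin: "linear \<sigma>" and im: "\<And>x. \<sigma> x \<in> imquat"
  shows "(\<forall>x y z. qmul (\<sigma> x) y \<bullet> z + qmul (\<sigma> y) z \<bullet> x + qmul (\<sigma> z) x \<bullet> y = 0) \<longleftrightarrow>
     (\<forall>y. (\<Sum>k\<in>UNIV. qmul (\<sigma> (axis k 1)) y $ k) = 0)" (is "?L \<longleftrightarrow> ?R")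
proof -
  have e: "\<sigma> x = x$1 *\<^sub>R \<sigma> (axis 1 1) + x$2 *\<^sub>R \<sigma> (axis 2 1) + x$3 *\<^sub>R \<sigma> (axis 3 1) + x$4 *\<^sub>R \<sigma> (axis 4 1)" for x
  proof -
    have "x = x$1 *\<^sub>R axis 1 1 + x$2 *\<^sub>R axis 2 1 + x$3 *\<^sub>R axis 3 1 + x$4 *\<^sub>R axis 4 1"
      by (simp add: vec_eq_iff forall_4 axis_nth4)
    from arg_cong[OF this, of \<sigma>] show ?thesis
      by (simp only: linear_add[OF lin] linear_scale[OF lin])
  qed
  define t where "t k = \<sigma> (axis k 1)" for k
  have i: "t k $ 1 = 0" for k using im imquat_iff t_def by metis
  have e: "\<sigma> x = x$1 *\<^sub>R t 1 + x$2 *\<^sub>R t 2 + x$3 *\<^sub>R t 3 + x$4 *\<^sub>R t 4" for x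
    using e unfolding t_def .
  \<comment> \<open>One equation for each component of a 3-form, equivalently for each component of
    the divergence.\<close>
  let ?c = "t 2 $ 2 + t 3 $ 3 + t 4 $ 4 = 0 \<and> t 1 $ 2 - t 3 $ 4 + t 4 $ 3 = 0 \<and>
    t 1 $ 3 + t 2 $ 4 - t 4 $ 2 = 0 \<and> t 1 $ 4 - t 2 $ 3 + t 3 $ 2 = 0"
  have "?R \<longleftrightarrow> ?c"
  proof
    assume ?R
    then have "(\<Sum>k\<in>UNIV. qmul (t k) y $ k) = 0" for y by (simp add: t_def)
    from this[of "axis 1 1"] this[of "axis 2 1"] this[of "axis 3 1"] this[of "axis 4 1"]
    show ?c by (simp add: sum_4 quat_nth i; argo)
  next
    assume ?c
    have "(\<Sum>k\<in>UNIV. qmul (t k) y $ k) = y$1 * (t 2 $ 2 + t 3 $ 3 + t 4 $ 4)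
      - y$2 * (t 1 $ 2 - t 3 $ 4 + t 4 $ 3) - y$3 * (t 1 $ 3 + t 2 $ 4 - t 4 $ 2)
      - y$4 * (t 1 $ 4 - t 2 $ 3 + t 3 $ 2)" for y
      by (simp add: sum_4 qmul_nth i algebra_simps)
    with \<open>?c\<close> show ?R by (simp add: t_def)
  qed
  moreover have "?L \<longleftrightarrow> ?c"
  proof
    assume L: ?L
    note C = L[rule_format, unfolded e]
    \<comment> \<open>The four triples of distinct basis vectors isolate the four equations.\<close>
    show ?c
      using C[of "axis 2 1" "axis 3 1" "axis 4 1"] C[of "axis 1 1" "axis 3 1" "axis 4 1"]
        C[of "axis 1 1" "axis 2 1" "axis 4 1"] C[of "axis 1 1" "axis 2 1" "axis 3 1"]
      by (simp add: inner4 quat_nth i algebra_simps)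
  next
    assume c: ?c
    \<comment> \<open>Each equation is solved for one component; after substitution the cyclic sum
      vanishes as a polynomial identity.\<close>
    then have sub: "t 2 $ 2 = - (t 3 $ 3 + t 4 $ 4)" "t 1 $ 2 = t 3 $ 4 - t 4 $ 3"
      "t 1 $ 3 = t 4 $ 2 - t 2 $ 4" "t 1 $ 4 = t 2 $ 3 - t 3 $ 2" by auto
    show ?L
      unfolding e
      by (simp only: inner4 qmul_nth vector_add_component vector_scaleR_component i sub) (simp add: algebra_simps)
  qed
  ultimately show ?thesis by blast
qed


section \<open>Tensor calculus in charts: metric, almost-complex structure, Levi-Civita
  connection\<close>

section \<open>Matrix fields on an almost-Hermitian 4-manifold\<close>

definition gram :: "'a form2_field \<Rightarrow> 'a chart \<Rightarrow> 'a \<Rightarrow> real^4^4" where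
  "gram g c p = (\<chi> i j. g c p (axis i 1) (axis j 1))"

abbreviation mfield :: "'a endo_field \<Rightarrow> 'a chart \<Rightarrow> 'a \<Rightarrow> real^4^4" where
  "mfield F c p \<equiv> matrix (F c p)"

definition nabla :: "'a tensor12_field \<Rightarrow> 'a chart \<Rightarrow> ('a \<Rightarrow> real^4^4) \<Rightarrow> 'a \<Rightarrow> real^4 \<Rightarrow> real^4^4" where
  "nabla \<Gamma> c F p u = pd c F p u + matrix (\<Gamma> c p u) ** F p - F p ** matrix (\<Gamma> c p u)"

text \<open>Regarding the Jacobian as the derivative of a coordinate map lets the general rules for
  \<open>pd\<close> supply its smoothness, linearity and cocycle law.\<close>

lemma jac_eq_pd: "jac c c' p = pd c (coord c') p"
  unfolding jac_def pd_def transition_def by simp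

lemma bilinear_gram:
  assumes "bilinear (b :: real^4 \<Rightarrow> real^4 \<Rightarrow> real)"
  shows "b v w = v \<bullet> ((\<chi> i j. b (axis i 1) (axis j 1)) *v w)"
proof -
  have v: "x = (\<Sum>i\<in>UNIV. x $ i *\<^sub>R axis i 1)" for x :: "real^4"
    by (simp add: vec_eq_iff forall_4 sum_4 axis_nth4)
  have "b v w = b (\<Sum>i\<in>UNIV. v $ i *\<^sub>R axis i 1) (\<Sum>i\<in>UNIV. w $ i *\<^sub>R axis i 1)"
    using v by metis
  also have "\<dots> = (\<Sum>i\<in>UNIV. \<Sum>j\<in>UNIV. v $ i * (w $ j * b (axis i 1) (axis j 1)))"
    using assms
    by (simp add: bilinear_sum sum.cartesian_product bilinear_lmul bilinear_rmul)
  also have "\<dots> = v \<bullet> ((\<chi> i j. b (axis i 1) (axis j 1)) *v w)"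
    by (simp add: inner_vec_def matrix_vector_mult_def sum_distrib_left mult_ac)
  finally show ?thesis .
qed

locale spinor_manifold =
  fixes M :: "'a manifold" and g :: "'a form2_field" and J :: "'a endo_field"
    and \<Gamma> :: "'a tensor12_field" and \<phi> :: "'a endo_field"
  assumes manifold: "oriented_manifold4 M"
    and metric: "riemannian_metric M g"
    and acs: "compatible_acs M g J"
    and levi_civita: "levi_civita M g \<Gamma>"
    and spinor: "plus_spinor M g \<phi>"
    and nonzero: "nowhere_zero M \<phi>"
begin

lemma chart: "c \<in> atlas M \<Longrightarrow> is_chart (top_space M) c"
  using manifold by (auto simp: oriented_manifold4_def)

lemma openin_chart_dom: "c \<in> atlas M \<Longrightarrow> openin (top_space M) (chart_dom c)"
  using chart by (auto simp: is_chart_def)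

lemma chart_dom_subset: "c \<in> atlas M \<Longrightarrow> chart_dom c \<subseteq> topspace (top_space M)"
  using openin_chart_dom openin_subset by blast

lemma chart_openI:
  assumes "c \<in> atlas M" "openin (top_space M) U"
  shows "chart_open c U"
proof -
  have h: "homeomorphic_map (subtopology (top_space M) (chart_dom c)) (top_of_set (coord c ` chart_dom c)) (coord c)"
    and o: "open (coord c ` chart_dom c)"
    using chart[OF assms(1)] by (auto simp: is_chart_def)
  have ts: "topspace (subtopology (top_space M) (chart_dom c)) = chart_dom c"
    using chart_dom_subset[OF assms(1)] by auto
  have "inj_on (coord c) (chart_dom c)"
    using homeomorphic_imp_injective_map[OF h] by (simp only: ts)
  moreover have "openin (subtopology (top_space M) (chart_dom c)) (U \<inter> chart_dom c)"
    using assms(2) by (simp add: openin_subtopology_Int)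
  then have "openin (top_of_set (coord c ` chart_dom c)) (coord c ` (U \<inter> chart_dom c))"
    using homeomorphic_imp_open_map[OF h] by (simp add: open_map_def)
  then have "open (coord c ` (U \<inter> chart_dom c))"
    using o openin_open_trans by blast
  ultimately show ?thesis by (simp add: chart_open_def)
qed

lemma smooth_field_iff:
  assumes "openin (top_space M) U"
  shows "smooth_field M U F \<longleftrightarrow> (\<forall>c\<in>atlas M. smooth_in c U (F c))"
  using chart_openI[OF _ assms] by (auto simp: smooth_field_def smooth_in_def)

lemma smooth_field_global:
  assumes "smooth_field M (topspace (top_space M)) F" "c \<in> atlas M" "openin (top_space M) U"
  shows "smooth_in c U (F c)"
proof -
  have "smooth_in c (topspace (top_space M)) (F c)"
    using assms smooth_field_iff[of "topspace (top_space M)"] by auto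
  then show ?thesis
    by (rule smooth_in_subset) (use assms openin_subset chart_openI in auto)
qed

lemma smooth_in_coord:
  assumes "c \<in> atlas M" "c' \<in> atlas M"
  shows "smooth_in c (chart_dom c') (coord c')"
proof -
  have "smooth_on (coord c ` (chart_dom c \<inter> chart_dom c')) (transition c c')"
    using manifold assms by (auto simp: oriented_manifold4_def)
  then have "smooth_on (coord c ` (chart_dom c' \<inter> chart_dom c)) (\<lambda>x. coord c' (param c x))"
    unfolding transition_def by (simp add: Int_commute)
  then show ?thesis
    using chart_openI[OF assms(1) openin_chart_dom[OF assms(2)]] by (simp add: smooth_in_def)
qed

lemma openin_Int_dom: "c \<in> atlas M \<Longrightarrow> openin (top_space M) U \<Longrightarrow> openin (top_space M) (U \<inter> chart_dom c)"
  using openin_chart_dom by blast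

lemma smooth_in_change_chart:
  assumes c: "c \<in> atlas M" "c' \<in> atlas M" and f: "smooth_in c' U f" and U: "openin (top_space M) U"
  shows "smooth_in c (U \<inter> chart_dom c') f"
proof -
  have co: "chart_open c (U \<inter> chart_dom c')" "chart_open c' U" "chart_open c U"
    using chart_openI openin_Int_dom c U by blast+
  let ?S = "coord c ` (U \<inter> chart_dom c' \<inter> chart_dom c)"
  have op: "open ?S" using co(1) by (simp add: chart_open_def)
  have im: "(\<lambda>x. coord c' (param c x)) ` ?S \<subseteq> coord c' ` (U \<inter> chart_dom c')"
    using co by auto
  have t: "smooth_in c (U \<inter> chart_dom c') (coord c')"
    by (rule smooth_in_subset[OF smooth_in_coord[OF c]]) (use co in auto)
  have "Ck_on k ?S (\<lambda>x. f (param c' (coord c' (param c x))))" for k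
    using Ck_on_compose[OF op im, of k "\<lambda>x. f (param c' x)"] f t
    unfolding smooth_in_def smooth_on_def by blast
  moreover have "f (param c' (coord c' (param c x))) = f (param c x)" if "x \<in> ?S" for x
    using that co by auto
  ultimately have "Ck_on k ?S (\<lambda>x. f (param c x))" for k
    using Ck_on_cong[OF op, of "\<lambda>x. f (param c' (coord c' (param c x)))" "\<lambda>x. f (param c x)" k] by blast
  then show ?thesis using co unfolding smooth_in_def smooth_on_def by blast
qed

lemma pd_change_chart:
  assumes c: "c \<in> atlas M" "c' \<in> atlas M" and f: "smooth_in c' U f" and U: "openin (top_space M) U"
    and p: "p \<in> U" "p \<in> chart_dom c" "p \<in> chart_dom c'"
  shows "pd c f p u = pd c' f p (jac c c' p u)"
proof -
  have co: "chart_open c (U \<inter> chart_dom c')" "chart_open c' U" "chart_open c U"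
    using chart_openI openin_Int_dom c U by blast+
  let ?S = "coord c ` (U \<inter> chart_dom c' \<inter> chart_dom c)"
  have op: "open ?S" using co(1) by (simp add: chart_open_def)
  have t: "((\<lambda>x. coord c' (param c x)) has_derivative jac c c' p) (at (coord c p))"
    unfolding jac_eq_pd by (rule pd_has_derivative[OF smooth_in_coord[OF c]]) (use p in auto)
  have "((\<lambda>x. f (param c' x)) has_derivative pd c' f p) (at (coord c' (param c (coord c p))))"
    using pd_has_derivative[OF f p(1,3)] param_coord[OF co(3) p(2)] by simp
  from diff_chain_at[OF t this]
  have "((\<lambda>x. f (param c' (coord c' (param c x)))) has_derivative (\<lambda>u. pd c' f p (jac c c' p u))) (at (coord c p))"
    by (simp add: o_def)
  then have "((\<lambda>x. f (param c x)) has_derivative (\<lambda>u. pd c' f p (jac c c' p u))) (at (coord c p))"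
    by (rule has_derivative_transform_within_open[OF _ op]) (use p co in auto)
  from pd_eqI[OF this] show ?thesis by (rule fun_cong)
qed

text \<open>The chain rule \<open>pd_change_chart\<close>, applied to the coordinate map of the
  third chart.\<close>

lemma jac_cocycle:
  assumes "c \<in> atlas M" "c' \<in> atlas M" "c'' \<in> atlas M" "p \<in> chart_dom c" "p \<in> chart_dom c'" "p \<in> chart_dom c''"
  shows "jac c' c'' p (jac c c' p u) = jac c c'' p u"
  unfolding jac_eq_pd[of c c''] jac_eq_pd[of c' c'']
  by (rule pd_change_chart[symmetric, OF _ _ smooth_in_coord openin_chart_dom]) (use assms in auto)

lemma linear_jac: "c \<in> atlas M \<Longrightarrow> c' \<in> atlas M \<Longrightarrow> p \<in> chart_dom c \<Longrightarrow> p \<in> chart_dom c' \<Longrightarrow> linear (jac c c' p)"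
  unfolding jac_eq_pd by (rule linear_pd[OF smooth_in_coord])

lemma det_jac: "c \<in> atlas M \<Longrightarrow> c' \<in> atlas M \<Longrightarrow> p \<in> chart_dom c \<Longrightarrow> p \<in> chart_dom c' \<Longrightarrow> det (matrix (jac c c' p)) > 0"
  using manifold by (auto simp: oriented_manifold4_def)

lemma smooth_in_jac:
  assumes "c \<in> atlas M" "c' \<in> atlas M" "openin (top_space M) U" "U \<subseteq> chart_dom c'"
  shows "smooth_in c U (\<lambda>p. jac c c' p u)" "smooth_in c U (\<lambda>p. matrix (jac c c' p))"
proof -
  have *: "smooth_in c U (\<lambda>p. jac c c' p u)" for u
    unfolding jac_eq_pd
    by (rule smooth_in_subset[OF smooth_in_pd[OF smooth_in_coord]]) (use assms chart_openI in auto)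
  then show "smooth_in c U (\<lambda>p. jac c c' p u)" "smooth_in c U (\<lambda>p. matrix (jac c c' p))"
    by (auto intro: smooth_in_matrix)
qed


subsection \<open>The tensors\<close>

lemma endomorphism_field_J: "endomorphism_field M J" and endomorphism_field_spinor: "endomorphism_field M \<phi>"
  using acs spinor by (auto simp: compatible_acs_def plus_spinor_def)

lemma endo_linear: "endomorphism_field M F \<Longrightarrow> c \<in> atlas M \<Longrightarrow> p \<in> chart_dom c \<Longrightarrow> linear (F c p)"
  by (auto simp: endomorphism_field_def)

lemma endo_apply: "endomorphism_field M F \<Longrightarrow> c \<in> atlas M \<Longrightarrow> p \<in> chart_dom c \<Longrightarrow> F c p v = mfield F c p *v v"
  by (simp add: endo_linear matrix_mult_linear)

lemmas J_apply = endo_apply[OF endomorphism_field_J]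
lemmas spinor_apply = endo_apply[OF endomorphism_field_spinor]

lemma endo_smooth:
  assumes "endomorphism_field M F" "c \<in> atlas M" "openin (top_space M) U"
  shows "smooth_in c U (\<lambda>p. F c p v)" "smooth_in c U (mfield F c)"
proof -
  have *: "smooth_in c U (\<lambda>p. F c p v)" for v
    using smooth_field_global[of "\<lambda>c p. F c p v"] assms by (auto simp: endomorphism_field_def)
  then show "smooth_in c U (\<lambda>p. F c p v)" "smooth_in c U (mfield F c)"
    by (auto intro: smooth_in_matrix)
qed

lemma endo_jac:
  assumes F: "endomorphism_field M F" and c: "c \<in> atlas M" "c' \<in> atlas M" "p \<in> chart_dom c" "p \<in> chart_dom c'"
  shows "mfield F c' p ** matrix (jac c c' p) = matrix (jac c c' p) ** mfield F c p"
proof -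
  have "F c' p (jac c c' p v) = jac c c' p (F c p v)" for v
    using F c by (auto simp: endomorphism_field_def)
  then show ?thesis
    unfolding matrix_eq using c
    by (simp add: matrix_vector_mul_assoc[symmetric] matrix_mult_linear endo_linear[OF F] linear_jac)
qed

lemma bilinear_metric: "c \<in> atlas M \<Longrightarrow> p \<in> chart_dom c \<Longrightarrow> bilinear (g c p)"
  and metric_sym: "c \<in> atlas M \<Longrightarrow> p \<in> chart_dom c \<Longrightarrow> g c p v w = g c p w v"
  and metric_pos: "c \<in> atlas M \<Longrightarrow> p \<in> chart_dom c \<Longrightarrow> v \<noteq> 0 \<Longrightarrow> g c p v v > 0"
  and metric_jac: "c \<in> atlas M \<Longrightarrow> c' \<in> atlas M \<Longrightarrow> p \<in> chart_dom c \<Longrightarrow> p \<in> chart_dom c' \<Longrightarrow>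
    g c' p (jac c c' p v) (jac c c' p w) = g c p v w"
  using metric by (auto simp: riemannian_metric_def)

lemma metric_gram: "c \<in> atlas M \<Longrightarrow> p \<in> chart_dom c \<Longrightarrow> g c p v w = v \<bullet> (gram g c p *v w)"
  unfolding gram_def by (rule bilinear_gram[OF bilinear_metric])

lemma transpose_gram: "c \<in> atlas M \<Longrightarrow> p \<in> chart_dom c \<Longrightarrow> transpose (gram g c p) = gram g c p"
  by (simp add: gram_def transpose_def vec_eq_iff metric_sym)

lemma smooth_metric:
  assumes "c \<in> atlas M" "openin (top_space M) U"
  shows "smooth_in c U (\<lambda>p. g c p v w)" "smooth_in c U (gram g c)"
proof -
  have *: "smooth_in c U (\<lambda>p. g c p v w)" for v w
    using smooth_field_global[of "\<lambda>c p. g c p v w"] assms metric by (auto simp: riemannian_metric_def)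
  then show "smooth_in c U (\<lambda>p. g c p v w)" .
  show "smooth_in c U (gram g c)"
    by (intro smooth_in_vec) (simp add: gram_def *)
qed

lemma J_square: "c \<in> atlas M \<Longrightarrow> p \<in> chart_dom c \<Longrightarrow> J c p (J c p v) = - v"
  and J_metric: "c \<in> atlas M \<Longrightarrow> p \<in> chart_dom c \<Longrightarrow> g c p (J c p v) (J c p w) = g c p v w"
  and J_orientation: "c \<in> atlas M \<Longrightarrow> p \<in> chart_dom c \<Longrightarrow>
    det (vector [v, J c p v, w, J c p w] :: real^4^4) \<noteq> 0 \<Longrightarrow>
    det (vector [v, J c p v, w, J c p w] :: real^4^4) > 0"
  using acs by (auto simp: compatible_acs_def)

lemma mfield_J_square: "c \<in> atlas M \<Longrightarrow> p \<in> chart_dom c \<Longrightarrow> mfield J c p ** mfield J c p = - mat 1"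
  unfolding matrix_eq
  by (simp add: matrix_vector_mul_assoc[symmetric] matrix_mult_linear endo_linear[OF endomorphism_field_J] J_square
      matrix_vector_mult_minus_left)

lemma J_skew: "c \<in> atlas M \<Longrightarrow> p \<in> chart_dom c \<Longrightarrow> g c p (J c p v) w = - g c p v (J c p w)"
  using J_metric[of c p v "J c p w"] J_square[of c p w] bilinear_rneg[OF bilinear_metric, of c p "J c p v" w] by simp

lemma affine: "affine_connection M \<Gamma>"
  using levi_civita by (simp add: levi_civita_def)

lemma Gamma_bilinear: "c \<in> atlas M \<Longrightarrow> p \<in> chart_dom c \<Longrightarrow> bilinear (\<Gamma> c p)"
  using affine by (simp add: affine_connection_def)

lemma Gamma_linear: "c \<in> atlas M \<Longrightarrow> p \<in> chart_dom c \<Longrightarrow> linear (\<Gamma> c p u)"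
  using Gamma_bilinear by (auto simp: bilinear_def)

lemma Gamma_apply: "c \<in> atlas M \<Longrightarrow> p \<in> chart_dom c \<Longrightarrow> \<Gamma> c p u v = matrix (\<Gamma> c p u) *v v"
  by (simp add: Gamma_linear matrix_mult_linear)

lemma linear_matrix_Gamma: "c \<in> atlas M \<Longrightarrow> p \<in> chart_dom c \<Longrightarrow> linear (\<lambda>u. matrix (\<Gamma> c p u))"
  using Gamma_bilinear[of c p]
  by (auto intro!: linearI simp: matrix_def vec_eq_iff bilinear_ladd bilinear_lmul)

lemma smooth_Gamma:
  assumes "c \<in> atlas M" "openin (top_space M) U"
  shows "smooth_in c U (\<lambda>p. matrix (\<Gamma> c p u))"
  using smooth_field_global[of "\<lambda>c p. \<Gamma> c p u _"] assms affine
  by (intro smooth_in_matrix) (auto simp: affine_connection_def)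

lemma Gamma_sym: "c \<in> atlas M \<Longrightarrow> p \<in> chart_dom c \<Longrightarrow> \<Gamma> c p u v = \<Gamma> c p v u"
  using levi_civita by (simp add: levi_civita_def covd_def)

lemma Gamma_jac:
  assumes c: "c \<in> atlas M" "c' \<in> atlas M" "p \<in> chart_dom c" "p \<in> chart_dom c'"
  shows "matrix (\<Gamma> c' p (jac c c' p u)) ** matrix (jac c c' p) =
    matrix (jac c c' p) ** matrix (\<Gamma> c p u) - pd c (\<lambda>x. matrix (jac c c' x)) p u"
proof -
  have "pd c (\<lambda>x. jac c c' x v) p u + \<Gamma> c' p (jac c c' p u) (jac c c' p v) = jac c c' p (\<Gamma> c p u v)" for v
    using affine c by (auto simp: affine_connection_def)
  moreover have "pd c (\<lambda>x. jac c c' x v) p u = pd c (\<lambda>x. matrix (jac c c' x)) p u *v v" for v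
    using c by (intro pd_matrix[where U="chart_dom c'"] smooth_in_jac linear_jac openin_chart_dom) auto
  ultimately have "pd c (\<lambda>x. matrix (jac c c' x)) p u *v v + (matrix (\<Gamma> c' p (jac c c' p u)) ** matrix (jac c c' p)) *v v
      = (matrix (jac c c' p) ** matrix (\<Gamma> c p u)) *v v" for v
    using c by (simp add: matrix_vector_mul_assoc[symmetric] matrix_mult_linear Gamma_linear linear_jac)
  then show ?thesis
    unfolding matrix_eq by (simp add: matrix_vector_mult_diff_rdistrib) (metis add_diff_cancel_left')
qed

lemma pd_gram:
  assumes c: "c \<in> atlas M" "p \<in> chart_dom c"
  shows "pd c (gram g c) p u = transpose (matrix (\<Gamma> c p u)) ** gram g c p + gram g c p ** matrix (\<Gamma> c p u)"
proof -
  have U: "openin (top_space M) (chart_dom c)" by (rule openin_chart_dom[OF c(1)])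
  have "pd c (gram g c) p u $ i $ j = pd c (\<lambda>x. g c x (axis i 1) (axis j 1)) p u" for i j
  proof -
    have "pd c (gram g c) p u $ i $ j = pd c (\<lambda>x. gram g c x $ i $ j) p u"
      using pd_nth[OF c(2) c(2), of "\<lambda>x. gram g c x $ i" j u] pd_nth[OF c(2) c(2), of "gram g c" i u]
        smooth_metric(2)[OF c(1) U] smooth_in_nth by metis
    then show ?thesis by (simp add: gram_def)
  qed
  moreover have "pd c (\<lambda>x. g c x v w) p u = g c p (\<Gamma> c p u v) w + g c p v (\<Gamma> c p u w)" for v w
    using levi_civita c by (auto simp: levi_civita_def covd_def)
  moreover have "g c p (\<Gamma> c p u v) w = v \<bullet> ((transpose (matrix (\<Gamma> c p u)) ** gram g c p) *v w)"
    "g c p v (\<Gamma> c p u w) = v \<bullet> ((gram g c p ** matrix (\<Gamma> c p u)) *v w)" for v w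
    unfolding metric_gram[OF c] Gamma_apply[OF c, of u v] Gamma_apply[OF c, of u w]
    by (simp_all only: inner_matrix_vector matrix_vector_mul_assoc)
  moreover have "axis i 1 \<bullet> (A *v axis j 1) = A $ i $ j" for A :: "real^4^4" and i j
    by (simp add: inner_axis' matrix_vector_mult_basis column_def)
  ultimately show ?thesis by (simp add: vec_eq_iff)
qed


subsection \<open>Covariant derivatives of endomorphism fields\<close>

text \<open>Differentiating the transformation law of the endomorphism produces second derivatives
  of the transition map; they cancel against the inhomogeneous term in the law of \<Gamma>.\<close>

lemma nabla_jac:
  assumes c: "c \<in> atlas M" "c' \<in> atlas M" and p: "p \<in> chart_dom c" "p \<in> chart_dom c'"
    and F: "smooth_in c (chart_dom c) (F c)" "smooth_in c' (chart_dom c') (F c')"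
    and law: "\<And>x. x \<in> chart_dom c \<Longrightarrow> x \<in> chart_dom c' \<Longrightarrow>
      F c' x ** matrix (jac c c' x) = matrix (jac c c' x) ** F c x"
  shows "nabla \<Gamma> c' (F c') p (jac c c' p u) ** matrix (jac c c' p) = matrix (jac c c' p) ** nabla \<Gamma> c (F c) p u"
proof -
  let ?U = "chart_dom c \<inter> chart_dom c'" and ?P = "\<lambda>x. matrix (jac c c' x)"
  have o: "openin (top_space M) ?U" using openin_chart_dom c by blast
  have co: "chart_open c ?U" "chart_open c' ?U" using chart_openI o c by blast+
  have F': "smooth_in c ?U (F c')"
    using smooth_in_change_chart[OF c F(2) openin_chart_dom[OF c(2)]] by (rule smooth_in_subset) (use co in auto)
  have F0: "smooth_in c ?U (F c)"
    using F(1) by (rule smooth_in_subset) (use co in auto)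
  have P: "smooth_in c ?U ?P" using smooth_in_jac(2)[OF c o] by simp
  have pU: "p \<in> ?U" using p by simp
  have "pd c (\<lambda>x. F c' x ** ?P x) p = pd c (\<lambda>x. ?P x ** F c x) p"
    by (rule pd_cong[OF smooth_in_matrix_mult[OF P F0] pU p(1)]) (use law in auto)
  then have eq: "pd c (F c') p u ** ?P p + F c' p ** pd c ?P p u = pd c ?P p u ** F c p + ?P p ** pd c (F c) p u"
    using pd_matrix_mult[OF pU p(1) F' P, of u] pd_matrix_mult[OF pU p(1) P F0, of u] by simp
  have ch: "pd c' (F c') p (jac c c' p u) = pd c (F c') p u"
    using pd_change_chart[OF c F(2) openin_chart_dom[OF c(2)]] p by simp
  note G = Gamma_jac[OF c p, of u]
  have "nabla \<Gamma> c' (F c') p (jac c c' p u) ** ?P p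
    = pd c (F c') p u ** ?P p + matrix (\<Gamma> c' p (jac c c' p u)) ** ?P p ** F c p
      - F c' p ** (matrix (\<Gamma> c' p (jac c c' p u)) ** ?P p)"
    unfolding nabla_def ch by (simp add: matrix_ring law p)
  also have "\<dots> = ?P p ** nabla \<Gamma> c (F c) p u"
    unfolding G nabla_def using eq law[OF p]
    by (simp add: matrix_ring) (simp add: matrix_mul_assoc algebra_simps)
  finally show ?thesis .
qed

lemma smooth_nabla:
  assumes "c \<in> atlas M" "openin (top_space M) U" "smooth_in c U F"
  shows "smooth_in c U (\<lambda>p. nabla \<Gamma> c F p u)"
  unfolding nabla_def
  by (intro smooth_in_add smooth_in_diff smooth_in_matrix_mult smooth_in_pd smooth_Gamma assms)

lemma linear_nabla:
  assumes "c \<in> atlas M" "p \<in> chart_dom c" "p \<in> U" "smooth_in c U F"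
  shows "linear (\<lambda>u. nabla \<Gamma> c F p u)"
  by (auto intro!: linearI simp: nabla_def linear_add[OF linear_pd[OF assms(4,3,2)]]
      linear_add[OF linear_matrix_Gamma[OF assms(1,2)]] linear_scale[OF linear_pd[OF assms(4,3,2)]]
      linear_scale[OF linear_matrix_Gamma[OF assms(1,2)]] matrix_ring algebra_simps)

end


lemma matrix_cancel_left: "B ** A = mat 1 \<Longrightarrow> A ** X = A ** Y \<Longrightarrow> X = Y"
  for A B X Y :: "real^'n^'n"
  by (metis matrix_mul_assoc matrix_mul_lid)

lemma bounded_linear_lmul: "bounded_linear lmul"
  by (auto intro!: linear_conv_bounded_linear[THEN iffD1] linearI simp: lmul_add lmul_scaleR)

lemma bounded_linear_qcnj: "bounded_linear qcnj"
  by (auto intro!: linear_conv_bounded_linear[THEN iffD1] linearI simp: vec_eq_iff forall_4 qcnj_nth)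

lemma bounded_bilinear_qmul: "bounded_bilinear qmul"
  unfolding bilinear_conv_bounded_bilinear[symmetric] bilinear_def
  using linear_qmul_left linear_qmul_right by auto

context spinor_manifold
begin

section \<open>Moving frames: connection forms, spinors in a U(2)-chart, existence of such
  charts\<close>

subsection \<open>U(2)-charts\<close>

lemma oriented_isometryD:
  assumes c: "c \<in> atlas M" "p \<in> chart_dom c" and L: "oriented_isometry g c p L"
  shows "linear L" "transpose (matrix L) ** matrix L = gram g c p" "det (matrix L) > 0"
proof -
  show l: "linear L" "det (matrix L) > 0" using L by (auto simp: oriented_isometry_def)
  have "axis i 1 \<bullet> (A *v axis j 1) = A $ i $ j" for A :: "real^4^4" and i j
    by (simp add: inner_axis' matrix_vector_mult_basis column_def)
  moreover have "v \<bullet> ((transpose (matrix L) ** matrix L) *v w) = v \<bullet> (gram g c p *v w)" for v w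
  proof -
    have "v \<bullet> ((transpose (matrix L) ** matrix L) *v w) = (matrix L *v v) \<bullet> (matrix L *v w)"
      by (simp only: inner_matrix_vector matrix_vector_mul_assoc)
    then show ?thesis
      using L by (simp add: matrix_mult_linear l oriented_isometry_def metric_gram[OF c])
  qed
  ultimately show "transpose (matrix L) ** matrix L = gram g c p"
    unfolding vec_eq_iff by metis
qed

context
  fixes U E
  assumes E: "u2_chart M g J U E"
begin

lemma u2_openin: "openin (top_space M) U"
  using E by (simp add: u2_chart_def)

lemma u2_isometry: "c \<in> atlas M \<Longrightarrow> p \<in> U \<Longrightarrow> p \<in> chart_dom c \<Longrightarrow> oriented_isometry g c p (E c p)"
  using E by (auto simp: u2_chart_def)

lemma u2_linear: "c \<in> atlas M \<Longrightarrow> p \<in> U \<Longrightarrow> p \<in> chart_dom c \<Longrightarrow> linear (E c p)"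
  using u2_isometry oriented_isometryD(1) by blast

lemma u2_apply: "c \<in> atlas M \<Longrightarrow> p \<in> U \<Longrightarrow> p \<in> chart_dom c \<Longrightarrow> E c p v = mfield E c p *v v"
  by (simp add: u2_linear matrix_mult_linear)

lemma u2_gram: "c \<in> atlas M \<Longrightarrow> p \<in> U \<Longrightarrow> p \<in> chart_dom c \<Longrightarrow>
    transpose (mfield E c p) ** mfield E c p = gram g c p"
  using u2_isometry oriented_isometryD(2) by blast

lemma u2_det: "c \<in> atlas M \<Longrightarrow> p \<in> U \<Longrightarrow> p \<in> chart_dom c \<Longrightarrow> det (mfield E c p) > 0"
  using u2_isometry oriented_isometryD(3) by blast

lemma u2_inverse:
  assumes "c \<in> atlas M" "p \<in> U" "p \<in> chart_dom c"
  shows "mfield E c p ** matrix_inv (mfield E c p) = mat 1" "matrix_inv (mfield E c p) ** mfield E c p = mat 1"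
  using matrix_inv_cancel[of "mfield E c p"] u2_det[OF assms] by auto

lemma u2_J:
  assumes "c \<in> atlas M" "p \<in> U" "p \<in> chart_dom c"
  shows "mfield E c p ** mfield J c p = lmul qi ** mfield E c p"
proof -
  have "E c p (J c p v) = qmul qi (E c p v)" for v
    using E assms by (auto simp: u2_chart_def)
  then show ?thesis
    unfolding matrix_eq matrix_vector_mul_assoc[symmetric]
    using assms by (simp add: matrix_mult_linear u2_linear endo_linear[OF endomorphism_field_J])
qed

lemma u2_jac:
  assumes c: "c \<in> atlas M" "c' \<in> atlas M" "p \<in> U" "p \<in> chart_dom c" "p \<in> chart_dom c'"
  shows "mfield E c' p ** matrix (jac c c' p) = mfield E c p"
proof -
  have "E c' p (jac c c' p v) = E c p v" for v
    using E c by (auto simp: u2_chart_def)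
  then show ?thesis
    unfolding matrix_eq matrix_vector_mul_assoc[symmetric]
    using c by (simp add: matrix_mult_linear u2_linear linear_jac)
qed

lemma u2_smooth:
  assumes "c \<in> atlas M"
  shows "smooth_in c U (\<lambda>p. E c p v)" "smooth_in c U (mfield E c)"
    "smooth_in c U (\<lambda>p. matrix_inv (mfield E c p))"
proof -
  have *: "smooth_in c U (\<lambda>p. E c p v)" for v
  proof -
    have "smooth_field M U (\<lambda>c p. E c p v)" using E by (auto simp: u2_chart_def)
    then show ?thesis using assms smooth_field_iff[OF u2_openin, of "\<lambda>c p. E c p v"] by auto
  qed
  then show "smooth_in c U (\<lambda>p. E c p v)" and **: "smooth_in c U (mfield E c)"
    by (auto intro: smooth_in_matrix)
  show "smooth_in c U (\<lambda>p. matrix_inv (mfield E c p))"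
    by (rule smooth_in_matrix_inv[OF **]) (use u2_det[OF assms] in force)
qed

lemma conn_forms_iff:
  assumes c: "c \<in> atlas M" "p \<in> U" "p \<in> chart_dom c"
  shows "conn_forms \<Gamma> E c p u a b \<longleftrightarrow> a \<in> imquat \<and> b \<in> imquat \<and>
    mfield E c p ** matrix (\<Gamma> c p u) = pd c (mfield E c) p u + (lmul a - rmul b) ** mfield E c p"
proof -
  have "pd c (\<lambda>x. E c x v) p u = pd c (mfield E c) p u *v v" for v
    by (rule pd_matrix[where U=U]) (use c u2_smooth u2_linear in auto)
  then show ?thesis
    unfolding conn_forms_def matrix_eq
    using c by (simp add: covd_def matrix_vector_mul_assoc[symmetric] matrix_mult_linear u2_linear Gamma_linear
        matrix_vector_mult_add_rdistrib matrix_vector_mult_diff_rdistrib add_diff_eq)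
qed

text \<open>Metricity makes the connection matrix in an orthonormal frame skew, and a skew matrix is
  a left minus a right multiplication by imaginary quaternions.\<close>

lemma conn_forms_exist:
  assumes c: "c \<in> atlas M" "p \<in> U" "p \<in> chart_dom c"
  obtains a b where "conn_forms \<Gamma> E c p u a b"
proof -
  define F where "F = matrix_inv (mfield E c p)"
  \<comment> \<open>\<open>Y ** F\<close> is the connection matrix in the frame. Its skewness
    results from comparing the derivative of \<open>transpose E ** E\<close> with that of the Gram
    matrix.\<close>
  define Y where "Y = mfield E c p ** matrix (\<Gamma> c p u) - pd c (mfield E c) p u"
  have FE: "F ** mfield E c p = mat 1" and EF: "mfield E c p ** F = mat 1"
    unfolding F_def using u2_inverse[OF c] by auto
  note sm = u2_smooth(2)[OF c(1)]
  have "pd c (gram g c) p u = pd c (\<lambda>x. transpose (mfield E c x) ** mfield E c x) p u"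
    by (rule fun_cong[OF pd_cong[OF smooth_in_matrix_mult[OF smooth_in_transpose[OF sm] sm] c(2,3)]])
      (use u2_gram c in auto)
  also have "\<dots> = transpose (pd c (mfield E c) p u) ** mfield E c p + transpose (mfield E c p) ** pd c (mfield E c) p u"
    by (simp add: pd_matrix_mult[OF c(2,3) smooth_in_transpose[OF sm] sm] pd_transpose[OF c(2,3) sm])
  finally have "transpose (pd c (mfield E c) p u) ** mfield E c p + transpose (mfield E c p) ** pd c (mfield E c) p u
      = transpose (matrix (\<Gamma> c p u)) ** gram g c p + gram g c p ** matrix (\<Gamma> c p u)"
    using pd_gram[OF c(1,3)] by simp
  then have skew: "transpose Y ** mfield E c p = - (transpose (mfield E c p) ** Y)"
    unfolding Y_def u2_gram[OF c, symmetric] by (simp add: transpose_ring matrix_ring algebra_simps)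
  have EF': "transpose F ** transpose (mfield E c p) = mat 1"
    by (metis EF matrix_transpose_mul transpose_mat)
  have "transpose (Y ** F) = transpose F ** (transpose Y ** mfield E c p) ** F"
    by (simp add: transpose_ring matrix_mul_assoc[symmetric] EF)
  also have "\<dots> = - (transpose F ** transpose (mfield E c p) ** (Y ** F))"
    by (simp add: skew matrix_ring)
  also have "\<dots> = - (Y ** F)" by (simp add: EF')
  finally obtain a b where "a \<in> imquat" "b \<in> imquat" "Y ** F = lmul a - rmul b"
    by (rule skew_matrix_decompose)
  moreover have "Y = (Y ** F) ** mfield E c p"
    by (simp add: matrix_mul_assoc[symmetric] FE)
  ultimately have "conn_forms \<Gamma> E c p u a b"
    unfolding conn_forms_iff[OF c] by (metis Y_def add.commute diff_add_cancel)
  then show ?thesis by (rule that)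
qed

text \<open>Right multiplications commute with left ones, so only the commutator with the left
  connection form survives.\<close>

lemma nabla_frame:
  assumes c: "c \<in> atlas M" "p \<in> U" "p \<in> chart_dom c"
    and ab: "conn_forms \<Gamma> E c p u a b"
    and F: "smooth_in c U F" and q: "smooth_in c U q"
    and law: "\<And>x. x \<in> U \<Longrightarrow> x \<in> chart_dom c \<Longrightarrow> mfield E c x ** F x = lmul (q x) ** mfield E c x"
  shows "mfield E c p ** nabla \<Gamma> c F p u
    = lmul (pd c q p u + (qmul a (q p) - qmul (q p) a)) ** mfield E c p"
proof -
  let ?E = "mfield E c" and ?G = "matrix (\<Gamma> c p u)"
  note sE = u2_smooth(2)[OF c(1)] and slq = smooth_in_linear[OF bounded_linear_lmul q]
  have "pd c (\<lambda>x. ?E x ** F x) p = pd c (\<lambda>x. lmul (q x) ** ?E x) p"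
    by (rule pd_cong[OF smooth_in_matrix_mult[OF slq sE] c(2,3)]) (use law in auto)
  then have d: "pd c ?E p u ** F p + ?E p ** pd c F p u = lmul (pd c q p u) ** ?E p + lmul (q p) ** pd c ?E p u"
    using pd_matrix_mult[OF c(2,3) sE F, of u] pd_matrix_mult[OF c(2,3) slq sE, of u]
      pd_linear[OF c(2,3) bounded_linear_lmul q, of u] by simp
  have W: "?E p ** ?G = pd c ?E p u + (lmul a - rmul b) ** ?E p"
    using ab conn_forms_iff[OF c] by blast
  note l = law[OF c(2,3)]
  have EFX: "?E p ** (F p ** X) = lmul (q p) ** (?E p ** X)" for X
    by (simp only: matrix_mul_assoc l)
  have EGX: "?E p ** (?G ** X) = pd c ?E p u ** X + (lmul a - rmul b) ** (?E p ** X)" for X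
    by (simp add: matrix_mul_assoc W matrix_mult_add_left)
  have ll: "lmul x ** (lmul y ** X) = lmul (qmul x y) ** X" for x y X
    by (simp add: matrix_mul_assoc lmul_mult)
  have rl: "rmul b ** (lmul y ** X) = lmul y ** (rmul b ** X)" for y X
    by (simp add: matrix_mul_assoc lmul_rmul)
  have d': "?E p ** pd c F p u = lmul (pd c q p u) ** ?E p + lmul (q p) ** pd c ?E p u - pd c ?E p u ** F p"
    using d by (simp add: algebra_simps)
  show ?thesis
    unfolding nabla_def
    by (simp add: matrix_ring EFX EGX d' l W lmul_add lmul_diff ll rl)
qed

text \<open>The isometry that witnesses membership in PSO+ is unrelated to the frame, but the two
  differ by an element of SO(4), which normalizes the left multiplications.\<close>

lemma u2_spinor:
  assumes c: "c \<in> atlas M" "p \<in> U" "p \<in> chart_dom c"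
  obtains q where "mfield E c p ** mfield \<phi> c p = lmul q ** mfield E c p"
proof -
  have "\<exists>L q. oriented_isometry g c p L \<and> (\<forall>v. L (\<phi> c p v) = qmul q (L v))"
    using spinor c unfolding plus_spinor_def by auto
  then obtain L q where L: "oriented_isometry g c p L" and Lq: "\<And>v. L (\<phi> c p v) = qmul q (L v)"
    by blast
  note L' = oriented_isometryD[OF c(1,3) L]
  define N where "N = matrix_inv (matrix L)"
  have LN: "matrix L ** N = mat 1" and NL: "N ** matrix L = mat 1"
    unfolding N_def using matrix_inv_cancel[of "matrix L"] L'(3) by auto
  have Lphi: "matrix L ** mfield \<phi> c p = lmul q ** matrix L"
    unfolding matrix_eq matrix_vector_mul_assoc[symmetric]
    using c by (simp add: matrix_mult_linear L'(1) endo_linear[OF endomorphism_field_spinor] Lq)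
  define R where "R = mfield E c p ** N"
  have "transpose R ** R = transpose N ** (transpose (matrix L) ** matrix L) ** N"
    unfolding R_def L'(2) u2_gram[OF c, symmetric] by (simp add: transpose_ring matrix_mul_assoc)
  also have "\<dots> = transpose (matrix L ** N) ** (matrix L ** N)"
    by (simp add: transpose_ring matrix_mul_assoc)
  finally have orth: "transpose R ** R = mat 1" by (simp add: LN)
  have "det (matrix L) * det N = 1" by (metis LN det_I det_mul)
  then have "det N > 0" using L'(3) by (metis zero_less_mult_pos zero_less_one)
  then have "det R > 0" by (simp add: R_def det_mul u2_det[OF c])
  with orth obtain q' where q': "R ** lmul q = lmul q' ** R" by (rule SO4_normalizes_lmul)
  have E: "mfield E c p = R ** matrix L"
    by (simp add: R_def matrix_mul_assoc[symmetric] NL)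
  have "mfield E c p ** mfield \<phi> c p = lmul q' ** mfield E c p"
    unfolding E by (metis Lphi matrix_mul_assoc q')
  then show ?thesis by (rule that)
qed

lemma u2_spinor_smooth:
  assumes c: "c \<in> atlas M"
  obtains q where "smooth_in c U q"
    "\<And>p. p \<in> U \<Longrightarrow> p \<in> chart_dom c \<Longrightarrow> mfield E c p ** mfield \<phi> c p = lmul (q p) ** mfield E c p"
proof -
  \<comment> \<open>Left multiplication by a quaternion sends 1 to that quaternion. Evaluating at 1
    thus recovers the pointwise multiplier by a smooth formula.\<close>
  define q where "q p = (mfield E c p ** mfield \<phi> c p ** matrix_inv (mfield E c p)) *v qone" for p
  have "smooth_in c U q"
    unfolding q_def
    by (intro smooth_in_matrix_vector_mult smooth_in_matrix_mult u2_smooth endo_smooth smooth_in_const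
        chart_openI endomorphism_field_spinor u2_openin c)
  moreover have "mfield E c p ** mfield \<phi> c p = lmul (q p) ** mfield E c p" if p: "p \<in> U" "p \<in> chart_dom c" for p
  proof -
    obtain q' where q': "mfield E c p ** mfield \<phi> c p = lmul q' ** mfield E c p"
      using u2_spinor[OF c p] .
    have "q p = q'"
      unfolding q_def q' by (simp add: matrix_mul_assoc[symmetric] u2_inverse[OF c p])
    then show ?thesis using q' by simp
  qed
  ultimately show ?thesis by (rule that)
qed

end


subsection \<open>Existence of U(2)-charts\<close>

text \<open>\<open>R ** gram\<close> takes a vector to its components in the basis e, Je, f, Jf.
  These correspond to 1, i, j, k, and since i 1 = i and i j = k, J becomes left multiplication by
  i.\<close>

lemma hermitian_frame:
  assumes c: "c \<in> atlas M" "p \<in> chart_dom c"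
    and e: "g c p e e = 1" "g c p f f = 1" "g c p e f = 0" "g c p (J c p e) f = 0"
  defines "R \<equiv> vector [e, J c p e, f, J c p f] :: real^4^4"
  shows "transpose (R ** gram g c p) ** (R ** gram g c p) = gram g c p"
    "det (R ** gram g c p) > 0"
    "(R ** gram g c p) ** mfield J c p = lmul qi ** (R ** gram g c p)"
proof -
  let ?G = "gram g c p" and ?J = "mfield J c p"
  have sk: "g c p (J c p v) v = 0" for v
    using J_skew[OF c, of v v] metric_sym[OF c, of v "J c p v"] by simp
  have sk': "g c p v (J c p v) = 0" for v using sk metric_sym[OF c] by metis
  have ef: "g c p e (J c p f) = 0" using J_skew[OF c, of e f] e by simp
  have fe: "g c p f e = 0" "g c p f (J c p e) = 0" "g c p (J c p f) e = 0" "g c p (J c p f) (J c p e) = 0"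
    using e ef metric_sym[OF c] J_metric[OF c] by metis+
  have row: "(R ** ?G ** transpose R) $ i $ j = R $ i \<bullet> (?G *v R $ j)" for i j
    by (simp add: matrix_mult_nth4 transpose_nth matrix_vector_mult_nth4 inner4 algebra_simps)
  have RGR: "R ** ?G ** transpose R = mat 1"
    unfolding vec_eq_iff[where 'b=4] vec_eq_iff row forall_4
    by (simp add: R_def mat_nth4 metric_gram[OF c, symmetric] e fe ef sk sk' J_metric[OF c])
  have GRR: "transpose R ** (R ** ?G) = mat 1"
    using RGR matrix_left_right_inverse by blast
  show "transpose (R ** ?G) ** (R ** ?G) = ?G"
    by (simp add: transpose_ring transpose_gram[OF c] matrix_mul_assoc[symmetric] GRR)
  have "det (R ** ?G) * det R = 1" using RGR by (metis det_I det_mul det_transpose)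
  \<comment> \<open>The preceding product makes the determinant nonzero; that J induces the
    orientation then decides its sign.\<close>
  moreover from this have "det R > 0"
    unfolding R_def by (intro J_orientation[OF c]) (auto simp: R_def)
  ultimately show "det (R ** ?G) > 0" by (metis zero_less_mult_pos2 zero_less_one)
  have "(?J ** transpose R) $ i $ j = (transpose R ** lmul qi) $ i $ j" for i j
  proof -
    have "(?J ** transpose R) $ i $ j = (?J *v R $ j) $ i"
      by (simp add: matrix_mult_nth4 matrix_vector_mult_nth4 transpose_nth)
    also have "\<dots> = J c p (R $ j) $ i"
      by (simp add: J_apply[OF c])
    also have "\<dots> = (transpose R ** lmul qi) $ i $ j"
      using exhaust_4[of j]
      by (auto simp: R_def matrix_mult_nth4 transpose_nth lmul_nth quat_nth J_square[OF c])
    finally show ?thesis .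
  qed
  then have "?J ** transpose R = transpose R ** lmul qi" by (simp add: vec_eq_iff)
  then have "(R ** ?G) ** (?J ** transpose R) ** (R ** ?G) = (R ** ?G ** transpose R) ** lmul qi ** (R ** ?G)"
    by (simp add: matrix_mul_assoc)
  then show "(R ** ?G) ** ?J = lmul qi ** (R ** ?G)"
    unfolding RGR by (simp add: matrix_mul_assoc[symmetric] GRR)
qed

text \<open>Complex Gram-Schmidt: a constant field is normalized to \<open>e\<close>, and a second
  constant field is projected off \<open>e\<close> and Je and normalized to \<open>f\<close>. The
  chart is restricted to the open set where this projection does not vanish.\<close>

lemma u2_chart_exists:
  assumes c0: "c0 \<in> atlas M" and p0: "p0 \<in> chart_dom c0"
  obtains U E where "u2_chart M g J U E" "p0 \<in> U"
proof -
  let ?D = "chart_dom c0" and ?g = "g c0" and ?J = "J c0"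
  have oD: "openin (top_space M) ?D" by (rule openin_chart_dom[OF c0])
  have coD: "chart_open c0 ?D" by (rule chart_openI[OF c0 oD])
  define v0 :: "real^4" where "v0 = axis 1 1"
  have v0: "v0 \<noteq> 0" by (simp add: v0_def)
  define e where "e p = (1 / sqrt (?g p v0 v0)) *\<^sub>R v0" for p
  have e1: "?g p (e p) (e p) = 1" if "p \<in> ?D" for p
    using metric_pos[OF c0 that v0]
    by (simp add: e_def bilinear_lmul[OF bilinear_metric[OF c0 that]] bilinear_rmul[OF bilinear_metric[OF c0 that]])
  define w where "w k p = axis k 1 - ?g p (e p) (axis k 1) *\<^sub>R e p - ?g p (?J p (e p)) (axis k 1) *\<^sub>R ?J p (e p)"
    for k :: 4 and p
  have sg: "smooth_in c0 ?D (\<lambda>p. ?g p (x p) (y p))" if "smooth_in c0 ?D x" "smooth_in c0 ?D y" for x y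
    by (rule smooth_in_cong[OF smooth_in_inner[OF that(1) smooth_in_matrix_vector_mult[OF smooth_metric(2)[OF c0 oD] that(2)]]])
      (use metric_gram[OF c0] in auto)
  have sJ: "smooth_in c0 ?D (\<lambda>p. ?J p (x p))" if "smooth_in c0 ?D x" for x
    by (rule smooth_in_cong[OF smooth_in_matrix_vector_mult[OF endo_smooth(2)[OF endomorphism_field_J c0 oD] that]])
      (use J_apply[OF c0] in auto)
  have se: "smooth_in c0 ?D e"
    unfolding e_def using metric_pos[OF c0 _ v0]
    by (intro smooth_in_scaleR smooth_in_const coD smooth_in_divide smooth_in_sqrt sg) (auto simp: less_le)
  have sw: "smooth_in c0 ?D (w k)" for k
    unfolding w_def by (intro smooth_in_diff smooth_in_scaleR smooth_in_const coD sg sJ se)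
  \<comment> \<open>If all projections vanished at \<open>p0\<close>, the four axis vectors would
    lie in the span of two vectors.\<close>
  have "\<exists>k. w k p0 \<noteq> 0"
  proof (rule ccontr)
    assume "\<not> ?thesis"
    then have "axis k 1 = ?g p0 (e p0) (axis k 1) *\<^sub>R e p0 + ?g p0 (?J p0 (e p0)) (axis k 1) *\<^sub>R ?J p0 (e p0)" for k
      unfolding w_def by (simp add: algebra_simps)
    then have "axis k 1 \<in> span {e p0, ?J p0 (e p0)}" for k
      by (metis insertCI span_add span_base span_scale)
    then have "Basis \<subseteq> span {e p0, ?J p0 (e p0)}"
      by (auto simp: Basis_vec_def)
    then have "DIM(real^4) \<le> card {e p0, ?J p0 (e p0)}"
      by (metis dim_UNIV dim_le_card finite.emptyI finite.insertI span_Basis span_minimal subspace_span top.extremum_uniqueI)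
    also have "\<dots> \<le> 2" by (simp add: card_insert_if)
    finally show False by simp
  qed
  then obtain k where k: "w k p0 \<noteq> 0" by blast
  define U where "U = {p \<in> ?D. w k p \<noteq> 0}"
  have oU: "openin (top_space M) U"
  proof -
    let ?S = "coord c0 ` ?D"
    let ?V = "?S \<inter> (\<lambda>x. w k (param c0 x)) -` (- {0})"
    have h: "homeomorphic_map (subtopology (top_space M) ?D) (top_of_set ?S) (coord c0)"
      and o: "open ?S"
      using chart[OF c0] by (auto simp: is_chart_def)
    have "continuous_on ?S (\<lambda>x. w k (param c0 x))"
      using sw[of k] smooth_on_continuous by (auto simp: smooth_in_def)
    then have "open ?V" using o by (intro continuous_open_preimage) auto
    then have "openin (top_of_set ?S) ?V"
      by (metis Int_lower1 open_subset)
    then have "openin (subtopology (top_space M) ?D) {p \<in> topspace (subtopology (top_space M) ?D). coord c0 p \<in> ?V}"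
      using homeomorphic_imp_continuous_map[OF h] openin_continuous_map_preimage by blast
    moreover have "{p \<in> topspace (subtopology (top_space M) ?D). coord c0 p \<in> ?V} = U"
    proof -
      have "coord c0 p \<in> ?V \<longleftrightarrow> w k p \<noteq> 0" if "p \<in> ?D" for p
        using that param_coord[OF coD that] by simp
      then show ?thesis using chart_dom_subset[OF c0] unfolding U_def by (auto simp del: vimage_Int)
    qed
    ultimately show ?thesis using oD openin_trans_full by metis
  qed
  have p0U: "p0 \<in> U" using k p0 by (simp add: U_def)
  have UD: "U \<subseteq> ?D" by (auto simp: U_def)
  have coU: "chart_open c0 U" by (rule chart_openI[OF c0 oU])
  have seU: "smooth_in c0 U e" and swU: "smooth_in c0 U (w k)"
    using se sw smooth_in_subset UD coU by blast+
  have sgU: "smooth_in c0 U (\<lambda>p. ?g p (w k p) (w k p))"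
    using sg[OF sw sw] smooth_in_subset UD coU by blast
  define f where "f p = (1 / sqrt (?g p (w k p) (w k p))) *\<^sub>R w k p" for p
  have wpos: "?g p (w k p) (w k p) > 0" if "p \<in> U" for p
    using that metric_pos[OF c0] by (simp add: U_def)
  have sf: "smooth_in c0 U f"
    unfolding f_def using wpos
    by (intro smooth_in_scaleR smooth_in_const coU smooth_in_divide smooth_in_sqrt sgU swU) (auto simp: less_le)
  define R where "R p = (vector [e p, ?J p (e p), f p, ?J p (f p)] :: real^4^4)" for p
  define E0 where "E0 p = R p ** gram g c0 p" for p
  have fr: "?g p (e p) (e p) = 1" "?g p (f p) (f p) = 1" "?g p (e p) (f p) = 0" "?g p (?J p (e p)) (f p) = 0"
    if p: "p \<in> U" for p
  proof -
    have pD: "p \<in> ?D" using p UD by auto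
    note bl = bilinear_metric[OF c0 pD]
    show "?g p (e p) (e p) = 1" by (rule e1[OF pD])
    show "?g p (f p) (f p) = 1"
      using wpos[OF p] by (simp add: f_def bilinear_lmul[OF bl] bilinear_rmul[OF bl])
    have sk: "?g p (?J p v) v = 0" for v
      using J_skew[OF c0 pD, of v v] metric_sym[OF c0 pD, of v "?J p v"] by simp
    have sk': "?g p v (?J p v) = 0" for v using sk metric_sym[OF c0 pD] by metis
    have "?g p (e p) (w k p) = 0"
      unfolding w_def by (simp add: bilinear_rsub[OF bl] bilinear_rmul[OF bl] e1[OF pD] sk')
    then show "?g p (e p) (f p) = 0" by (simp add: f_def bilinear_rmul[OF bl])
    have "?g p (?J p (e p)) (w k p) = 0"
      unfolding w_def by (simp add: bilinear_rsub[OF bl] bilinear_rmul[OF bl] e1[OF pD] sk J_metric[OF c0 pD])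
    then show "?g p (?J p (e p)) (f p) = 0" by (simp add: f_def bilinear_rmul[OF bl])
  qed
  have E0: "transpose (E0 p) ** E0 p = gram g c0 p" "det (E0 p) > 0" "E0 p ** mfield J c0 p = lmul qi ** E0 p"
    if p: "p \<in> U" for p
    unfolding E0_def R_def using hermitian_frame[OF c0 _ fr[OF p]] p UD by auto
  have sJU: "smooth_in c0 U (\<lambda>p. ?J p (x p))" if "smooth_in c0 U x" for x
    by (rule smooth_in_cong[OF smooth_in_matrix_vector_mult[OF endo_smooth(2)[OF endomorphism_field_J c0 oU] that]])
      (use J_apply[OF c0] UD in auto)
  have sR: "smooth_in c0 U R"
  proof (rule smooth_in_vec)
    fix i :: 4 show "smooth_in c0 U (\<lambda>p. R p $ i)"
      using exhaust_4[of i] seU sf sJU[OF seU] sJU[OF sf] by (auto simp: R_def)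
  qed
  have sE0: "smooth_in c0 U E0"
    unfolding E0_def by (intro smooth_in_matrix_mult sR smooth_metric[OF c0 oU])
  \<comment> \<open>The frame is built in the one chart \<open>c0\<close> and carried to all others
    by the Jacobian, so its invariance is the cocycle law.\<close>
  define E where "E c p v = E0 p *v jac c c0 p v" for c p v
  have Em: "mfield E c p = E0 p ** matrix (jac c c0 p)" and El: "linear (E c p)"
    if "c \<in> atlas M" "p \<in> U" "p \<in> chart_dom c" for c p
  proof -
    have "linear (jac c c0 p)" using that UD c0 by (auto intro: linear_jac)
    then have "E c p v = (E0 p ** matrix (jac c c0 p)) *v v" for v
      by (simp add: E_def matrix_vector_mul_assoc[symmetric] matrix_mult_linear)
    then have "E c p = (\<lambda>v. (E0 p ** matrix (jac c c0 p)) *v v)" by (rule ext)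
    then show "mfield E c p = E0 p ** matrix (jac c c0 p)" "linear (E c p)" by simp_all
  qed
  have "u2_chart M g J U E"
    unfolding u2_chart_def
  proof (intro conjI ballI allI)
    show "openin (top_space M) U" by (rule oU)
  next
    fix c p assume c: "c \<in> atlas M" and "p \<in> U \<inter> chart_dom c"
    then have p: "p \<in> U" "p \<in> chart_dom c" "p \<in> ?D" using UD by auto
    have iso: "E c p v \<bullet> E c p w = g c p v w" for v w
    proof -
      have "E c p v \<bullet> E c p w = jac c c0 p v \<bullet> ((transpose (E0 p) ** E0 p) *v jac c c0 p w)"
        unfolding E_def by (simp only: inner_matrix_vector matrix_vector_mul_assoc)
      then show ?thesis
        by (simp add: E0(1)[OF p(1)] metric_gram[OF c0 p(3), symmetric] metric_jac[OF c c0 p(2,3)])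
    qed
    show "oriented_isometry g c p (E c p)"
      unfolding oriented_isometry_def
      using iso El[OF c p(1,2)] E0(2)[OF p(1)] det_jac[OF c c0 p(2,3)]
      by (simp add: Em[OF c p(1,2)] det_mul)
    fix v
    have "mfield E c p ** mfield J c p = lmul qi ** mfield E c p"
      unfolding Em[OF c p(1,2)]
      by (metis E0(3)[OF p(1)] endo_jac[OF endomorphism_field_J c c0 p(2,3)] matrix_mul_assoc)
    then have "(mfield E c p ** mfield J c p) *v v = (lmul qi ** mfield E c p) *v v" by simp
    then show "E c p (J c p v) = qmul qi (E c p v)"
      using El[OF c p(1,2)] endo_linear[OF endomorphism_field_J c p(2)]
      by (simp add: matrix_vector_mul_assoc[symmetric] matrix_mult_linear)
  next
    fix c c' p v assume "c \<in> atlas M" "c' \<in> atlas M" "p \<in> U \<inter> chart_dom c \<inter> chart_dom c'"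
    then show "E c' p (jac c c' p v) = E c p v"
      using UD c0 by (auto simp: E_def jac_cocycle)
  next
    fix v
    show "smooth_field M U (\<lambda>c p. E c p v)"
      unfolding smooth_field_iff[OF oU] E_def
    proof
      fix c assume c: "c \<in> atlas M"
      have "smooth_in c (U \<inter> ?D) E0" by (rule smooth_in_change_chart[OF c c0 sE0 oU])
      moreover have "U \<inter> ?D = U" using UD by auto
      ultimately show "smooth_in c U (\<lambda>p. E0 p *v jac c c0 p v)"
        by (intro smooth_in_matrix_vector_mult smooth_in_jac[OF c c0 oU UD]) simp
    qed
  qed
  then show ?thesis using p0U by (rule that)
qed

end


section \<open>The line bundle of complex bivectors and the unitary connections obtained from
  Levi-Civita\<close>

section \<open>Unitary connections on the determinant line\<close>

lemma bivector_matrix: "bivector (A *v v) (A *v w) = A ** bivector v w ** transpose A"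
  by (simp add: vec_eq_iff forall_4 bivector_def matrix_mult_nth4 matrix_vector_mult_nth4 transpose_nth algebra_simps)

lemma transpose_bivector: "transpose (bivector v w) = - bivector v w"
  by (simp add: vec_eq_iff bivector_def transpose_nth)

lemma skew_bivector_sum:
  assumes "transpose \<beta> = - \<beta>"
  shows "\<beta> = (\<Sum>i\<in>UNIV. \<Sum>j\<in>UNIV. (\<beta> $ i $ j / 2) *\<^sub>R bivector (axis i 1) (axis j 1))"
proof -
  have s: "\<beta> $ j $ i = - \<beta> $ i $ j" for i j
    using assms by (metis transpose_nth vector_uminus_component)
  have d: "\<beta> $ i $ i = 0" for i using s[of i i] by simp
  show ?thesis
    by (simp add: vec_eq_iff forall_4 sum_4 bivector_def axis_nth4 d
        s[of 2 1] s[of 3 1] s[of 4 1] s[of 3 2] s[of 4 2] s[of 4 3])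
qed

definition bivector_covd ::
  "'a tensor12_field \<Rightarrow> 'a chart \<Rightarrow> ('a \<Rightarrow> real^4^4) \<Rightarrow> 'a \<Rightarrow> real^4 \<Rightarrow> real^4^4" where
  "bivector_covd \<Gamma> c s p u =
     pd c s p u + matrix (\<Gamma> c p u) ** s p + s p ** transpose (matrix (\<Gamma> c p u))"

text \<open>On antisymmetric matrices this is the projection onto the determinant line, which
  \<open>kstar_iff\<close> identifies as the (-1)-eigenspace of the involution taking \<beta> to J
  \<beta> J^T.\<close>

definition kproj :: "'a endo_field \<Rightarrow> 'a chart \<Rightarrow> 'a \<Rightarrow> real^4^4 \<Rightarrow> real^4^4" where
  "kproj J c p \<beta> = (1/2) *\<^sub>R (\<beta> - mfield J c p ** \<beta> ** transpose (mfield J c p))"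

text \<open>The projected Levi-Civita connection, shifted by the imaginary 1-form \<open>2i\<eta>\<close>.\<close>

definition kconn ::
  "'a endo_field \<Rightarrow> 'a tensor12_field \<Rightarrow> ('a, real^4 \<Rightarrow> real) field \<Rightarrow> 'a kconnection" where
  "kconn J \<Gamma> \<eta> s c p u =
     kproj J c p (bivector_covd \<Gamma> c (s c) p u) + (2 * \<eta> c p u) *\<^sub>R (mfield J c p ** s c p)"

definition one_form :: "'a manifold \<Rightarrow> ('a, real^4 \<Rightarrow> real) field \<Rightarrow> bool" where
  "one_form M \<eta> \<longleftrightarrow>
     (\<forall>c\<in>atlas M. \<forall>p\<in>chart_dom c. linear (\<eta> c p)) \<and>
     (\<forall>c\<in>atlas M. \<forall>c'\<in>atlas M. \<forall>p\<in>chart_dom c \<inter> chart_dom c'. \<forall>u. \<eta> c' p (jac c c' p u) = \<eta> c p u) \<and>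
     (\<forall>c\<in>atlas M. \<forall>u. smooth_in c (chart_dom c) (\<lambda>p. \<eta> c p u))"

lemma linear_kproj: "linear (kproj J c p)"
  by (auto intro!: linearI simp: kproj_def matrix_ring algebra_simps)

lemma kscale_add: "kscale J c p z (\<beta> + \<gamma>) = kscale J c p z \<beta> + kscale J c p z \<gamma>"
  by (simp add: kscale_def matrix_ring algebra_simps)

context spinor_manifold
begin

context
  fixes c p
  assumes c: "c \<in> atlas M" and p: "p \<in> chart_dom c"
begin

lemma J_cancel: "mfield J c p ** (mfield J c p ** X) = - X"
  using mfield_J_square[OF c p] by (simp add: matrix_mul_assoc matrix_mult_minus_left)

lemma J_transpose_cancel: "transpose (mfield J c p) ** (transpose (mfield J c p) ** X) = - X"
proof -
  have "transpose (mfield J c p) ** transpose (mfield J c p) = - mat 1"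
    using arg_cong[OF mfield_J_square[OF c p], of transpose] by (simp add: transpose_ring)
  then show ?thesis by (simp add: matrix_mul_assoc matrix_mult_minus_left)
qed

lemma J_transpose_cancel': "X ** transpose (mfield J c p) ** transpose (mfield J c p) = - X"
proof -
  have "transpose (mfield J c p) ** transpose (mfield J c p) = - mat 1"
    using arg_cong[OF mfield_J_square[OF c p], of transpose] by (simp add: transpose_ring)
  then show ?thesis by (simp add: matrix_mul_assoc[symmetric] matrix_mult_minus_right)
qed

lemma J_gram: "transpose (mfield J c p) ** gram g c p = - (gram g c p ** mfield J c p)"
proof -
  have "v \<bullet> ((transpose (mfield J c p) ** gram g c p) *v w) = v \<bullet> ((- (gram g c p ** mfield J c p)) *v w)" for v w
  proof -
    have "v \<bullet> ((transpose (mfield J c p) ** gram g c p) *v w) = g c p (J c p v) w"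
      unfolding J_apply[OF c p, of v] metric_gram[OF c p]
      by (simp only: inner_matrix_vector matrix_vector_mul_assoc)
    also have "\<dots> = - g c p v (J c p w)" by (rule J_skew[OF c p])
    also have "\<dots> = v \<bullet> ((- (gram g c p ** mfield J c p)) *v w)"
      unfolding J_apply[OF c p, of w] metric_gram[OF c p]
      by (simp add: matrix_vector_mult_minus_left matrix_vector_mul_assoc)
    finally show ?thesis .
  qed
  then have "(transpose (mfield J c p) ** gram g c p) *v w = (- (gram g c p ** mfield J c p)) *v w" for w
    by (rule vector_eq_ldot[THEN iffD1, rule_format])
  then show ?thesis unfolding matrix_eq by blast
qed

lemma cwedge_bivector: "cwedge J c p v w = bivector v w - mfield J c p ** bivector v w ** transpose (mfield J c p)"
  by (simp only: cwedge_def J_apply[OF c p, of v]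
      J_apply[OF c p, of w] bivector_matrix)

text \<open>Turns the span into two equations that can be checked by matrix algebra. Conversely, a
  solution is fixed by \<open>kproj\<close>, and projecting its expansion into simple bivectors
  yields complex wedge products.\<close>

lemma kstar_iff:
  "\<beta> \<in> kstar J c p \<longleftrightarrow> transpose \<beta> = - \<beta> \<and> mfield J c p ** \<beta> ** transpose (mfield J c p) = - \<beta>"
proof
  let ?K = "{\<beta>. transpose \<beta> = - \<beta> \<and> mfield J c p ** \<beta> ** transpose (mfield J c p) = - \<beta>}"
  have "subspace ?K"
    by (auto simp: subspace_def transpose_ring matrix_ring) (simp add: transpose_def vec_eq_iff)
  moreover have "cwedge J c p v w \<in> ?K" for v w
    unfolding cwedge_bivector
    by (simp add: transpose_ring transpose_bivector matrix_ring J_cancel J_transpose_cancel)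
      (simp add: matrix_mul_assoc J_transpose_cancel')
  ultimately have "kstar J c p \<subseteq> ?K"
    unfolding kstar_def by (intro span_minimal) auto
  then show "\<beta> \<in> kstar J c p \<Longrightarrow> transpose \<beta> = - \<beta> \<and> mfield J c p ** \<beta> ** transpose (mfield J c p) = - \<beta>"
    by auto
next
  assume \<beta>: "transpose \<beta> = - \<beta> \<and> mfield J c p ** \<beta> ** transpose (mfield J c p) = - \<beta>"
  then have "\<beta> = kproj J c p \<beta>" by (simp add: kproj_def scaleR_2[symmetric])
  also have "\<dots> = kproj J c p (\<Sum>i\<in>UNIV. \<Sum>j\<in>UNIV. (\<beta> $ i $ j / 2) *\<^sub>R bivector (axis i 1) (axis j 1))"
    by (rule arg_cong[OF skew_bivector_sum]) (use \<beta> in blast)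
  \<comment> \<open>The quarter is one half from the double counting of pairs times one half from
    the projection.\<close>
  also have "\<dots> = (\<Sum>i\<in>UNIV. \<Sum>j\<in>UNIV. (\<beta> $ i $ j / 4) *\<^sub>R cwedge J c p (axis i 1) (axis j 1))"
    by (simp add: linear_sum[OF linear_kproj] linear_scale[OF linear_kproj] cwedge_bivector) (simp add: kproj_def)
  also have "\<dots> \<in> kstar J c p"
    unfolding kstar_def by (intro span_sum span_scale span_base) auto
  finally show "\<beta> \<in> kstar J c p" .
qed

lemma kstar_J: "\<beta> \<in> kstar J c p \<Longrightarrow> \<beta> ** transpose (mfield J c p) = mfield J c p ** \<beta>"
proof -
  assume "\<beta> \<in> kstar J c p"
  then have "mfield J c p ** (mfield J c p ** \<beta> ** transpose (mfield J c p)) = mfield J c p ** (- \<beta>)"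
    by (simp add: kstar_iff)
  then show ?thesis by (simp add: matrix_ring J_cancel)
qed

lemma kstar_J_mem: "\<beta> \<in> kstar J c p \<Longrightarrow> mfield J c p ** \<beta> \<in> kstar J c p"
  using kstar_J[of \<beta>] by (simp add: kstar_iff transpose_ring matrix_ring J_cancel)

lemma subspace_kstar: "subspace (kstar J c p)"
  by (simp add: kstar_def)

lemma kproj_mem: "transpose \<beta> = - \<beta> \<Longrightarrow> kproj J c p \<beta> \<in> kstar J c p"
  unfolding kstar_iff kproj_def
  by (simp add: transpose_ring matrix_ring J_cancel)
    (simp add: matrix_mul_assoc J_transpose_cancel' scaleR_right_diff_distrib)

lemma kproj_id: "\<beta> \<in> kstar J c p \<Longrightarrow> kproj J c p \<beta> = \<beta>"
  by (simp add: kstar_iff kproj_def scaleR_2[symmetric])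

lemma kproj_J: "kproj J c p (mfield J c p ** \<beta>) = mfield J c p ** kproj J c p \<beta>"
  by (simp add: kproj_def matrix_ring)

lemma kinner_gram: "kinner g c p \<beta> \<gamma> = (1/4) * (\<beta> \<bullet> (gram g c p ** \<gamma> ** gram g c p))"
proof -
  have "(\<Sum>k\<in>UNIV. \<Sum>l\<in>UNIV. \<beta>$i$j * \<gamma>$k$l * g c p (axis i 1) (axis k 1) * g c p (axis j 1) (axis l 1))
    = \<beta>$i$j * (gram g c p ** \<gamma> ** gram g c p)$i$j" for i j
  proof -
    have "(gram g c p ** \<gamma> ** gram g c p)$i$j
        = (\<Sum>l\<in>UNIV. \<Sum>k\<in>UNIV. g c p (axis i 1) (axis k 1) * \<gamma>$k$l * g c p (axis l 1) (axis j 1))"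
      by (simp add: matrix_matrix_mult_def gram_def sum_distrib_right)
    also have "\<dots> = (\<Sum>k\<in>UNIV. \<Sum>l\<in>UNIV. g c p (axis i 1) (axis k 1) * \<gamma>$k$l * g c p (axis j 1) (axis l 1))"
      by (subst sum.swap) (simp add: metric_sym[OF c p])
    finally show ?thesis by (simp add: sum_distrib_left mult_ac)
  qed
  then show ?thesis unfolding kinner_def by (simp add: inner_vec_def)
qed

text \<open>Multiplication by i is skew for the real inner product, which is why a shift by an
  imaginary 1-form preserves unitarity.\<close>

lemma kinner_J: "kinner g c p (mfield J c p ** \<beta>) \<gamma> + kinner g c p \<beta> (mfield J c p ** \<gamma>) = 0"
proof -
  have "(mfield J c p ** \<beta>) \<bullet> (gram g c p ** \<gamma> ** gram g c p)
      = \<beta> \<bullet> ((transpose (mfield J c p) ** gram g c p) ** \<gamma> ** gram g c p)"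
    by (simp add: inner_matrix_left matrix_mul_assoc)
  then show ?thesis
    unfolding kinner_gram J_gram by (simp add: matrix_ring)
qed

text \<open>The involution behind \<open>kproj\<close> is an isometry because J is orthogonal; its
  eigenspaces are therefore orthogonal, and the discarded part is not seen by \<gamma>.\<close>

lemma kinner_kproj:
  assumes "\<gamma> \<in> kstar J c p"
  shows "kinner g c p (kproj J c p \<beta>) \<gamma> = kinner g c p \<beta> \<gamma>" "kinner g c p \<gamma> (kproj J c p \<beta>) = kinner g c p \<gamma> \<beta>"
proof -
  let ?J = "mfield J c p" and ?G = "gram g c p"
  have JG: "transpose ?J ** (?G ** X) = - (?G ** (?J ** X))" for X
    by (simp add: matrix_mul_assoc J_gram matrix_mult_minus_left)
  have GJ: "?G ** ?J = - (transpose ?J ** ?G)" using J_gram by simp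
  have \<gamma>J: "?J ** (\<gamma> ** transpose ?J) = - \<gamma>" using assms by (simp add: kstar_iff matrix_mul_assoc)
  have "(?J ** \<beta> ** transpose ?J) \<bullet> (?G ** \<gamma> ** ?G) = \<beta> \<bullet> (transpose ?J ** (?G ** \<gamma> ** (?G ** ?J)))"
    by (simp only: inner_matrix_right[of "?J ** \<beta>"] inner_matrix_left[of ?J \<beta>] transpose_transpose matrix_mul_assoc)
  also have "\<dots> = \<beta> \<bullet> (?G ** (?J ** (\<gamma> ** transpose ?J)) ** ?G)"
    unfolding GJ by (simp add: matrix_ring JG)
  finally have 1: "(?J ** \<beta> ** transpose ?J) \<bullet> (?G ** \<gamma> ** ?G) = - (\<beta> \<bullet> (?G ** \<gamma> ** ?G))"
    unfolding \<gamma>J by (simp add: matrix_ring)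
  have "\<gamma> \<bullet> (?G ** (?J ** \<beta> ** transpose ?J) ** ?G) = \<gamma> \<bullet> (transpose ?J ** (?G ** \<beta> ** ?G) ** ?J)"
  proof -
    have "?G ** (?J ** \<beta> ** transpose ?J) ** ?G = (?G ** ?J) ** \<beta> ** (transpose ?J ** ?G)"
      by (simp add: matrix_mul_assoc)
    also have "\<dots> = transpose ?J ** (?G ** \<beta> ** ?G) ** ?J"
      by (simp add: matrix_ring J_gram JG)
    finally show ?thesis by simp
  qed
  also have "\<dots> = (?J ** \<gamma> ** transpose ?J) \<bullet> (?G ** \<beta> ** ?G)"
    by (simp only: inner_matrix_right[of "?J ** \<gamma>"] inner_matrix_left[of ?J \<gamma>] transpose_transpose matrix_mul_assoc)
  finally have 2: "\<gamma> \<bullet> (?G ** (?J ** \<beta> ** transpose ?J) ** ?G) = - (\<gamma> \<bullet> (?G ** \<beta> ** ?G))"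
    using assms by (simp add: kstar_iff)
  show "kinner g c p (kproj J c p \<beta>) \<gamma> = kinner g c p \<beta> \<gamma>"
    unfolding kinner_gram kproj_def using 1 by (simp add: inner_diff_left)
  show "kinner g c p \<gamma> (kproj J c p \<beta>) = kinner g c p \<gamma> \<beta>"
    unfolding kinner_gram kproj_def using 2
    by (simp add: matrix_ring inner_diff_right)
qed

end

lemma kstar_sectionD:
  assumes "kstar_section M J U s" "openin (top_space M) U"
  shows "c \<in> atlas M \<Longrightarrow> p \<in> U \<Longrightarrow> p \<in> chart_dom c \<Longrightarrow> s c p \<in> kstar J c p"
    "c \<in> atlas M \<Longrightarrow> c' \<in> atlas M \<Longrightarrow> p \<in> U \<Longrightarrow> p \<in> chart_dom c \<Longrightarrow> p \<in> chart_dom c' \<Longrightarrow>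
      s c' p = matrix (jac c c' p) ** s c p ** transpose (matrix (jac c c' p))"
    "c \<in> atlas M \<Longrightarrow> smooth_in c U (s c)"
proof -
  have "\<forall>c\<in>atlas M. \<forall>p\<in>U \<inter> chart_dom c. s c p \<in> kstar J c p"
    and law: "\<forall>c\<in>atlas M. \<forall>c'\<in>atlas M. \<forall>p\<in>U \<inter> chart_dom c \<inter> chart_dom c'. s c' p = bivector_law c c' p (s c p)"
    and "smooth_field M U s"
    using assms(1) unfolding kstar_section_def by blast+
  then show "c \<in> atlas M \<Longrightarrow> p \<in> U \<Longrightarrow> p \<in> chart_dom c \<Longrightarrow> s c p \<in> kstar J c p"
    "c \<in> atlas M \<Longrightarrow> smooth_in c U (s c)"
    unfolding smooth_field_iff[OF assms(2)] by blast+
  show "c \<in> atlas M \<Longrightarrow> c' \<in> atlas M \<Longrightarrow> p \<in> U \<Longrightarrow> p \<in> chart_dom c \<Longrightarrow> p \<in> chart_dom c' \<Longrightarrow>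
      s c' p = matrix (jac c c' p) ** s c p ** transpose (matrix (jac c c' p))"
    using law unfolding bivector_law_def by blast
qed

lemma kstar_section_subset:
  assumes s: "kstar_section M J U s" and U: "openin (top_space M) U" and V: "openin (top_space M) V" "V \<subseteq> U"
  shows "kstar_section M J V s"
proof -
  have "smooth_field M V s"
    unfolding smooth_field_iff[OF V(1)]
    by (intro ballI smooth_in_subset[OF kstar_sectionD(3)[OF s U]] chart_openI V)
  then show ?thesis using s V(2) unfolding kstar_section_def by blast
qed

lemma one_formD:
  assumes "one_form M \<eta>"
  shows "c \<in> atlas M \<Longrightarrow> p \<in> chart_dom c \<Longrightarrow> linear (\<eta> c p)"
    "c \<in> atlas M \<Longrightarrow> c' \<in> atlas M \<Longrightarrow> p \<in> chart_dom c \<Longrightarrow> p \<in> chart_dom c' \<Longrightarrow> \<eta> c' p (jac c c' p u) = \<eta> c p u"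
    "c \<in> atlas M \<Longrightarrow> openin (top_space M) U \<Longrightarrow> smooth_in c U (\<lambda>p. \<eta> c p u)"
proof -
  show "c \<in> atlas M \<Longrightarrow> p \<in> chart_dom c \<Longrightarrow> linear (\<eta> c p)"
    "c \<in> atlas M \<Longrightarrow> c' \<in> atlas M \<Longrightarrow> p \<in> chart_dom c \<Longrightarrow> p \<in> chart_dom c' \<Longrightarrow> \<eta> c' p (jac c c' p u) = \<eta> c p u"
    using assms by (auto simp: one_form_def)
  assume c: "c \<in> atlas M" and U: "openin (top_space M) U"
  have "smooth_in c (chart_dom c) (\<lambda>p. \<eta> c p u)" using assms c by (auto simp: one_form_def)
  moreover have "coord c ` (chart_dom c \<inter> chart_dom c) \<supseteq> coord c ` (U \<inter> chart_dom c)" by auto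
  ultimately show "smooth_in c U (\<lambda>p. \<eta> c p u)"
    using chart_openI[OF c U] unfolding smooth_in_def smooth_on_def by (meson Ck_on_subset)
qed

context
  fixes U s
  assumes s: "kstar_section M J U s" and U: "openin (top_space M) U"
begin

lemma smooth_bivector_covd:
  "c \<in> atlas M \<Longrightarrow> smooth_in c U (\<lambda>p. bivector_covd \<Gamma> c (s c) p u)"
  unfolding bivector_covd_def
  by (intro smooth_in_add smooth_in_matrix_mult smooth_in_pd smooth_in_transpose smooth_Gamma U kstar_sectionD(3)[OF s U])

lemma linear_bivector_covd:
  assumes "c \<in> atlas M" "p \<in> U" "p \<in> chart_dom c"
  shows "linear (\<lambda>u. bivector_covd \<Gamma> c (s c) p u)"
proof -
  note 1 = linear_pd[OF kstar_sectionD(3)[OF s U assms(1)] assms(2,3)] and 2 = linear_matrix_Gamma[OF assms(1,3)]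
  show ?thesis
    by (auto intro!: linearI simp: bivector_covd_def linear_add[OF 1] linear_add[OF 2] linear_scale[OF 1]
        linear_scale[OF 2] matrix_ring transpose_ring algebra_simps)
qed

lemma transpose_bivector_covd:
  assumes "c \<in> atlas M" "p \<in> U" "p \<in> chart_dom c"
  shows "transpose (bivector_covd \<Gamma> c (s c) p u) = - bivector_covd \<Gamma> c (s c) p u"
proof -
  note sm = kstar_sectionD(3)[OF s U assms(1)]
  have sk: "transpose (s c x) = - s c x" if "x \<in> U" "x \<in> chart_dom c" for x
    using kstar_sectionD(1)[OF s U assms(1) that] kstar_iff[OF assms(1) that(2)] by blast
  have "transpose (pd c (s c) p u) = pd c (\<lambda>x. transpose (s c x)) p u"
    by (simp add: pd_transpose[OF assms(2,3) sm])
  also have "\<dots> = pd c (\<lambda>x. - s c x) p u"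
    by (rule fun_cong[OF pd_cong[OF smooth_in_minus[OF sm] assms(2,3)]]) (simp add: sk)
  finally have "transpose (pd c (s c) p u) = - pd c (s c) p u"
    by (simp add: pd_minus[OF assms(2,3) sm])
  then show ?thesis
    by (simp add: bivector_covd_def transpose_ring sk assms matrix_ring)
qed

text \<open>The cancellation of \<open>nabla_jac\<close>, now with a Jacobian on either
  side.\<close>

lemma bivector_covd_jac:
  assumes c: "c \<in> atlas M" "c' \<in> atlas M" and p: "p \<in> U" "p \<in> chart_dom c" "p \<in> chart_dom c'"
  shows "bivector_covd \<Gamma> c' (s c') p (jac c c' p u)
    = matrix (jac c c' p) ** bivector_covd \<Gamma> c (s c) p u ** transpose (matrix (jac c c' p))"
proof -
  let ?V = "U \<inter> chart_dom c'" and ?P = "\<lambda>x. matrix (jac c c' x)"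
  have o: "openin (top_space M) ?V" using openin_chart_dom c U by blast
  have co: "chart_open c ?V" using chart_openI o c by blast
  have s': "smooth_in c' U (s c')" by (rule kstar_sectionD(3)[OF s U c(2)])
  have s0: "smooth_in c ?V (s c)" by (rule smooth_in_subset[OF kstar_sectionD(3)[OF s U c(1)] _ co]) auto
  have P: "smooth_in c ?V ?P" using smooth_in_jac(2)[OF c o] by simp
  note PT = smooth_in_transpose[OF P]
  have pV: "p \<in> ?V" using p by simp
  have "pd c' (s c') p (jac c c' p u) = pd c (s c') p u"
    using pd_change_chart[OF c s' U] p by simp
  also have "\<dots> = pd c (\<lambda>x. ?P x ** s c x ** transpose (?P x)) p u"
    by (rule fun_cong[OF pd_cong[OF smooth_in_matrix_mult[OF smooth_in_matrix_mult[OF P s0] PT] pV p(2)]])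
      (use kstar_sectionD(2)[OF s U c] in auto)
  also have "\<dots> = pd c ?P p u ** s c p ** transpose (?P p) + ?P p ** pd c (s c) p u ** transpose (?P p)
      + ?P p ** s c p ** transpose (pd c ?P p u)"
    by (simp add: pd_matrix_mult[OF pV p(2) smooth_in_matrix_mult[OF P s0] PT] pd_matrix_mult[OF pV p(2) P s0]
        pd_transpose[OF pV p(2) P] matrix_mult_add_left)
  finally have d: "pd c' (s c') p (jac c c' p u) = \<dots>" .
  note G = Gamma_jac[OF c p(2,3), of u] and law = kstar_sectionD(2)[OF s U c p]
  have 1: "matrix (\<Gamma> c' p (jac c c' p u)) ** s c' p
      = (?P p ** matrix (\<Gamma> c p u) - pd c ?P p u) ** (s c p ** transpose (?P p))"
    unfolding law G[symmetric] by (simp add: matrix_mul_assoc)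
  have "transpose (?P p) ** transpose (matrix (\<Gamma> c' p (jac c c' p u)))
      = transpose (?P p ** matrix (\<Gamma> c p u) - pd c ?P p u)"
    unfolding G[symmetric] by (simp add: transpose_ring)
  then have 2: "s c' p ** transpose (matrix (\<Gamma> c' p (jac c c' p u)))
      = ?P p ** s c p ** transpose (?P p ** matrix (\<Gamma> c p u) - pd c ?P p u)"
    unfolding law by (simp add: matrix_mul_assoc[symmetric])
  show ?thesis
    unfolding bivector_covd_def d 1 2
    by (simp add: matrix_ring transpose_ring)
qed

lemma kproj_jac:
  assumes c: "c \<in> atlas M" "c' \<in> atlas M" and p: "p \<in> chart_dom c" "p \<in> chart_dom c'"
  shows "kproj J c' p (matrix (jac c c' p) ** \<beta> ** transpose (matrix (jac c c' p)))
    = matrix (jac c c' p) ** kproj J c p \<beta> ** transpose (matrix (jac c c' p))"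
proof -
  let ?P = "matrix (jac c c' p)"
  have J: "mfield J c' p ** ?P = ?P ** mfield J c p" by (rule endo_jac[OF endomorphism_field_J c p])
  have "mfield J c' p ** (?P ** \<beta> ** transpose ?P) ** transpose (mfield J c' p)
      = (mfield J c' p ** ?P) ** \<beta> ** transpose (mfield J c' p ** ?P)"
    by (simp add: transpose_ring matrix_mul_assoc)
  then show ?thesis
    unfolding J kproj_def by (simp add: matrix_ring transpose_ring)
qed

lemma kconn_form1:
  assumes \<eta>: "one_form M \<eta>"
  shows "kstar_form1 M J U (kconn J \<Gamma> \<eta> s)"
  unfolding kstar_form1_def
proof (intro conjI ballI allI)
  fix c p assume c: "c \<in> atlas M" and "p \<in> U \<inter> chart_dom c"
  then have p: "p \<in> U" "p \<in> chart_dom c" by auto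
  note 1 = linear_bivector_covd[OF c p] and 2 = one_formD(1)[OF \<eta> c p(2)] and 3 = linear_kproj[of J c p]
  show "linear (kconn J \<Gamma> \<eta> s c p)"
    by (auto intro!: linearI simp: kconn_def linear_add[OF 1] linear_add[OF 2] linear_add[OF 3]
        linear_scale[OF 1] linear_scale[OF 2] linear_scale[OF 3] algebra_simps)
  fix u show "kconn J \<Gamma> \<eta> s c p u \<in> kstar J c p"
    unfolding kconn_def
    by (intro subspace_add subspace_scale subspace_kstar kproj_mem kstar_J_mem c p transpose_bivector_covd
        kstar_sectionD(1)[OF s U])
next
  fix c c' p u assume c: "c \<in> atlas M" "c' \<in> atlas M" and "p \<in> U \<inter> chart_dom c \<inter> chart_dom c'"
  then have p: "p \<in> U" "p \<in> chart_dom c" "p \<in> chart_dom c'" by auto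
  let ?P = "matrix (jac c c' p)"
  have "mfield J c' p ** s c' p = ?P ** (mfield J c p ** s c p) ** transpose ?P"
    unfolding kstar_sectionD(2)[OF s U c p]
    by (simp only: matrix_mul_assoc endo_jac[OF endomorphism_field_J c p(2,3)])
  then show "kconn J \<Gamma> \<eta> s c' p (jac c c' p u) = bivector_law c c' p (kconn J \<Gamma> \<eta> s c p u)"
    by (simp add: kconn_def bivector_law_def bivector_covd_jac[OF c p] kproj_jac[OF c p(2,3)]
        one_formD(2)[OF \<eta> c p(2,3)] matrix_add_ldistrib matrix_mult_add_left matrix_mult_scaleR_left
        matrix_mult_scaleR_right)
next
  fix u
  show "smooth_field M U (\<lambda>c p. kconn J \<Gamma> \<eta> s c p u)"
    unfolding smooth_field_iff[OF U] kconn_def kproj_def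
    by (intro ballI smooth_in_add smooth_in_scaleR smooth_in_diff smooth_in_matrix_mult smooth_in_mult
        smooth_in_transpose smooth_bivector_covd endo_smooth endomorphism_field_J U smooth_in_const chart_openI
        one_formD(3)[OF \<eta>] kstar_sectionD(3)[OF s U])
qed

end

lemma nabla_J_anticommute:
  assumes c: "c \<in> atlas M" "p \<in> chart_dom c"
  shows "mfield J c p ** nabla \<Gamma> c (mfield J c) p u = - (nabla \<Gamma> c (mfield J c) p u ** mfield J c p)"
proof -
  let ?J = "mfield J c"
  note sm = endo_smooth(2)[OF endomorphism_field_J c(1) openin_chart_dom[OF c(1)]]
  have "pd c (\<lambda>x. ?J x ** ?J x) p u = pd c (\<lambda>x. - mat 1) p u"
    by (rule fun_cong[OF pd_cong[OF smooth_in_const c(2) c(2)]])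
      (use c openin_chart_dom chart_openI mfield_J_square in auto)
  then have "pd c ?J p u ** ?J p + ?J p ** pd c ?J p u = 0"
    by (simp add: pd_matrix_mult[OF c(2) c(2) sm sm])
  then have d: "?J p ** pd c ?J p u = - (pd c ?J p u ** ?J p)" by (simp add: eq_neg_iff_add_eq_0 add.commute)
  show ?thesis
    unfolding nabla_def
    by (simp add: matrix_ring d J_cancel[OF c] mfield_J_square[OF c])
qed

text \<open>Since i acts as J, which need not be parallel, the unprojected derivative violates the
  complex Leibniz rule by a term with \<nabla>J. The projection annihilates this term.\<close>

lemma kconn_leibniz:
  fixes f :: "'a \<Rightarrow> complex"
  assumes s: "kstar_section M J U s" and U: "openin (top_space M) U" and f: "smooth_function M U f"
    and c: "c \<in> atlas M" and p: "p \<in> U" "p \<in> chart_dom c"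
  shows "kconn J \<Gamma> \<eta> (\<lambda>c p. kscale J c p (f p) (s c p)) c p u
    = kscale J c p (pd c f p u) (s c p) + kscale J c p (f p) (kconn J \<Gamma> \<eta> s c p u)"
proof -
  let ?J = "mfield J c" and ?D = "bivector_covd \<Gamma> c (s c) p u"
  note ss = kstar_sectionD(3)[OF s U c]
  have sf: "smooth_in c U f"
    using f c smooth_field_iff[OF U, of "\<lambda>c. f"] by (simp add: smooth_function_def)
  note sre = smooth_in_linear[OF bounded_linear_Re sf] and sim = smooth_in_linear[OF bounded_linear_Im sf]
  note sJ = endo_smooth(2)[OF endomorphism_field_J c U]
  note sJs = smooth_in_matrix_mult[OF sJ ss]
  have sp: "s c p \<in> kstar J c p" by (rule kstar_sectionD(1)[OF s U c p])
  have "pd c (\<lambda>x. kscale J c x (f x) (s c x)) p u =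
      Re (pd c f p u) *\<^sub>R s c p + Re (f p) *\<^sub>R pd c (s c) p u
      + (Im (pd c f p u) *\<^sub>R (?J p ** s c p) + Im (f p) *\<^sub>R (pd c ?J p u ** s c p + ?J p ** pd c (s c) p u))"
    unfolding kscale_def
    by (simp add: pd_add[OF p smooth_in_scaleR[OF sre ss] smooth_in_scaleR[OF sim sJs]]
        pd_scaleR[OF p sre ss] pd_scaleR[OF p sim sJs] pd_matrix_mult[OF p sJ ss]
        pd_linear[OF p bounded_linear_Re sf] pd_linear[OF p bounded_linear_Im sf])
  then have D: "bivector_covd \<Gamma> c (\<lambda>x. kscale J c x (f x) (s c x)) p u =
      kscale J c p (pd c f p u) (s c p) + kscale J c p (f p) ?D + Im (f p) *\<^sub>R (nabla \<Gamma> c ?J p u ** s c p)"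
    unfolding bivector_covd_def kscale_def nabla_def
    by (simp add: matrix_ring algebra_simps)
  let ?N = "nabla \<Gamma> c ?J p u"
  \<comment> \<open>On the determinant line right multiplication by J^T equals left multiplication
    by J. As J anticommutes with \<nabla>J, the error term lies in the (+1)-eigenspace of the
    involution.\<close>
  have "?J p ** (?N ** s c p) ** transpose (?J p) = (?J p ** ?N) ** (s c p ** transpose (?J p))"
    by (simp add: matrix_mul_assoc)
  also have "\<dots> = ?N ** s c p"
    unfolding nabla_J_anticommute[OF c p(2)] kstar_J[OF c p(2) sp] by (simp add: matrix_ring J_cancel[OF c p(2)])
  finally have 0: "kproj J c p (?N ** s c p) = 0" by (simp add: kproj_def)
  note l = linear_add[OF linear_kproj] linear_scale[OF linear_kproj]
  show ?thesis
    unfolding kconn_def D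
    by (simp add: l 0 kscale_def kproj_J[OF c p(2)] kproj_id[OF c p(2) sp] matrix_ring J_cancel[OF c p(2)] algebra_simps)
qed

text \<open>Levi-Civita preserves the inner product of bivectors, the projection is orthogonal, and
  the two shift terms cancel because i acts skewly.\<close>

lemma kconn_metric:
  assumes s: "kstar_section M J U s" and t: "kstar_section M J U t" and U: "openin (top_space M) U"
    and c: "c \<in> atlas M" and p: "p \<in> U" "p \<in> chart_dom c"
  shows "pd c (\<lambda>x. kinner g c x (s c x) (t c x)) p u
    = kinner g c p (kconn J \<Gamma> \<eta> s c p u) (t c p) + kinner g c p (s c p) (kconn J \<Gamma> \<eta> t c p u)"
proof -
  let ?G = "gram g c" and ?L = "matrix (\<Gamma> c p u)" and ?s = "s c" and ?t = "t c"
  note ss = kstar_sectionD(3)[OF s U c] and st = kstar_sectionD(3)[OF t U c] and sG = smooth_metric(2)[OF c U]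
  note sp = kstar_sectionD(1)[OF s U c p] and tp = kstar_sectionD(1)[OF t U c p]
  note s1 = smooth_in_matrix_mult[OF sG st]
  note s2 = smooth_in_matrix_mult[OF s1 sG]
  note s3 = smooth_in_inner[OF ss s2]
  have "pd c (\<lambda>x. kinner g c x (?s x) (?t x)) p u = pd c (\<lambda>x. (1/4) * (?s x \<bullet> (?G x ** ?t x ** ?G x))) p u"
    by (rule fun_cong[OF pd_cong[OF smooth_in_linear[OF bounded_linear_mult_right s3] p]])
      (simp add: kinner_gram[OF c])
  also have "\<dots> = (1/4) * (pd c ?s p u \<bullet> (?G p ** ?t p ** ?G p) +
      ?s p \<bullet> ((pd c ?G p u ** ?t p + ?G p ** pd c ?t p u) ** ?G p + ?G p ** ?t p ** pd c ?G p u))"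
    unfolding pd_linear[OF p bounded_linear_mult_right s3]
    by (simp add: pd_inner[OF p ss s2] pd_matrix_mult[OF p s1 sG]
        pd_matrix_mult[OF p sG st] inner_commute)
  also have "\<dots> = (1/4) * ((pd c ?s p u + ?L ** ?s p + ?s p ** transpose ?L) \<bullet> (?G p ** ?t p ** ?G p) +
      ?s p \<bullet> (?G p ** (pd c ?t p u + ?L ** ?t p + ?t p ** transpose ?L) ** ?G p))"
    unfolding pd_gram[OF c p(2)]
    by (simp add: matrix_ring inner_add_left inner_add_right inner_matrix_left[of ?L "?s p"]
        inner_matrix_right[of "?s p" "transpose ?L"])
  also have "\<dots> = kinner g c p (bivector_covd \<Gamma> c ?s p u) (?t p) + kinner g c p (?s p) (bivector_covd \<Gamma> c ?t p u)"
    by (simp add: kinner_gram[OF c p(2)] bivector_covd_def)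
  also have "\<dots> = kinner g c p (kproj J c p (bivector_covd \<Gamma> c ?s p u)) (?t p)
      + kinner g c p (?s p) (kproj J c p (bivector_covd \<Gamma> c ?t p u))"
    by (simp add: kinner_kproj[OF c p(2)] sp tp)
  also have "\<dots> = kinner g c p (kconn J \<Gamma> \<eta> s c p u) (?t p) + kinner g c p (?s p) (kconn J \<Gamma> \<eta> t c p u)"
  proof -
    have "kinner g c p (\<beta> + r *\<^sub>R \<beta>') \<gamma> = kinner g c p \<beta> \<gamma> + r * kinner g c p \<beta>' \<gamma>"
      "kinner g c p \<gamma> (\<beta> + r *\<^sub>R \<beta>') = kinner g c p \<gamma> \<beta> + r * kinner g c p \<gamma> \<beta>'" for \<beta> \<beta>' \<gamma> r
      by (simp_all add: kinner_gram[OF c p(2)] matrix_ring inner_add_left inner_add_right algebra_simps)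
    moreover have "kinner g c p (?s p) (mfield J c p ** ?t p) = - kinner g c p (mfield J c p ** ?s p) (?t p)"
      using kinner_J[OF c p(2), of "?s p" "?t p"] by simp
    ultimately show ?thesis unfolding kconn_def by simp
  qed
  finally show ?thesis .
qed

lemma kconn_unitary:
  assumes \<eta>: "one_form M \<eta>"
  shows "unitary_connection M g J (kconn J \<Gamma> \<eta>)"
  unfolding unitary_connection_def
proof (intro conjI allI impI ballI; elim conjE)
  fix U s assume U: "openin (top_space M) U" and s: "kstar_section M J U s"
  then show "kstar_form1 M J U (kconn J \<Gamma> \<eta> s)" by (rule kconn_form1[OF _ _ \<eta>, rotated])
next
  fix U s c p u and f :: "'a \<Rightarrow> complex"
  assume "openin (top_space M) U" "kstar_section M J U s" "smooth_function M U f" "c \<in> atlas M" "p \<in> U \<inter> chart_dom c"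
  then show "kconn J \<Gamma> \<eta> (\<lambda>c p. kscale J c p (f p) (s c p)) c p u
      = kscale J c p (pd c f p u) (s c p) + kscale J c p (f p) (kconn J \<Gamma> \<eta> s c p u)"
    by (intro kconn_leibniz) auto
next
  fix U s t c p
  assume U: "openin (top_space M) U" and s: "kstar_section M J U s" and t: "kstar_section M J U t"
    and eq: "\<forall>c\<in>atlas M. \<forall>p\<in>U \<inter> chart_dom c. s c p = t c p" and c: "c \<in> atlas M" and p: "p \<in> U \<inter> chart_dom c"
  have "pd c (t c) p = pd c (s c) p"
    by (rule pd_cong[OF kstar_sectionD(3)[OF s U c]]) (use eq c p in auto)
  moreover have "s c p = t c p" using eq c p by blast
  ultimately show "kconn J \<Gamma> \<eta> s c p = kconn J \<Gamma> \<eta> t c p"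
    by (intro ext) (simp add: kconn_def bivector_covd_def)
next
  fix U s t c p u
  assume U: "openin (top_space M) U" and s: "kstar_section M J U s" and t: "kstar_section M J U t"
    and c: "c \<in> atlas M" and "p \<in> U \<inter> chart_dom c"
  then have p: "p \<in> U" "p \<in> chart_dom c" by auto
  have "bivector_covd \<Gamma> c (\<lambda>x. s c x + t c x) p u = bivector_covd \<Gamma> c (s c) p u + bivector_covd \<Gamma> c (t c) p u"
    unfolding bivector_covd_def
    by (simp add: pd_add[OF p kstar_sectionD(3)[OF s U c] kstar_sectionD(3)[OF t U c]] matrix_ring)
  then show "kconn J \<Gamma> \<eta> (\<lambda>c p. s c p + t c p) c p u = kconn J \<Gamma> \<eta> s c p u + kconn J \<Gamma> \<eta> t c p u"
    by (simp add: kconn_def linear_add[OF linear_kproj] matrix_ring algebra_simps)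
  show "pd c (\<lambda>x. kinner g c x (s c x) (t c x)) p u
      = kinner g c p (kconn J \<Gamma> \<eta> s c p u) (t c p) + kinner g c p (s c p) (kconn J \<Gamma> \<eta> t c p u)"
    by (rule kconn_metric[OF s t U c p])
qed

end


section \<open>Differences of unitary connections, and the spinorial tensor without
  U(2)-charts\<close>

section \<open>The spinorial connections\<close>

text \<open>This is \<open>\<B>\<^sup>A\<phi>\<close> for the projected Levi-Civita connection A: its connection form cancels the
  i-part of \<open>\<aa>\<^sub>+\<close>, and the remaining part of \<open>\<aa>\<^sub>+\<close> acts on the tangent bundle as \<open>(1/2) J (\<nabla>J)\<close>.\<close>

definition spin_B0 :: "'a endo_field \<Rightarrow> 'a tensor12_field \<Rightarrow> 'a endo_field \<Rightarrow> 'a chart \<Rightarrow> 'a \<Rightarrow> real^4 \<Rightarrow> real^4^4" where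
  "spin_B0 J \<Gamma> \<phi> c p u = nabla \<Gamma> c (mfield \<phi> c) p u
     - (1/2) *\<^sub>R (mfield J c p ** nabla \<Gamma> c (mfield J c) p u ** mfield \<phi> c p)"

text \<open>\<open>A\<close> differs at p by the imaginary covector \<open>2ih\<close> from the projected Levi-Civita connection.\<close>

definition shift_at ::
  "'a manifold \<Rightarrow> 'a endo_field \<Rightarrow> 'a tensor12_field \<Rightarrow> 'a kconnection \<Rightarrow> 'a chart \<Rightarrow> 'a \<Rightarrow> (real^4 \<Rightarrow> real) \<Rightarrow> bool" where
  "shift_at M J \<Gamma> A c p h \<longleftrightarrow> (\<forall>U s u. openin (top_space M) U \<and> p \<in> U \<and> kstar_section M J U s \<longrightarrow>
     A s c p u = kconn J \<Gamma> (\<lambda>_ _ _. 0) s c p u + (2 * h u) *\<^sub>R (mfield J c p ** s c p))"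

lemma shift_at_kconn: "shift_at M J \<Gamma> (kconn J \<Gamma> \<eta>) c p (\<eta> c p)"
  by (simp add: shift_at_def kconn_def)

text \<open>The j,k-part of \<open>a\<close> anticommutes with i, so half of i times the commutator
  is exactly this part, and subtracting it leaves the i-part.\<close>

lemma quat_half_commutator:
  assumes "a \<in> imquat"
  shows "a - (1/2) *\<^sub>R qmul qi (qmul a qi - qmul qi a) = (a$2) *\<^sub>R qi"
  using assms by (simp add: vec_eq_iff forall_4 quat_nth imquat_iff)

context spinor_manifold
begin

lemma zero_one_form: "one_form M (\<lambda>_ _ _. 0)"
  using chart_openI openin_chart_dom
  by (auto simp: one_form_def intro!: linearI smooth_in_const)

lemma unitary_connectionD:
  assumes A: "unitary_connection M g J A" and U: "openin (top_space M) U" and s: "kstar_section M J U s"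
    and c: "c \<in> atlas M" "p \<in> U" "p \<in> chart_dom c"
  shows unitary_mem: "A s c p u \<in> kstar J c p"
    and unitary_leibniz: "\<And>f :: 'a \<Rightarrow> complex. smooth_function M U f \<Longrightarrow>
      A (\<lambda>c p. kscale J c p (f p) (s c p)) c p u
        = kscale J c p (pd c f p u) (s c p) + kscale J c p (f p) (A s c p u)"
    and unitary_local: "\<And>t. kstar_section M J U t \<Longrightarrow>
      (\<And>c p. c \<in> atlas M \<Longrightarrow> p \<in> U \<Longrightarrow> p \<in> chart_dom c \<Longrightarrow> s c p = t c p) \<Longrightarrow> A s c p = A t c p"
    and unitary_metric: "\<And>t. kstar_section M J U t \<Longrightarrow>
      pd c (\<lambda>x. kinner g c x (s c x) (t c x)) p u
        = kinner g c p (A s c p u) (t c p) + kinner g c p (s c p) (A t c p u)"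
proof -
  note 1 = conjunct1[OF A[unfolded unitary_connection_def], rule_format, OF conjI[OF U s]]
  show "A s c p u \<in> kstar J c p"
    using conjunct1[OF 1] c unfolding kstar_form1_def by blast
  have p: "p \<in> U \<inter> chart_dom c" using c by simp
  show "A (\<lambda>c p. kscale J c p (f p) (s c p)) c p u
      = kscale J c p (pd c f p u) (s c p) + kscale J c p (f p) (A s c p u)"
    if "smooth_function M U f" for f :: "'a \<Rightarrow> complex"
    by (rule conjunct2[OF 1, rule_format, OF that c(1) p])
  fix t assume t: "kstar_section M J U t"
  note 2 = conjunct2[OF A[unfolded unitary_connection_def], rule_format, OF conjI[OF U conjI[OF s t]]]
  show "pd c (\<lambda>x. kinner g c x (s c x) (t c x)) p u
      = kinner g c p (A s c p u) (t c p) + kinner g c p (s c p) (A t c p u)"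
    by (rule conjunct2[OF conjunct2[OF 2, rule_format, OF c(1) p]])
  assume "\<And>c p. c \<in> atlas M \<Longrightarrow> p \<in> U \<Longrightarrow> p \<in> chart_dom c \<Longrightarrow> s c p = t c p"
  then have "\<forall>c\<in>atlas M. \<forall>p\<in>U \<inter> chart_dom c. s c p = t c p" by auto
  then show "A s c p = A t c p"
    using mp[OF conjunct1[OF 2[rule_format]]] c(1) p by blast
qed

context
  fixes U E
  assumes E: "u2_chart M g J U E"
begin

context
  fixes c p
  assumes c: "c \<in> atlas M" "p \<in> U" "p \<in> chart_dom c"
begin

lemma inverse_J: "mfield J c p ** matrix_inv (mfield E c p) = matrix_inv (mfield E c p) ** lmul qi"
proof -
  let ?E = "mfield E c p" and ?F = "matrix_inv (mfield E c p)"
  have "?F ** (?E ** mfield J c p) ** ?F = ?F ** (lmul qi ** ?E) ** ?F"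
    by (simp add: u2_J[OF E c])
  moreover have "?F ** (?E ** mfield J c p) ** ?F = mfield J c p ** ?F"
    by (simp add: matrix_mul_assoc u2_inverse[OF E c])
  moreover have "?F ** (lmul qi ** ?E) ** ?F = ?F ** lmul qi"
    by (simp add: matrix_mul_assoc[symmetric] u2_inverse[OF E c])
  ultimately show ?thesis by simp
qed

lemma kframe_eq: "kframe J E c p = matrix_inv (mfield E c p) ** kref ** transpose (matrix_inv (mfield E c p))"
proof -
  let ?F = "matrix_inv (mfield E c p)"
  have "inv (E c p) = (\<lambda>v. ?F *v v)"
  proof (rule inv_equality)
    fix v
    have "?F *v (mfield E c p *v v) = v" by (simp add: matrix_vector_mul_assoc u2_inverse[OF E c])
    then show "?F *v E c p v = v" by (simp add: u2_apply[OF E c, of v])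
    have "mfield E c p *v (?F *v v) = v" by (simp add: matrix_vector_mul_assoc u2_inverse[OF E c])
    then show "E c p (?F *v v) = v" by (simp add: u2_apply[OF E c, of "?F *v v"])
  qed
  then have "kframe J E c p = bivector (?F *v qone) (?F *v qj)
      - bivector (mfield J c p *v (?F *v qone)) (mfield J c p *v (?F *v qj))"
    by (simp add: kframe_def cwedge_def J_apply[OF c(1,3), of "?F *v qone"]
        J_apply[OF c(1,3), of "?F *v qj"])
  also have "\<dots> = bivector (?F *v qone) (?F *v qj) - bivector (?F *v qmul qi qone) (?F *v qmul qi qj)"
    by (simp add: matrix_vector_mul_assoc inverse_J) (simp add: matrix_vector_mul_assoc[symmetric])
  also have "\<dots> = ?F ** kref ** transpose ?F"
    by (simp add: bivector_matrix kref_def matrix_mult_diff_left matrix_mult_diff_right)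
  finally show ?thesis .
qed

lemma frame_transpose_inverse:
  "transpose (matrix_inv (mfield E c p)) ** transpose (mfield E c p) = mat 1"
  "transpose (mfield E c p) ** transpose (matrix_inv (mfield E c p)) = mat 1"
  by (simp_all flip: matrix_transpose_mul add: u2_inverse[OF E c])

lemma frame_conj_inverse:
  "matrix_inv (mfield E c p) ** (mfield E c p ** \<beta> ** transpose (mfield E c p)) ** transpose (matrix_inv (mfield E c p)) = \<beta>"
  "mfield E c p ** (matrix_inv (mfield E c p) ** \<beta> ** transpose (matrix_inv (mfield E c p))) ** transpose (mfield E c p) = \<beta>"
proof -
  let ?E = "mfield E c p" and ?F = "matrix_inv (mfield E c p)"
  have "?F ** (?E ** \<beta> ** transpose ?E) ** transpose ?F = (?F ** ?E) ** \<beta> ** (transpose ?E ** transpose ?F)"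
    "?E ** (?F ** \<beta> ** transpose ?F) ** transpose ?E = (?E ** ?F) ** \<beta> ** (transpose ?F ** transpose ?E)"
    by (simp_all only: matrix_mul_assoc)
  then show "?F ** (?E ** \<beta> ** transpose ?E) ** transpose ?F = \<beta>" "?E ** (?F ** \<beta> ** transpose ?F) ** transpose ?E = \<beta>"
    by (simp_all add: u2_inverse[OF E c] frame_transpose_inverse)
qed

lemma frame_conj_inject:
  "mfield E c p ** \<beta> ** transpose (mfield E c p) = mfield E c p ** \<gamma> ** transpose (mfield E c p) \<Longrightarrow> \<beta> = \<gamma>"
  by (metis frame_conj_inverse(1))

lemma kframe_conj: "mfield E c p ** kframe J E c p ** transpose (mfield E c p) = kref"
  unfolding kframe_eq by (rule frame_conj_inverse(2))

lemma J_conj: "mfield E c p ** (mfield J c p ** \<beta>) ** transpose (mfield E c p)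
    = lmul qi ** (mfield E c p ** \<beta> ** transpose (mfield E c p))"
  by (simp only: matrix_mul_assoc u2_J[OF E c])

lemma kproj_conj: "mfield E c p ** kproj J c p \<beta> ** transpose (mfield E c p)
    = (1/2) *\<^sub>R (mfield E c p ** \<beta> ** transpose (mfield E c p)
      - lmul qi ** (mfield E c p ** \<beta> ** transpose (mfield E c p)) ** transpose (lmul qi))"
proof -
  let ?E = "mfield E c p" and ?J = "mfield J c p"
  have "transpose ?J ** transpose ?E = transpose ?E ** transpose (lmul qi)"
    using arg_cong[OF u2_J[OF E c], of transpose] by (simp add: matrix_transpose_mul)
  then have "?E ** (?J ** \<beta> ** transpose ?J) ** transpose ?E
      = (?E ** ?J) ** \<beta> ** (transpose ?E ** transpose (lmul qi))"
    by (simp add: matrix_mul_assoc[symmetric])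
  then have "?E ** (?J ** \<beta> ** transpose ?J) ** transpose ?E
      = lmul qi ** (?E ** \<beta> ** transpose ?E) ** transpose (lmul qi)"
    unfolding u2_J[OF E c] by (simp add: matrix_mul_assoc)
  then show ?thesis
    by (simp add: kproj_def matrix_mult_scaleR_left matrix_mult_scaleR_right matrix_mult_diff_left matrix_mult_diff_right)
qed

lemma kframe_mem: "kframe J E c p \<in> kstar J c p"
  unfolding kframe_def kstar_def by (intro span_base) auto

lemma kframe_nonzero: "mfield J c p ** kframe J E c p \<noteq> 0"
proof
  assume "mfield J c p ** kframe J E c p = 0"
  then have "mfield J c p ** (mfield J c p ** kframe J E c p) = 0" by simp
  then have "kframe J E c p = 0" by (simp add: J_cancel[OF c(1,3)])
  then have "kref = 0" using kframe_conj by simp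
  then have "kref $ 1 $ 3 = 0" by simp
  then show False by (simp add: kref_nth)
qed

text \<open>Conjugation by the frame carries J to left multiplication by i and hence the equations
  of the line to those of \<open>kref_span\<close>.\<close>

lemma kstar_in_frame:
  assumes "\<beta> \<in> kstar J c p"
  defines "Z \<equiv> mfield E c p ** \<beta> ** transpose (mfield E c p)"
  shows "\<beta> = kscale J c p (Complex (Z$1$3) (Z$1$4)) (kframe J E c p)"
proof (rule frame_conj_inject)
  let ?E = "mfield E c p"
  have "transpose Z = - Z"
    using assms(1) by (simp add: Z_def kstar_iff[OF c(1,3)] transpose_ring matrix_ring)
  moreover have "lmul qi ** Z ** transpose (lmul qi) = - Z"
  proof -
    let ?Y = "lmul qi ** Z ** transpose (lmul qi)"
    have e: "Z = (1/2) *\<^sub>R (Z - ?Y)"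
      using kproj_conj[of \<beta>] unfolding kproj_id[OF c(1,3) assms(1)] Z_def[symmetric] .
    have "2 *\<^sub>R Z = 2 *\<^sub>R ((1/2) *\<^sub>R (Z - ?Y))" using e by (rule arg_cong)
    then have "Z + Z = Z - ?Y" by (simp add: scaleR_2)
    then have "Z + Z - Z = Z - ?Y - Z" by simp
    then have "Z = - ?Y" by simp
    then show ?thesis by (metis minus_minus)
  qed
  ultimately have "Z = Z$1$3 *\<^sub>R kref + Z$1$4 *\<^sub>R (lmul qi ** kref)" by (rule kref_span)
  then show "?E ** \<beta> ** transpose ?E =
      ?E ** kscale J c p (Complex (Z$1$3) (Z$1$4)) (kframe J E c p) ** transpose ?E"
    unfolding kscale_def
    by (simp add: matrix_add_ldistrib matrix_mult_add_left matrix_mult_scaleR_left matrix_mult_scaleR_right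
        J_conj kframe_conj Z_def[symmetric])
qed

lemma kinner_frame: "kinner g c p \<beta> \<gamma> = (1/4) *
    ((mfield E c p ** \<beta> ** transpose (mfield E c p)) \<bullet> (mfield E c p ** \<gamma> ** transpose (mfield E c p)))"
proof -
  let ?E = "mfield E c p"
  have "(?E ** \<beta> ** transpose ?E) \<bullet> (?E ** \<gamma> ** transpose ?E)
      = \<beta> \<bullet> (transpose ?E ** (?E ** \<gamma> ** transpose ?E ** ?E))"
    by (simp only: inner_matrix_right[of "?E ** \<beta>"] inner_matrix_left[of ?E \<beta>] transpose_transpose)
  also have "\<dots> = \<beta> \<bullet> (gram g c p ** \<gamma> ** gram g c p)"
    unfolding u2_gram[OF E c, symmetric] by (simp only: matrix_mul_assoc)
  finally show ?thesis by (simp add: kinner_gram[OF c(1,3)])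
qed

lemma kinner_kframe: "kinner g c p (kframe J E c p) (kframe J E c p) = 1"
  "kinner g c p (kframe J E c p) (mfield J c p ** kframe J E c p) = 0"
  "kinner g c p (mfield J c p ** kframe J E c p) (kframe J E c p) = 0"
  by (simp_all add: kinner_frame J_conj kframe_conj kref_inner inner_commute[of "lmul qi ** kref" kref])

end

lemma kstar_section_kframe: "kstar_section M J U (kframe J E)"
  unfolding kstar_section_def
proof (intro conjI ballI)
  fix c p assume "c \<in> atlas M" "p \<in> U \<inter> chart_dom c"
  then show "kframe J E c p \<in> kstar J c p" using kframe_mem by auto
next
  fix c c' p assume c: "c \<in> atlas M" "c' \<in> atlas M" and "p \<in> U \<inter> chart_dom c \<inter> chart_dom c'"
  then have p: "p \<in> U" "p \<in> chart_dom c" "p \<in> chart_dom c'" by auto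
  let ?P = "matrix (jac c c' p)"
  have e: "mfield E c' p ** ?P = mfield E c p" by (rule u2_jac[OF E c p])
  have "mfield E c' p ** (?P ** kframe J E c p ** transpose ?P) ** transpose (mfield E c' p)
      = (mfield E c' p ** ?P) ** kframe J E c p ** transpose (mfield E c' p ** ?P)"
    by (simp add: matrix_transpose_mul matrix_mul_assoc)
  also have "\<dots> = kref" unfolding e by (rule kframe_conj[OF c(1) p(1,2)])
  finally show "kframe J E c' p = bivector_law c c' p (kframe J E c p)"
    unfolding bivector_law_def
    by (rule frame_conj_inject[OF c(2) p(1,3), OF trans[OF kframe_conj[OF c(2) p(1,3)] sym]])
next
  have U: "openin (top_space M) U" by (rule u2_openin[OF E])
  show "smooth_field M U (kframe J E)"
    unfolding smooth_field_iff[OF U]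
  proof
    fix c assume c: "c \<in> atlas M"
    have "smooth_in c U (\<lambda>p. matrix_inv (mfield E c p) ** kref ** transpose (matrix_inv (mfield E c p)))"
      by (intro smooth_in_matrix_mult smooth_in_transpose u2_smooth[OF E c] smooth_in_const chart_openI[OF c U])
    then show "smooth_in c U (kframe J E c)"
      by (rule smooth_in_cong) (use c kframe_eq in auto)
  qed
qed

text \<open>In the frame the section is the constant \<open>kref\<close>, so only the connection
  matrix acts on it, and \<open>kref_connection\<close> keeps the i-part of the left form. Thus the
  connection form \<alpha> is \<open>a$2\<close> plus the shift.\<close>

lemma kconn_kframe:
  assumes c: "c \<in> atlas M" "p \<in> U" "p \<in> chart_dom c" and ab: "conn_forms \<Gamma> E c p u a b"
  shows "kconn J \<Gamma> \<eta> (kframe J E) c p u = (2 * (a$2 + \<eta> c p u)) *\<^sub>R (mfield J c p ** kframe J E c p)"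
proof -
  let ?E = "mfield E c" and ?s = "kframe J E c" and ?G = "matrix (\<Gamma> c p u)"
  let ?W = "lmul a - rmul b"
  have U: "openin (top_space M) U" by (rule u2_openin[OF E])
  note sE = u2_smooth(2)[OF E c(1)] and ss = kstar_sectionD(3)[OF kstar_section_kframe U c(1)]
  note sET = smooth_in_transpose[OF sE] and sEs = smooth_in_matrix_mult[OF sE ss]
  have EG: "?E p ** ?G = pd c ?E p u + ?W ** ?E p" and a: "a \<in> imquat" and b: "b \<in> imquat"
    using ab conn_forms_iff[OF E c] by blast+
  have "pd c (\<lambda>x. ?E x ** ?s x ** transpose (?E x)) p u = pd c (\<lambda>x. kref) p u"
    by (rule fun_cong[OF pd_cong[OF smooth_in_const[OF chart_openI[OF c(1) U]] c(2,3)]])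
      (use kframe_conj c in auto)
  then have d: "pd c ?E p u ** ?s p ** transpose (?E p) + ?E p ** pd c ?s p u ** transpose (?E p)
      + ?E p ** ?s p ** transpose (pd c ?E p u) = 0"
    by (simp add: pd_matrix_mult[OF c(2,3) sEs sET] pd_matrix_mult[OF c(2,3) sE ss] pd_transpose[OF c(2,3) sE]
        matrix_mult_add_left)
  have EGT: "transpose ?G ** transpose (?E p) = transpose (pd c ?E p u) + transpose (?E p) ** transpose ?W"
    using arg_cong[OF EG, of transpose] by (simp add: matrix_transpose_mul transpose_add)
  have "?E p ** bivector_covd \<Gamma> c ?s p u ** transpose (?E p)
      = ?E p ** pd c ?s p u ** transpose (?E p) + (?E p ** ?G) ** ?s p ** transpose (?E p)
        + ?E p ** ?s p ** (transpose ?G ** transpose (?E p))"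
    by (simp add: bivector_covd_def matrix_add_ldistrib matrix_mult_add_left matrix_mul_assoc)
  also have "\<dots> = ?W ** (?E p ** ?s p ** transpose (?E p)) + (?E p ** ?s p ** transpose (?E p)) ** transpose ?W"
    unfolding EG EGT using d
    by (simp add: matrix_add_ldistrib matrix_mult_add_left matrix_mul_assoc algebra_simps)
  finally have Z: "?E p ** bivector_covd \<Gamma> c ?s p u ** transpose (?E p) = ?W ** kref + kref ** transpose ?W"
    unfolding kframe_conj[OF c] .
  have "?E p ** kproj J c p (bivector_covd \<Gamma> c ?s p u) ** transpose (?E p) = (2 * a$2) *\<^sub>R (lmul qi ** kref)"
    unfolding kproj_conj[OF c] Z by (rule kref_connection[OF a b refl refl])
  also have "\<dots> = ?E p ** ((2 * a$2) *\<^sub>R (mfield J c p ** ?s p)) ** transpose (?E p)"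
    by (simp add: matrix_mult_scaleR_left matrix_mult_scaleR_right J_conj[OF c] kframe_conj[OF c])
  finally have "kproj J c p (bivector_covd \<Gamma> c ?s p u) = (2 * a$2) *\<^sub>R (mfield J c p ** ?s p)"
    by (rule frame_conj_inject[OF c])
  then show ?thesis by (simp add: kconn_def algebra_simps)
qed

text \<open>The section has constant norm one, so the real part of its connection form is
  zero.\<close>

lemma unitary_kframe:
  assumes A: "unitary_connection M g J A" and c: "c \<in> atlas M" "p \<in> U" "p \<in> chart_dom c"
  obtains y where "A (kframe J E) c p u = y *\<^sub>R (mfield J c p ** kframe J E c p)"
proof -
  let ?s = "kframe J E"
  have U: "openin (top_space M) U" by (rule u2_openin[OF E])
  note s = kstar_section_kframe
  have "A ?s c p u \<in> kstar J c p" by (rule unitary_mem[OF A U s c])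
  then obtain z where z: "A ?s c p u = kscale J c p z (?s c p)" using kstar_in_frame[OF c] by blast
  have "pd c (\<lambda>x. kinner g c x (?s c x) (?s c x)) p u
      = kinner g c p (A ?s c p u) (?s c p) + kinner g c p (?s c p) (A ?s c p u)"
    by (rule unitary_metric[OF A U s c s])
  moreover have "pd c (\<lambda>x. kinner g c x (?s c x) (?s c x)) p u = pd c (\<lambda>x. 1) p u"
    by (rule fun_cong[OF pd_cong[OF smooth_in_const[OF chart_openI[OF c(1) U]] c(2,3)]])
      (use kinner_kframe(1) c in auto)
  ultimately have 0: "kinner g c p (A ?s c p u) (?s c p) + kinner g c p (?s c p) (A ?s c p u) = 0" by simp
  have "kinner g c p (kscale J c p z (?s c p)) (?s c p) = Re z"
  proof -
    have "kinner g c p (kscale J c p z (?s c p)) (?s c p)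
        = Re z * kinner g c p (?s c p) (?s c p) + Im z * kinner g c p (mfield J c p ** ?s c p) (?s c p)"
      unfolding kscale_def kinner_gram[OF c(1,3)] by (simp add: inner_add_left algebra_simps)
    then show ?thesis by (simp add: kinner_kframe[OF c])
  qed
  moreover have "kinner g c p (?s c p) (kscale J c p z (?s c p)) = Re z"
  proof -
    have "kinner g c p (?s c p) (kscale J c p z (?s c p))
        = Re z * kinner g c p (?s c p) (?s c p) + Im z * kinner g c p (?s c p) (mfield J c p ** ?s c p)"
      unfolding kscale_def kinner_gram[OF c(1,3)] by (simp add: inner_add_right matrix_ring algebra_simps)
    then show ?thesis by (simp add: kinner_kframe[OF c])
  qed
  ultimately have "Re z = 0" using 0 unfolding z by simp
  then show ?thesis using that[of "Im z"] z by (simp add: kscale_def)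
qed

lemma kstar_section_in_frame:
  assumes s: "kstar_section M J V s" and V: "openin (top_space M) V" "V \<subseteq> U"
  obtains f :: "'a \<Rightarrow> complex" where "smooth_function M V f"
    "\<And>c p. c \<in> atlas M \<Longrightarrow> p \<in> V \<Longrightarrow> p \<in> chart_dom c \<Longrightarrow> s c p = kscale J c p (f p) (kframe J E c p)"
proof -
  define Z where "Z c p = mfield E c p ** s c p ** transpose (mfield E c p)" for c p
  \<comment> \<open>The coefficient has to be a function on the manifold, while sections are given
    chart by chart. A chart is chosen at every point; \<open>Zinv\<close> shows that the value does
    not depend on it.\<close>
  define ch where "ch p = (SOME c. c \<in> atlas M \<and> p \<in> chart_dom c)" for p
  define f where "f p = Complex (Z (ch p) p $ 1 $ 3) (Z (ch p) p $ 1 $ 4)" for p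
  have Zinv: "Z c' p = Z c p" if "c \<in> atlas M" "c' \<in> atlas M" "p \<in> V" "p \<in> chart_dom c" "p \<in> chart_dom c'" for c c' p
  proof -
    let ?P = "matrix (jac c c' p)"
    have e: "mfield E c' p ** ?P = mfield E c p" by (rule u2_jac[OF E]) (use that V in auto)
    have "Z c' p = mfield E c' p ** (?P ** s c p ** transpose ?P) ** transpose (mfield E c' p)"
      unfolding Z_def using kstar_sectionD(2)[OF s V(1) that] by simp
    also have "\<dots> = (mfield E c' p ** ?P) ** s c p ** transpose (mfield E c' p ** ?P)"
      by (simp add: matrix_transpose_mul matrix_mul_assoc)
    finally show ?thesis unfolding e Z_def .
  qed
  have feq: "f p = Complex (Z c p $ 1 $ 3) (Z c p $ 1 $ 4)"
    if "c \<in> atlas M" "p \<in> V" "p \<in> chart_dom c" for c p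
  proof -
    have "ch p \<in> atlas M \<and> p \<in> chart_dom (ch p)"
      unfolding ch_def by (rule someI[of _ c]) (use that in auto)
    then show ?thesis unfolding f_def using Zinv[of c "ch p" p] that by simp
  qed
  have "smooth_function M V f"
    unfolding smooth_function_def smooth_field_iff[OF V(1)]
  proof
    fix c assume c: "c \<in> atlas M"
    have sE: "smooth_in c V (mfield E c)"
      by (rule smooth_in_subset[OF u2_smooth(2)[OF E c] V(2) chart_openI[OF c V(1)]])
    have "smooth_in c V (Z c)"
      unfolding Z_def by (intro smooth_in_matrix_mult smooth_in_transpose sE kstar_sectionD(3)[OF s V(1) c])
    then have "smooth_in c V (\<lambda>p. Complex (Z c p $ 1 $ 3) (Z c p $ 1 $ 4))"
      by (intro smooth_in_Complex smooth_in_nth)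
    then show "smooth_in c V f" by (rule smooth_in_cong) (use feq c in auto)
  qed
  moreover have "s c p = kscale J c p (f p) (kframe J E c p)" if "c \<in> atlas M" "p \<in> V" "p \<in> chart_dom c" for c p
    unfolding feq[OF that] Z_def
    by (rule kstar_in_frame) (use that V kstar_sectionD(1)[OF s V(1)] in auto)
  ultimately show ?thesis by (rule that)
qed

text \<open>Both connections obey the same Leibniz rule, so their difference is complex linear over
  functions and its value on the frame determines it on every section.\<close>

lemma unitary_difference_frame:
  assumes A: "unitary_connection M g J A" and c: "c \<in> atlas M" "p \<in> U" "p \<in> chart_dom c"
    and h: "A (kframe J E) c p u = kconn J \<Gamma> (\<lambda>_ _ _. 0) (kframe J E) c p u + (2 * h) *\<^sub>R (mfield J c p ** kframe J E c p)"
    and V: "openin (top_space M) V" "p \<in> V" and s: "kstar_section M J V s"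
  shows "A s c p u = kconn J \<Gamma> (\<lambda>_ _ _. 0) s c p u + (2 * h) *\<^sub>R (mfield J c p ** s c p)"
proof -
  let ?V = "U \<inter> V" and ?k = "kframe J E"
  have o: "openin (top_space M) ?V" using u2_openin[OF E] V by blast
  have pV: "p \<in> ?V" using c V by auto
  have s': "kstar_section M J ?V s" by (rule kstar_section_subset[OF s V(1) o]) auto
  have k': "kstar_section M J ?V ?k" by (rule kstar_section_subset[OF kstar_section_kframe u2_openin[OF E] o]) auto
  obtain f where f: "smooth_function M ?V f"
    and sf: "\<And>c p. c \<in> atlas M \<Longrightarrow> p \<in> ?V \<Longrightarrow> p \<in> chart_dom c \<Longrightarrow> s c p = kscale J c p (f p) (?k c p)"
    using kstar_section_in_frame[OF s' o] by auto
  let ?fs = "\<lambda>c p. kscale J c p (f p) (?k c p)"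
  have fs: "kstar_section M J ?V ?fs"
    unfolding kstar_section_def
  proof (intro conjI ballI)
    fix c p assume "c \<in> atlas M" "p \<in> ?V \<inter> chart_dom c"
    then show "?fs c p \<in> kstar J c p" using sf[of c p] kstar_sectionD(1)[OF s' o, of c p] by auto
  next
    fix c c' p assume "c \<in> atlas M" "c' \<in> atlas M" "p \<in> ?V \<inter> chart_dom c \<inter> chart_dom c'"
    then show "?fs c' p = bivector_law c c' p (?fs c p)"
      using sf[of c p] sf[of c' p] kstar_sectionD(2)[OF s' o, of c c' p] by (auto simp: bivector_law_def)
  next
    show "smooth_field M ?V ?fs"
      unfolding smooth_field_iff[OF o]
    proof
      fix c assume c: "c \<in> atlas M"
      show "smooth_in c ?V (?fs c)"
        by (rule smooth_in_cong[OF kstar_sectionD(3)[OF s' o c]]) (use sf c in auto)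
    qed
  qed
  \<comment> \<open>A connection acts on total functions, so locality is invoked before the section
    may be replaced by the multiple of the frame it equals on \<open>?V\<close>.\<close>
  have gen: "B s c p u = kscale J c p (pd c f p u) (?k c p) + kscale J c p (f p) (B ?k c p u)"
    if B: "unitary_connection M g J B" for B
  proof -
    have "B s c p = B ?fs c p"
      by (rule unitary_local[OF B o s' c(1) pV c(3) fs]) (rule sf)
    moreover have "B ?fs c p u = kscale J c p (pd c f p u) (?k c p) + kscale J c p (f p) (B ?k c p u)"
      by (rule unitary_leibniz[OF B o k' c(1) pV c(3) f])
    ultimately show ?thesis by simp
  qed
  have J: "kscale J c p z (r *\<^sub>R (mfield J c p ** \<beta>)) = r *\<^sub>R (mfield J c p ** kscale J c p z \<beta>)" for z r \<beta>
    by (simp add: kscale_def matrix_ring J_cancel[OF c(1,3)] algebra_simps)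
  show ?thesis
    unfolding gen[OF A] gen[OF kconn_unitary[OF zero_one_form]] h kscale_add J sf[OF c(1) pV c(3)]
    by (simp add: algebra_simps)
qed

end

text \<open>The shift is found at one point, direction by direction; the norms at that point see it
  only through its values on an orthonormal basis.\<close>

lemma unitary_difference:
  assumes A: "unitary_connection M g J A" and c: "c \<in> atlas M" "p \<in> chart_dom c"
  obtains h where "shift_at M J \<Gamma> A c p h"
proof -
  obtain U E where E: "u2_chart M g J U E" and p: "p \<in> U"
    using u2_chart_exists[OF c] .
  have "\<exists>h. A (kframe J E) c p u = kconn J \<Gamma> (\<lambda>_ _ _. 0) (kframe J E) c p u
      + (2 * h) *\<^sub>R (mfield J c p ** kframe J E c p)" for u
  proof -
    obtain y where y: "A (kframe J E) c p u = y *\<^sub>R (mfield J c p ** kframe J E c p)"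
      using unitary_kframe[OF E A c(1) p c(2)] .
    obtain y' where y': "kconn J \<Gamma> (\<lambda>_ _ _. 0) (kframe J E) c p u = y' *\<^sub>R (mfield J c p ** kframe J E c p)"
      using unitary_kframe[OF E kconn_unitary[OF zero_one_form] c(1) p c(2)] .
    show ?thesis
      unfolding y y' by (rule exI[of _ "(y - y') / 2"]) (simp add: field_simps flip: scaleR_left_distrib)
  qed
  then obtain h where h: "\<And>u. A (kframe J E) c p u = kconn J \<Gamma> (\<lambda>_ _ _. 0) (kframe J E) c p u
      + (2 * h u) *\<^sub>R (mfield J c p ** kframe J E c p)" by metis
  have "shift_at M J \<Gamma> A c p h"
    unfolding shift_at_def using unitary_difference_frame[OF E A c(1) p c(2) h] by blast
  then show ?thesis by (rule that)
qed

lemma det_conn_form_iff: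
  assumes E: "u2_chart M g J U E" and c: "c \<in> atlas M" "p \<in> U" "p \<in> chart_dom c"
    and ab: "conn_forms \<Gamma> E c p u a b" and h: "shift_at M J \<Gamma> A c p h"
  shows "det_conn_form J A E c p u \<alpha> \<longleftrightarrow> \<alpha> = a$2 + h u"
proof -
  let ?k = "mfield J c p ** kframe J E c p"
  have "A (kframe J E) c p u = kconn J \<Gamma> (\<lambda>_ _ _. 0) (kframe J E) c p u + (2 * h u) *\<^sub>R ?k"
    using h u2_openin[OF E] kstar_section_kframe[OF E] c(2) unfolding shift_at_def by blast
  also have "\<dots> = (2 * (a$2 + h u)) *\<^sub>R ?k"
    by (simp add: kconn_kframe[OF E c ab] algebra_simps)
  finally have "A (kframe J E) c p u = (2 * (a$2 + h u)) *\<^sub>R ?k" .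
  moreover have "kscale J c p (2 * \<i> * complex_of_real \<alpha>) (kframe J E c p) = (2 * \<alpha>) *\<^sub>R ?k"
    by (simp add: kscale_def)
  ultimately show ?thesis
    unfolding det_conn_form_def using kframe_nonzero[OF E c] by auto
qed

text \<open>Resolves the definite description: a vector written without a frame satisfies the
  defining equation in every U(2)-chart around the point, and a single such chart makes it
  unique.\<close>

lemma spin_B_formula:
  assumes c: "c \<in> atlas M" "p \<in> chart_dom c" and h: "shift_at M J \<Gamma> A c p h"
  shows "spin_B M g J \<Gamma> \<phi> A c p u v =
    spin_B0 J \<Gamma> \<phi> c p u *v v + h u *\<^sub>R (mfield J c p *v (mfield \<phi> c p *v v))"
proof -
  let ?J = "mfield J c p" and ?\<Phi> = "mfield \<phi> c" and ?G = "matrix (\<Gamma> c p u)" and ?N = "nabla \<Gamma> c (mfield J c) p u"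
  \<comment> \<open>The Levi-Civita derivative of the field acts with the full left form.
    Subtracting its j,k-part, which is (1/2) J \<nabla>J, and adding \<open>h\<close> times J turns
    that form into \<alpha> i.\<close>
  define z where "z = (pd c ?\<Phi> p u + ?G ** ?\<Phi> p + h u *\<^sub>R (?J ** ?\<Phi> p) - (1/2) *\<^sub>R (?J ** ?N ** ?\<Phi> p)) *v v"
  have key: "E c p z = pd c (\<lambda>x. E c x (\<phi> c x v)) p u + \<alpha> *\<^sub>R qmul qi (E c p (\<phi> c p v)) - qmul (E c p (\<phi> c p v)) b"
    if E: "u2_chart M g J U E" and p: "p \<in> U" and ab: "conn_forms \<Gamma> E c p u a b"
      and \<alpha>: "det_conn_form J A E c p u \<alpha>" for U E a b \<alpha>
  proof -
    note cp = c(1) p c(2)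
    let ?E = "mfield E c"
    have U: "openin (top_space M) U" by (rule u2_openin[OF E])
    note sE = u2_smooth(2)[OF E c(1)] and s\<Phi> = endo_smooth(2)[OF endomorphism_field_spinor c(1) U]
      and sJ = endo_smooth(2)[OF endomorphism_field_J c(1) U]
    have EG: "?E p ** ?G = pd c ?E p u + (lmul a - rmul b) ** ?E p" and a: "a \<in> imquat"
      using ab conn_forms_iff[OF E cp] by blast+
    have \<alpha>': "\<alpha> = a$2 + h u" using \<alpha> det_conn_form_iff[OF E cp ab h] by blast
    have EJ: "?E p ** ?J = lmul qi ** ?E p" by (rule u2_J[OF E cp])
    have EN: "?E p ** ?N = lmul (qmul a qi - qmul qi a) ** ?E p"
      using nabla_frame[OF E cp ab sJ smooth_in_const[OF chart_openI[OF c(1) U], of qi]] u2_J[OF E c(1)] by simp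
    have "pd c (\<lambda>x. E c x (\<phi> c x v)) p u = pd c (\<lambda>x. (?E x ** ?\<Phi> x) *v v) p u"
    proof (rule fun_cong[OF pd_cong[symmetric]])
      show "smooth_in c U (\<lambda>x. E c x (\<phi> c x v))"
        by (rule smooth_in_cong[OF smooth_in_matrix_vector_mult[OF smooth_in_matrix_mult[OF sE s\<Phi>] smooth_in_const[OF chart_openI[OF c(1) U]], of v]])
          (use c in \<open>auto simp: matrix_vector_mul_assoc[symmetric] matrix_mult_linear u2_linear[OF E] endo_linear[OF endomorphism_field_spinor]\<close>)
    qed (use p c in \<open>auto simp: matrix_vector_mul_assoc[symmetric] matrix_mult_linear u2_linear[OF E] endo_linear[OF endomorphism_field_spinor]\<close>)
    also have "\<dots> = (pd c ?E p u ** ?\<Phi> p + ?E p ** pd c ?\<Phi> p u) *v v"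
      by (simp add: pd_matrix_vector_mult[OF p c(2) smooth_in_matrix_mult[OF sE s\<Phi>] smooth_in_const[OF chart_openI[OF c(1) U]]]
          pd_matrix_mult[OF p c(2) sE s\<Phi>])
    finally have d: "pd c (\<lambda>x. E c x (\<phi> c x v)) p u = \<dots>" .
    define y where "y = (?E p ** ?\<Phi> p) *v v"
    have Ew: "E c p (\<phi> c p v) = y"
      using cp by (simp add: y_def matrix_vector_mul_assoc[symmetric] matrix_mult_linear u2_linear[OF E]
          endo_linear[OF endomorphism_field_spinor])
    have "E c p z = ?E p *v z" by (rule u2_apply[OF E cp])
    also have "\<dots> = (?E p ** pd c ?\<Phi> p u + (?E p ** ?G) ** ?\<Phi> p + h u *\<^sub>R ((?E p ** ?J) ** ?\<Phi> p)
        - (1/2) *\<^sub>R ((?E p ** ?J) ** ?N ** ?\<Phi> p)) *v v"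
      unfolding z_def by (simp add: matrix_vector_mul_assoc matrix_ring)
    also have "(?E p ** ?J) ** ?N ** ?\<Phi> p = lmul qi ** (?E p ** ?N) ** ?\<Phi> p"
      by (simp add: EJ matrix_mul_assoc)
    also have "\<dots> = lmul (qmul qi (qmul a qi - qmul qi a)) ** (?E p ** ?\<Phi> p)"
      unfolding EN lmul_mult[symmetric] by (simp add: matrix_mul_assoc)
    finally have "E c p z = (?E p ** pd c ?\<Phi> p u + pd c ?E p u ** ?\<Phi> p) *v v
        + (qmul a y - qmul y b + h u *\<^sub>R qmul qi y) - (1/2) *\<^sub>R qmul (qmul qi (qmul a qi - qmul qi a)) y"
      unfolding EG EJ y_def
      by (simp add: matrix_vector_mult_add_rdistrib matrix_vector_mult_diff_rdistrib matrix_mult_add_left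
          matrix_mult_diff_left matrix_vector_mul_assoc[symmetric] matrix_mul_assoc[symmetric]
          matrix_vector_mult_scaleR_left)
    also have "\<dots> = (?E p ** pd c ?\<Phi> p u + pd c ?E p u ** ?\<Phi> p) *v v
        + (qmul (a - (1/2) *\<^sub>R qmul qi (qmul a qi - qmul qi a)) y + h u *\<^sub>R qmul qi y) - qmul y b"
      by (simp add: bounded_bilinear.diff_left[OF bounded_bilinear_qmul]
          bounded_bilinear.scaleR_left[OF bounded_bilinear_qmul] algebra_simps)
    also have "\<dots> = (pd c ?E p u ** ?\<Phi> p + ?E p ** pd c ?\<Phi> p u) *v v + \<alpha> *\<^sub>R qmul qi y - qmul y b"
      unfolding quat_half_commutator[OF a] \<alpha>'
      by (simp add: bounded_bilinear.scaleR_left[OF bounded_bilinear_qmul] algebra_simps)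
    finally show ?thesis unfolding d Ew .
  qed
  obtain U E where E: "u2_chart M g J U E" and p: "p \<in> U" using u2_chart_exists[OF c] .
  obtain a b where ab: "conn_forms \<Gamma> E c p u a b" using conn_forms_exist[OF E c(1) p c(2)] .
  have \<alpha>: "det_conn_form J A E c p u (a$2 + h u)" using det_conn_form_iff[OF E c(1) p c(2) ab h] by blast
  have "spin_covd M g J \<Gamma> A c (\<lambda>x. \<phi> c x v) p u = z"
    unfolding spin_covd_def
  proof (rule the_equality)
    show "\<forall>U E a b \<alpha>. u2_chart M g J U E \<and> p \<in> U \<and> conn_forms \<Gamma> E c p u a b \<and> det_conn_form J A E c p u \<alpha> \<longrightarrow>
      E c p z = pd c (\<lambda>x. E c x (\<phi> c x v)) p u + \<alpha> *\<^sub>R qmul qi (E c p (\<phi> c p v)) - qmul (E c p (\<phi> c p v)) b"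
      using key by blast
  next
    fix z' assume *: "\<forall>U E a b \<alpha>. u2_chart M g J U E \<and> p \<in> U \<and> conn_forms \<Gamma> E c p u a b \<and> det_conn_form J A E c p u \<alpha> \<longrightarrow>
      E c p z' = pd c (\<lambda>x. E c x (\<phi> c x v)) p u + \<alpha> *\<^sub>R qmul qi (E c p (\<phi> c p v)) - qmul (E c p (\<phi> c p v)) b"
    \<comment> \<open>An actual U(2)-chart with all its forms is used here: without one the
      quantified condition would be vacuous and would determine no vector.\<close>
    have "E c p z' = E c p z"
      by (rule trans[OF _ key[OF E p ab \<alpha>, symmetric]], rule *[rule_format]) (use E p ab \<alpha> in blast)
    then have "mfield E c p *v z' = mfield E c p *v z"
      by (simp only: u2_apply[OF E c(1) p c(2), of z'] u2_apply[OF E c(1) p c(2), of z])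
    then have "matrix_inv (mfield E c p) *v (mfield E c p *v z') = matrix_inv (mfield E c p) *v (mfield E c p *v z)"
      by simp
    then show "z' = z" by (simp add: matrix_vector_mul_assoc u2_inverse[OF E c(1) p c(2)])
  qed
  then show ?thesis
    using c unfolding spin_B_def z_def spin_B0_def nabla_def covd_def
    by (simp add: matrix_vector_mult_add_rdistrib matrix_vector_mult_diff_rdistrib Gamma_apply[OF c, of u v]
        spinor_apply[OF c, of "_ *v _"] matrix_vector_mul_assoc
        matrix_vector_mult_scaleR_left)
qed

end


section \<open>Minimization of the norms of the tensor and of its alternation\<close>

section \<open>Minimality\<close>

text \<open>Completing the square: as functions of the covector \<open>h\<close>, the two norms are minimized by
  \<open>t1\<close> and \<open>4/3 (t1 - t2)\<close>, respectively.\<close>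

lemma shifted_tensor_norms:
  fixes G :: "real^4 \<Rightarrow> real^4 \<Rightarrow> real" and B0 B :: "real^4 \<Rightarrow> real^4 \<Rightarrow> real^4"
    and e :: "4 \<Rightarrow> real^4" and t1 t2 :: "4 \<Rightarrow> real"
  assumes G: "bilinear G" "\<And>v w. G v w = G w v"
    and e: "\<And>j k. G (e j) (e k) = (if j = k then 1 else 0)"
    and K: "\<And>v w. G (K v) (K w) = N * G v w"
    and t1: "\<And>j. (\<Sum>k\<in>UNIV. G (B0 (e j) (e k)) (K (e k))) = - 4 * N * t1 j"
    and t2: "\<And>j. (\<Sum>k\<in>UNIV. G (B0 (e k) (e j)) (K (e k))) = - 4 * N * t2 j"
    and B: "\<And>u v. B u v = B0 u v + h u *\<^sub>R K v"
  shows "(\<Sum>j\<in>UNIV. \<Sum>k\<in>UNIV. G (B (e j) (e k)) (B (e j) (e k)))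
      = ((\<Sum>j\<in>UNIV. \<Sum>k\<in>UNIV. G (B0 (e j) (e k)) (B0 (e j) (e k))) - 4 * N * (\<Sum>j\<in>UNIV. (t1 j)\<^sup>2))
        + 4 * N * (\<Sum>j\<in>UNIV. (h (e j) - t1 j)\<^sup>2)" (is ?th1)
    and "(\<Sum>j\<in>UNIV. \<Sum>k\<in>UNIV. G ((1/2) *\<^sub>R (B (e j) (e k) - B (e k) (e j))) ((1/2) *\<^sub>R (B (e j) (e k) - B (e k) (e j))))
      = (1/2) * ((\<Sum>j\<in>UNIV. \<Sum>k\<in>UNIV. G (B0 (e j) (e k)) (B0 (e j) (e k)))
           - (\<Sum>j\<in>UNIV. \<Sum>k\<in>UNIV. G (B0 (e j) (e k)) (B0 (e k) (e j))))
        - 3/2 * N * (\<Sum>j\<in>UNIV. (4/3 * (t1 j - t2 j))\<^sup>2)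
        + 3/2 * N * (\<Sum>j\<in>UNIV. (h (e j) - 4/3 * (t1 j - t2 j))\<^sup>2)" (is ?th2)
proof -
  note bl = bilinear_ladd[OF G(1)] bilinear_radd[OF G(1)] bilinear_lmul[OF G(1)] bilinear_rmul[OF G(1)]
    bilinear_lsub[OF G(1)] bilinear_rsub[OF G(1)]
  let ?b = "\<lambda>j k. B0 (e j) (e k)" and ?h = "\<lambda>j. h (e j)" and ?K = "\<lambda>k. K (e k)"
  have KK: "G (?K k) (?K k) = N" for k by (simp add: K e)
  have 1: "(\<Sum>k\<in>UNIV. G (B (e j) (e k)) (B (e j) (e k)))
      = (\<Sum>k\<in>UNIV. G (?b j k) (?b j k)) - 8 * N * t1 j * ?h j + 4 * N * (?h j)\<^sup>2" for j
  proof -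
    have "G (B (e j) (e k)) (B (e j) (e k)) = G (?b j k) (?b j k) + 2 * ?h j * G (?b j k) (?K k) + N * (?h j)\<^sup>2" for k
      by (simp add: B bl KK G(2)[of "?K k" "?b j k"] power2_eq_square algebra_simps)
    then have "(\<Sum>k\<in>UNIV. G (B (e j) (e k)) (B (e j) (e k)))
        = (\<Sum>k\<in>UNIV. G (?b j k) (?b j k)) + 2 * ?h j * (\<Sum>k\<in>UNIV. G (?b j k) (?K k)) + 4 * (N * (?h j)\<^sup>2)"
      by (simp add: sum.distrib sum_distrib_left)
    then show ?thesis by (simp add: t1)
  qed
  have S1: "(\<Sum>j\<in>UNIV. \<Sum>k\<in>UNIV. G (B (e j) (e k)) (B (e j) (e k)))
      = (\<Sum>j\<in>UNIV. \<Sum>k\<in>UNIV. G (?b j k) (?b j k)) + (\<Sum>j\<in>UNIV. 4 * N * (?h j)\<^sup>2 - 8 * N * t1 j * ?h j)"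
    by (simp add: 1 sum.distrib sum_subtractf)
  show ?th1
    unfolding S1 by (simp add: sum_distrib_left sum_subtractf[symmetric] sum.distrib[symmetric])
      (simp add: power2_eq_square algebra_simps sum.distrib sum_subtractf)
  \<comment> \<open>The quadratic term pairs \<open>K (e k)\<close> with \<open>K (e j)\<close> and
    survives only for j = k. It contributes N times the sum of the squares of \<open>h\<close>,
    against 4N in the full norm.\<close>
  have "G (B (e j) (e k)) (B (e k) (e j)) = G (?b j k) (?b k j) + ?h k * G (?b j k) (?K j)
      + ?h j * G (?b k j) (?K k) + (if j = k then N * ?h j * ?h k else 0)" for j k
    by (simp add: B bl K e G(2)[of "?K k" "?b k j"] algebra_simps)
  then have "(\<Sum>j\<in>UNIV. \<Sum>k\<in>UNIV. G (B (e j) (e k)) (B (e k) (e j)))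
      = (\<Sum>j\<in>UNIV. \<Sum>k\<in>UNIV. G (?b j k) (?b k j)) + (\<Sum>j\<in>UNIV. \<Sum>k\<in>UNIV. ?h k * G (?b j k) (?K j))
        + (\<Sum>j\<in>UNIV. \<Sum>k\<in>UNIV. ?h j * G (?b k j) (?K k)) + (\<Sum>j\<in>UNIV. N * ?h j * ?h j)"
    by (simp add: sum.distrib)
  also have "(\<Sum>j\<in>UNIV. \<Sum>k\<in>UNIV. ?h k * G (?b j k) (?K j)) = (\<Sum>j\<in>UNIV. \<Sum>k\<in>UNIV. ?h j * G (?b k j) (?K k))"
    by (rule sum.swap)
  also have "(\<Sum>j\<in>UNIV. \<Sum>k\<in>UNIV. ?h j * G (?b k j) (?K k)) = (\<Sum>j\<in>UNIV. - 4 * N * t2 j * ?h j)"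
    by (simp add: sum_distrib_left[symmetric] t2 algebra_simps)
  finally have S2: "(\<Sum>j\<in>UNIV. \<Sum>k\<in>UNIV. G (B (e j) (e k)) (B (e k) (e j)))
      = (\<Sum>j\<in>UNIV. \<Sum>k\<in>UNIV. G (?b j k) (?b k j)) + (\<Sum>j\<in>UNIV. N * (?h j)\<^sup>2 - 8 * N * t2 j * ?h j)"
    by (simp add: sum_subtractf sum_negf sum_distrib_left power2_eq_square mult_ac)
  have "G ((1/2) *\<^sub>R (x - y)) ((1/2) *\<^sub>R (x - y)) = (1/4) * G x x + (1/4) * G y y - (1/2) * G x y" for x y
    by (simp add: bl G(2)[of y x] algebra_simps)
  then have "(\<Sum>j\<in>UNIV. \<Sum>k\<in>UNIV. G ((1/2) *\<^sub>R (B (e j) (e k) - B (e k) (e j))) ((1/2) *\<^sub>R (B (e j) (e k) - B (e k) (e j))))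
      = (1/4) * (\<Sum>j\<in>UNIV. \<Sum>k\<in>UNIV. G (B (e j) (e k)) (B (e j) (e k)))
      + (1/4) * (\<Sum>j\<in>UNIV. \<Sum>k\<in>UNIV. G (B (e k) (e j)) (B (e k) (e j)))
      - (1/2) * (\<Sum>j\<in>UNIV. \<Sum>k\<in>UNIV. G (B (e j) (e k)) (B (e k) (e j)))"
    by (simp add: sum.distrib sum_subtractf sum_distrib_left)
  also have "(\<Sum>j\<in>UNIV. \<Sum>k\<in>UNIV. G (B (e k) (e j)) (B (e k) (e j)))
      = (\<Sum>j\<in>UNIV. \<Sum>k\<in>UNIV. G (B (e j) (e k)) (B (e j) (e k)))"
    by (rule sum.swap)
  finally have S3: "(\<Sum>j\<in>UNIV. \<Sum>k\<in>UNIV. G ((1/2) *\<^sub>R (B (e j) (e k) - B (e k) (e j))) ((1/2) *\<^sub>R (B (e j) (e k) - B (e k) (e j))))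
      = (1/2) * ((\<Sum>j\<in>UNIV. \<Sum>k\<in>UNIV. G (B (e j) (e k)) (B (e j) (e k)))
        - (\<Sum>j\<in>UNIV. \<Sum>k\<in>UNIV. G (B (e j) (e k)) (B (e k) (e j))))"
    by (simp add: algebra_simps)
  \<comment> \<open>The leading coefficient is (4 - 1)/2 times N and the linear one is -4 N (t1 -
    t2), which puts the vertex at 4/3 (t1 - t2).\<close>
  have "(1/2) * ((\<Sum>j\<in>UNIV. 4 * N * (?h j)\<^sup>2 - 8 * N * t1 j * ?h j) - (\<Sum>j\<in>UNIV. N * (?h j)\<^sup>2 - 8 * N * t2 j * ?h j))
      = 3/2 * N * (\<Sum>j\<in>UNIV. (?h j - 4/3 * (t1 j - t2 j))\<^sup>2) - 3/2 * N * (\<Sum>j\<in>UNIV. (4/3 * (t1 j - t2 j))\<^sup>2)"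
    unfolding sum_subtractf[symmetric] sum_distrib_left
    by (intro sum.cong refl) (simp add: power2_eq_square field_simps)
  then show ?th2
    unfolding S3 S1 S2 by (simp add: algebra_simps)
qed

text \<open>With F the matrix of the frame, F F^T inverts the Gram matrix. This turns the metric
  trace into the matrix trace and also expands every vector in the frame.\<close>

lemma trace_orthonormal:
  fixes e :: "4 \<Rightarrow> real^4" and X Gm :: "real^4^4"
  assumes e: "\<And>j k. e j \<bullet> (Gm *v e k) = (if j = k then 1 else 0)" and sym: "transpose Gm = Gm"
  shows "(\<Sum>k\<in>UNIV. (X *v e k) \<bullet> (Gm *v e k)) = trace X" "\<exists>w. v = (\<Sum>k\<in>UNIV. w k *\<^sub>R e k)"
proof -
  define F :: "real^4^4" where "F = (\<chi> i k. e k $ i)"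
  have entry: "(transpose F ** Y ** F) $ j $ k = e j \<bullet> (Y *v e k)" for Y j k
    by (simp add: F_def matrix_mult_nth4 matrix_vector_mult_nth4 inner4 transpose_nth algebra_simps)
  have FGF: "transpose F ** Gm ** F = mat 1"
    unfolding vec_eq_iff entry e by (simp add: mat_def)
  then have 1: "F ** (transpose F ** Gm) = mat 1" using matrix_left_right_inverse by blast
  have "(\<Sum>k\<in>UNIV. (X *v e k) \<bullet> (Gm *v e k)) = trace (transpose F ** (transpose X ** Gm) ** F)"
    by (simp add: trace_def entry inner_matrix_vector matrix_vector_mul_assoc del: transpose_matrix_vector)
  also have "\<dots> = trace (transpose X ** (Gm ** F ** transpose F))"
    by (metis matrix_mul_assoc trace_mul_sym)
  also have "Gm ** F ** transpose F = mat 1"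
    using arg_cong[OF 1, of transpose] by (simp add: matrix_transpose_mul sym)
  finally show "(\<Sum>k\<in>UNIV. (X *v e k) \<bullet> (Gm *v e k)) = trace X"
    by (simp add: trace_def transpose_nth)
  have "v = F *v ((transpose F ** Gm) *v v)" by (simp add: matrix_vector_mul_assoc 1)
  also have "\<dots> = (\<Sum>k\<in>UNIV. ((transpose F ** Gm) *v v) $ k *\<^sub>R e k)"
    by (simp add: vec_eq_iff F_def matrix_vector_mult_def mult.commute)
  finally show "\<exists>w. v = (\<Sum>k\<in>UNIV. w k *\<^sub>R e k)"
    by (rule exI[of "\<lambda>w. v = (\<Sum>k\<in>UNIV. w k *\<^sub>R e k)"])
qed

text \<open>Used both to compute traces in a quaternionic frame and to see that they agree in all
  charts.\<close>

lemma trace_conj: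
  fixes A A' P :: "real^'n^'n"
  assumes "A' ** P = P ** A" "det P \<noteq> 0"
  shows "trace A' = trace A"
proof -
  have "trace A' = trace (A' ** (P ** matrix_inv P))" by (simp add: matrix_inv_cancel assms)
  also have "\<dots> = trace (P ** (A ** matrix_inv P))" by (simp add: matrix_mul_assoc assms(1))
  also have "\<dots> = trace (A ** (matrix_inv P ** P))" by (metis matrix_mul_assoc trace_mul_sym)
  finally show ?thesis by (simp add: matrix_inv_cancel assms)
qed

text \<open>The adjoint of \<open>\<phi>\<close>, that is, multiplication by \<open>conj q\<close>; the formula is visibly natural and smooth.\<close>

definition spinor_adj :: "'a endo_field \<Rightarrow> 'a chart \<Rightarrow> 'a \<Rightarrow> real^4^4" where
  "spinor_adj \<phi> c p = (trace (mfield \<phi> c p) / 2) *\<^sub>R mat 1 - mfield \<phi> c p"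

text \<open>If \<phi> is left multiplication by q in a U(2)-chart, this is 4|q|^2.\<close>

definition spinor_norm :: "'a endo_field \<Rightarrow> 'a chart \<Rightarrow> 'a \<Rightarrow> real" where
  "spinor_norm \<phi> c p = trace (spinor_adj \<phi> c p ** mfield \<phi> c p)"

text \<open>In a U(2)-chart this is left multiplication by conj(q) i \<beta> / (4|q|^2), where
  \<beta> represents \<open>spin_B0\<close>. The divisor is chosen so that its trace is the
  minimizing shift itself.\<close>

definition spin_T :: "'a endo_field \<Rightarrow> 'a tensor12_field \<Rightarrow> 'a endo_field \<Rightarrow> 'a chart \<Rightarrow> 'a \<Rightarrow> real^4 \<Rightarrow> real^4^4" where
  "spin_T J \<Gamma> \<phi> c p u = inverse (spinor_norm \<phi> c p) *\<^sub>R (spinor_adj \<phi> c p ** mfield J c p ** spin_B0 J \<Gamma> \<phi> c p u)"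

text \<open>Contracts the covector slot with the output, whereas \<open>match_form\<close> contracts
  the vector slot. It enters through the transposed term of the alternation.\<close>

definition spin_t :: "'a endo_field \<Rightarrow> 'a tensor12_field \<Rightarrow> 'a endo_field \<Rightarrow> ('a, real^4 \<Rightarrow> real) field" where
  "spin_t J \<Gamma> \<phi> c p v = trace (matrix (\<lambda>u. spin_T J \<Gamma> \<phi> c p u *v v))"

text \<open>The next two 1-forms are the shifts that minimize \<open>\<B>\<^sup>A\<phi>\<close> and its alternation.\<close>

definition match_form :: "'a endo_field \<Rightarrow> 'a tensor12_field \<Rightarrow> 'a endo_field \<Rightarrow> ('a, real^4 \<Rightarrow> real) field" where
  "match_form J \<Gamma> \<phi> c p v = trace (spin_T J \<Gamma> \<phi> c p v)"

definition torsion_form :: "'a endo_field \<Rightarrow> 'a tensor12_field \<Rightarrow> 'a endo_field \<Rightarrow> ('a, real^4 \<Rightarrow> real) field" where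
  "torsion_form J \<Gamma> \<phi> c p v = 4/3 * (match_form J \<Gamma> \<phi> c p v - spin_t J \<Gamma> \<phi> c p v)"

context spinor_manifold
begin

text \<open>The trace of left multiplication by q is 4 Re q, and 2 Re q - q is conj(q).\<close>

lemma spinor_adj_frame:
  assumes E: "u2_chart M g J U E" and c: "c \<in> atlas M" "p \<in> U" "p \<in> chart_dom c"
    and q: "mfield E c p ** mfield \<phi> c p = lmul q ** mfield E c p"
  shows "mfield E c p ** spinor_adj \<phi> c p = lmul (qcnj q) ** mfield E c p"
    and "spinor_norm \<phi> c p = 4 * (q \<bullet> q)"
    and "spinor_adj \<phi> c p ** mfield \<phi> c p = (q \<bullet> q) *\<^sub>R mat 1"
    and "mfield \<phi> c p ** spinor_adj \<phi> c p = (q \<bullet> q) *\<^sub>R mat 1"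
    and "q \<noteq> 0"
    and "transpose (mfield \<phi> c p) ** gram g c p = gram g c p ** spinor_adj \<phi> c p"
proof -
  let ?E = "mfield E c p" and ?F = "matrix_inv (mfield E c p)"
  have tr: "trace (mfield \<phi> c p) = 4 * q$1"
    using trace_conj[OF q[symmetric]] u2_det[OF E c] by (simp add: trace_lmul)
  have "lmul (qcnj q) = (2 * q$1) *\<^sub>R mat 1 - lmul q"
    by (simp add: vec_eq_iff forall_4 lmul_nth qcnj_nth mat_nth4)
  then show adj: "?E ** spinor_adj \<phi> c p = lmul (qcnj q) ** ?E"
    unfolding spinor_adj_def by (simp add: tr matrix_ring q)
  have "?E ** (spinor_adj \<phi> c p ** mfield \<phi> c p) = ?E ** ((q \<bullet> q) *\<^sub>R mat 1)"
    by (simp only: matrix_mul_assoc adj) (simp add: matrix_mul_assoc[symmetric] q, simp add: matrix_mul_assoc lmul_mult qmul_qcnj lmul_scaleR lmul_one matrix_ring)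
  then show am: "spinor_adj \<phi> c p ** mfield \<phi> c p = (q \<bullet> q) *\<^sub>R mat 1"
    by (rule matrix_cancel_left[OF u2_inverse(2)[OF E c]])
  have "?E ** (mfield \<phi> c p ** spinor_adj \<phi> c p) = ?E ** ((q \<bullet> q) *\<^sub>R mat 1)"
    by (simp only: matrix_mul_assoc q) (simp add: matrix_mul_assoc[symmetric] adj, simp add: matrix_mul_assoc lmul_mult qmul_qcnj lmul_scaleR lmul_one matrix_ring)
  then show "mfield \<phi> c p ** spinor_adj \<phi> c p = (q \<bullet> q) *\<^sub>R mat 1"
    by (rule matrix_cancel_left[OF u2_inverse(2)[OF E c]])
  show "spinor_norm \<phi> c p = 4 * (q \<bullet> q)"
    unfolding spinor_norm_def am by (simp add: trace_scaleR trace_def mat_def)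
  show "q \<noteq> 0"
  proof
    assume "q = 0"
    then have "lmul q = 0" by (simp add: vec_eq_iff forall_4 lmul_nth)
    then have "?E ** mfield \<phi> c p = ?E ** 0" using q by simp
    then have "mfield \<phi> c p = 0" by (rule matrix_cancel_left[OF u2_inverse(2)[OF E c]])
    then have "\<phi> c p v = 0" for v by (simp add: spinor_apply[OF c(1,3), of v])
    then show False using nonzero c unfolding nowhere_zero_def by blast
  qed
  have "transpose (mfield \<phi> c p) ** gram g c p = transpose (?E ** mfield \<phi> c p) ** ?E"
    unfolding u2_gram[OF E c, symmetric] by (simp add: matrix_transpose_mul matrix_mul_assoc)
  also have "\<dots> = transpose ?E ** (lmul (qcnj q) ** ?E)"
    unfolding q by (simp add: matrix_transpose_mul transpose_lmul matrix_mul_assoc)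
  also have "\<dots> = gram g c p ** spinor_adj \<phi> c p"
    unfolding adj[symmetric] u2_gram[OF E c, symmetric] by (simp add: matrix_mul_assoc)
  finally show "transpose (mfield \<phi> c p) ** gram g c p = gram g c p ** spinor_adj \<phi> c p" .
qed

context
  fixes c p
  assumes c: "c \<in> atlas M" "p \<in> chart_dom c"
begin

lemma spinor_adj_facts:
  "spinor_norm \<phi> c p > 0"
  "spinor_adj \<phi> c p ** mfield \<phi> c p = (spinor_norm \<phi> c p / 4) *\<^sub>R mat 1"
  "mfield \<phi> c p ** spinor_adj \<phi> c p = (spinor_norm \<phi> c p / 4) *\<^sub>R mat 1"
  "transpose (mfield \<phi> c p) ** gram g c p = gram g c p ** spinor_adj \<phi> c p"
proof -
  obtain U E where E: "u2_chart M g J U E" and p: "p \<in> U" using u2_chart_exists[OF c] .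
  obtain q where "mfield E c p ** mfield \<phi> c p = lmul q ** mfield E c p" using u2_spinor[OF E c(1) p c(2)] .
  note f = spinor_adj_frame[OF E c(1) p c(2) this]
  show "spinor_norm \<phi> c p > 0" using f(2,5) by simp
  show "spinor_adj \<phi> c p ** mfield \<phi> c p = (spinor_norm \<phi> c p / 4) *\<^sub>R mat 1"
    "mfield \<phi> c p ** spinor_adj \<phi> c p = (spinor_norm \<phi> c p / 4) *\<^sub>R mat 1"
    "transpose (mfield \<phi> c p) ** gram g c p = gram g c p ** spinor_adj \<phi> c p"
    using f by simp_all
qed

lemma metric_spinor: "g c p (mfield \<phi> c p *v v) w = g c p v (spinor_adj \<phi> c p *v w)"
proof -
  have "g c p (mfield \<phi> c p *v v) w = v \<bullet> ((transpose (mfield \<phi> c p) ** gram g c p) *v w)"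
    by (simp only: metric_gram[OF c] inner_matrix_vector matrix_vector_mul_assoc)
  then show ?thesis
    unfolding spinor_adj_facts(4) by (simp only: metric_gram[OF c] matrix_vector_mul_assoc)
qed

lemma metric_J_skew: "g c p (mfield J c p *v v) w = - g c p v (mfield J c p *v w)"
  using J_skew[OF c, of v w] J_apply[OF c, of v] J_apply[OF c, of w] by simp

lemma metric_J_spinor: "g c p (mfield J c p *v (mfield \<phi> c p *v v)) (mfield J c p *v (mfield \<phi> c p *v w))
    = spinor_norm \<phi> c p / 4 * g c p v w"
proof -
  have JJ: "mfield J c p *v (mfield J c p *v x) = - x" for x
    by (simp add: matrix_vector_mul_assoc mfield_J_square[OF c] matrix_vector_mult_minus_left)
  have "spinor_adj \<phi> c p *v (mfield \<phi> c p *v w) = (spinor_norm \<phi> c p / 4) *\<^sub>R w"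
    unfolding matrix_vector_mul_assoc spinor_adj_facts(2)
    by (simp add: matrix_vector_mult_scaleR_left)
  then show ?thesis
    by (simp add: metric_J_skew JJ bilinear_rneg[OF bilinear_metric[OF c]] metric_spinor bilinear_rmul[OF bilinear_metric[OF c]])
qed

lemma metric_spin_T: "g c p (spin_B0 J \<Gamma> \<phi> c p u *v v) (mfield J c p *v (mfield \<phi> c p *v w))
    = - spinor_norm \<phi> c p * g c p (spin_T J \<Gamma> \<phi> c p u *v v) w"
proof -
  let ?x = "spin_B0 J \<Gamma> \<phi> c p u *v v"
  have "g c p ?x (mfield J c p *v (mfield \<phi> c p *v w)) = - g c p (mfield J c p *v ?x) (mfield \<phi> c p *v w)"
    by (simp add: metric_J_skew)
  also have "\<dots> = - g c p (spinor_adj \<phi> c p *v (mfield J c p *v ?x)) w"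
    by (simp add: metric_sym[OF c, of _ "_ *v w"] metric_spinor metric_sym[OF c, of w])
  also have "spinor_adj \<phi> c p *v (mfield J c p *v ?x) = spinor_norm \<phi> c p *\<^sub>R (spin_T J \<Gamma> \<phi> c p u *v v)"
    using spinor_adj_facts(1)
    by (simp add: spin_T_def matrix_vector_mul_assoc matrix_mul_assoc matrix_vector_mult_scaleR_left)
  finally show ?thesis by (simp add: bilinear_lmul[OF bilinear_metric[OF c]])
qed

lemma linear_spin_T: "linear (\<lambda>u. spin_T J \<Gamma> \<phi> c p u)"
proof -
  note 1 = linear_nabla[OF c c(2) endo_smooth(2)[OF endomorphism_field_spinor c(1) openin_chart_dom[OF c(1)]]]
    and 2 = linear_nabla[OF c c(2) endo_smooth(2)[OF endomorphism_field_J c(1) openin_chart_dom[OF c(1)]]]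
  show ?thesis
    by (rule linearI) (simp_all add: spin_T_def spin_B0_def linear_add[OF 1] linear_add[OF 2] linear_scale[OF 1]
        linear_scale[OF 2] matrix_ring algebra_simps)
qed

lemma linear_spin_T_vec: "linear (\<lambda>u. spin_T J \<Gamma> \<phi> c p u *v v)"
  by (rule linearI) (simp_all add: linear_add[OF linear_spin_T] linear_scale[OF linear_spin_T]
      matrix_vector_mult_add_rdistrib matrix_vector_mult_scaleR_left)

lemma orthonormal_exists: "\<exists>e :: 4 \<Rightarrow> real^4. \<forall>j k. g c p (e j) (e k) = (if j = k then 1 else 0)"
proof -
  obtain U E where E: "u2_chart M g J U E" and p: "p \<in> U" using u2_chart_exists[OF c] .
  let ?F = "matrix_inv (mfield E c p)"
  have "g c p (?F *v axis j 1) (?F *v axis k 1) = (if j = k then 1 else 0)" for j k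
  proof -
    have "g c p (?F *v axis j 1) (?F *v axis k 1)
        = (mfield E c p *v (?F *v axis j 1)) \<bullet> (mfield E c p *v (?F *v axis k 1))"
    proof -
      have "(A *v x) \<bullet> (A *v y) = x \<bullet> ((transpose A ** A) *v y)" for A :: "real^4^4" and x y
        by (simp only: inner_matrix_vector matrix_vector_mul_assoc)
      then show ?thesis unfolding metric_gram[OF c] u2_gram[OF E c(1) p c(2), symmetric] by simp
    qed
    then show ?thesis
      by (simp add: matrix_vector_mul_assoc u2_inverse[OF E c(1) p c(2)] inner_axis_axis)
  qed
  then show ?thesis by (intro exI[of _ "\<lambda>k. ?F *v axis k 1"]) blast
qed

text \<open>Here \<open>e\<close> is the very basis chosen inside \<open>tensor_inner\<close>, and
  \<open>C1\<close>, \<open>C2\<close> are the same for all connections, so minimization reduces to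
  sums of squares. The factor 3/8 is 3/2 times N with N = |q|^2, a quarter of
  \<open>spinor_norm\<close>.\<close>

lemma tensor_inner_shift:
  obtains e :: "4 \<Rightarrow> real^4" and C1 C2 where
    "\<And>v. \<exists>w. v = (\<Sum>k\<in>UNIV. w k *\<^sub>R e k)"
    "\<And>A h. shift_at M J \<Gamma> A c p h \<Longrightarrow>
      tensor_inner g c p (spin_B M g J \<Gamma> \<phi> A c p) (spin_B M g J \<Gamma> \<phi> A c p)
        = C1 + spinor_norm \<phi> c p * (\<Sum>j\<in>UNIV. (h (e j) - match_form J \<Gamma> \<phi> c p (e j))\<^sup>2)"
    "\<And>A h. shift_at M J \<Gamma> A c p h \<Longrightarrow>
      tensor_inner g c p (alt_part (spin_B M g J \<Gamma> \<phi> A) c p) (alt_part (spin_B M g J \<Gamma> \<phi> A) c p)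
        = C2 + 3/8 * spinor_norm \<phi> c p * (\<Sum>j\<in>UNIV. (h (e j) - torsion_form J \<Gamma> \<phi> c p (e j))\<^sup>2)"
proof -
  define e where "e = (SOME e :: 4 \<Rightarrow> real^4. \<forall>j k. g c p (e j) (e k) = (if j = k then 1 else 0))"
  have e: "g c p (e j) (e k) = (if j = k then 1 else 0)" for j k
    using someI_ex[OF orthonormal_exists] unfolding e_def by blast
  note tr = trace_orthonormal[of e "gram g c p", OF e[unfolded metric_gram[OF c]] transpose_gram[OF c]]
  let ?N = "spinor_norm \<phi> c p / 4" and ?B0 = "\<lambda>u v. spin_B0 J \<Gamma> \<phi> c p u *v v"
    and ?K = "\<lambda>v. mfield J c p *v (mfield \<phi> c p *v v)"
  have tr': "(\<Sum>k\<in>UNIV. g c p (X *v e k) (e k)) = trace X" for X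
    unfolding metric_gram[OF c] by (rule tr(1))
  have t1: "(\<Sum>k\<in>UNIV. g c p (?B0 (e j) (e k)) (?K (e k))) = - 4 * ?N * match_form J \<Gamma> \<phi> c p (e j)" for j
    using tr'[of "spin_T J \<Gamma> \<phi> c p (e j)"]
    by (simp add: metric_spin_T match_form_def sum_negf flip: sum_distrib_left)
  have t2: "(\<Sum>k\<in>UNIV. g c p (?B0 (e k) (e j)) (?K (e k))) = - 4 * ?N * spin_t J \<Gamma> \<phi> c p (e j)" for j
    using tr'[of "matrix (\<lambda>u. spin_T J \<Gamma> \<phi> c p u *v e j)"]
    by (simp add: metric_spin_T spin_t_def matrix_mult_linear[OF linear_spin_T_vec] sum_negf
        flip: sum_distrib_left)
  note norms = shifted_tensor_norms[OF bilinear_metric[OF c] metric_sym[OF c] e metric_J_spinor t1 t2 spin_B_formula[OF c]]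
  show ?thesis
  proof (rule that)
    show "\<And>v. \<exists>w. v = (\<Sum>k\<in>UNIV. w k *\<^sub>R e k)" by (rule tr(2))
    show "tensor_inner g c p (spin_B M g J \<Gamma> \<phi> A c p) (spin_B M g J \<Gamma> \<phi> A c p)
        = ((\<Sum>j\<in>UNIV. \<Sum>k\<in>UNIV. g c p (?B0 (e j) (e k)) (?B0 (e j) (e k))) - 4 * ?N * (\<Sum>j\<in>UNIV. (match_form J \<Gamma> \<phi> c p (e j))\<^sup>2))
          + spinor_norm \<phi> c p * (\<Sum>j\<in>UNIV. (h (e j) - match_form J \<Gamma> \<phi> c p (e j))\<^sup>2)"
      if "shift_at M J \<Gamma> A c p h" for A h
      unfolding tensor_inner_def Let_def e_def[symmetric] norms(1)[OF that] by simp
    show "tensor_inner g c p (alt_part (spin_B M g J \<Gamma> \<phi> A) c p) (alt_part (spin_B M g J \<Gamma> \<phi> A) c p)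
        = ((1/2) * ((\<Sum>j\<in>UNIV. \<Sum>k\<in>UNIV. g c p (?B0 (e j) (e k)) (?B0 (e j) (e k)))
           - (\<Sum>j\<in>UNIV. \<Sum>k\<in>UNIV. g c p (?B0 (e j) (e k)) (?B0 (e k) (e j))))
          - 3/2 * ?N * (\<Sum>j\<in>UNIV. (4/3 * (match_form J \<Gamma> \<phi> c p (e j) - spin_t J \<Gamma> \<phi> c p (e j)))\<^sup>2))
          + 3/8 * spinor_norm \<phi> c p * (\<Sum>j\<in>UNIV. (h (e j) - torsion_form J \<Gamma> \<phi> c p (e j))\<^sup>2)"
      if "shift_at M J \<Gamma> A c p h" for A h
      unfolding tensor_inner_def Let_def e_def[symmetric] alt_part_def norms(2)[OF that] torsion_form_def by simp
  qed
qed

lemma linear_match_form: "linear (match_form J \<Gamma> \<phi> c p)"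
  by (rule linearI) (simp_all add: match_form_def linear_add[OF linear_spin_T] linear_scale[OF linear_spin_T]
      trace_add trace_scaleR)

lemma linear_spin_t: "linear (spin_t J \<Gamma> \<phi> c p)"
  by (rule linearI) (simp_all add: spin_t_def trace_def matrix_def matrix_vector_right_distrib sum.distrib
      matrix_vector_mult_scaleR sum_distrib_left)

lemma linear_torsion_form: "linear (torsion_form J \<Gamma> \<phi> c p)"
  by (rule linearI) (simp_all add: torsion_form_def linear_add[OF linear_match_form] linear_add[OF linear_spin_t]
      linear_scale[OF linear_match_form] linear_scale[OF linear_spin_t] algebra_simps)

end

lemma linear_eq_on_basis:
  fixes f f' :: "real^4 \<Rightarrow> real" and e :: "4 \<Rightarrow> real^4"
  assumes "linear f" "linear f'" "\<And>v. \<exists>w. v = (\<Sum>k\<in>UNIV. w k *\<^sub>R e k)" "\<And>k. f (e k) = f' (e k)"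
  shows "f v = f' v"
proof -
  obtain w where "v = (\<Sum>k\<in>UNIV. w k *\<^sub>R e k)" using assms(3) by blast
  then show ?thesis by (simp add: linear_sum assms linear_scale)
qed


section \<open>Chart independence and smoothness of the two minimizing 1-forms\<close>

subsection \<open>The two minimizing connections\<close>

context
  fixes c c' p
  assumes c: "c \<in> atlas M" "c' \<in> atlas M" and p: "p \<in> chart_dom c" "p \<in> chart_dom c'"
begin

lemma spinor_adj_jac:
  "spinor_adj \<phi> c' p ** matrix (jac c c' p) = matrix (jac c c' p) ** spinor_adj \<phi> c p"
  "spinor_norm \<phi> c' p = spinor_norm \<phi> c p"
proof -
  let ?P = "matrix (jac c c' p)"
  have d: "det ?P \<noteq> 0" using det_jac[OF c p] by simp
  note j = endo_jac[OF endomorphism_field_spinor c p]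
  have "trace (mfield \<phi> c' p) = trace (mfield \<phi> c p)" by (rule trace_conj[OF j d])
  then show *: "spinor_adj \<phi> c' p ** ?P = ?P ** spinor_adj \<phi> c p"
    by (simp add: spinor_adj_def matrix_ring j)
  have "(spinor_adj \<phi> c' p ** mfield \<phi> c' p) ** ?P = ?P ** (spinor_adj \<phi> c p ** mfield \<phi> c p)"
    by (simp only: matrix_mul_assoc[symmetric] j) (simp only: matrix_mul_assoc *)
  then show "spinor_norm \<phi> c' p = spinor_norm \<phi> c p"
    unfolding spinor_norm_def by (rule trace_conj[OF _ d])
qed

text \<open>All ingredients are products, traces and covariant derivatives of endomorphism fields,
  so the Jacobian can be moved through them one factor at a time.\<close>

lemma spin_T_jac: "spin_T J \<Gamma> \<phi> c' p (jac c c' p u) ** matrix (jac c c' p) = matrix (jac c c' p) ** spin_T J \<Gamma> \<phi> c p u"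
proof -
  let ?P = "matrix (jac c c' p)" and ?u = "jac c c' p u"
  note j = endo_jac[OF endomorphism_field_spinor] and k = endo_jac[OF endomorphism_field_J]
  have n: "nabla \<Gamma> c' (mfield F c') p ?u ** ?P = ?P ** nabla \<Gamma> c (mfield F c) p u"
    if F: "endomorphism_field M F" for F
    by (rule nabla_jac[OF c p]) (use c endo_smooth(2)[OF F] openin_chart_dom endo_jac[OF F] in auto)
  have "(mfield J c' p ** nabla \<Gamma> c' (mfield J c') p ?u ** mfield \<phi> c' p) ** ?P
      = ?P ** (mfield J c p ** nabla \<Gamma> c (mfield J c) p u ** mfield \<phi> c p)"
    by (simp only: matrix_mul_assoc[symmetric] j[OF c p])
      (simp only: matrix_mul_assoc, simp only: matrix_mul_assoc[symmetric] n[OF endomorphism_field_J],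
       simp only: matrix_mul_assoc k[OF c p])
  then have b: "spin_B0 J \<Gamma> \<phi> c' p ?u ** ?P = ?P ** spin_B0 J \<Gamma> \<phi> c p u"
    unfolding spin_B0_def
    by (simp add: matrix_mult_diff_left matrix_mult_diff_right matrix_mult_scaleR_left matrix_mult_scaleR_right
        n[OF endomorphism_field_spinor])
  have "(spinor_adj \<phi> c' p ** mfield J c' p ** spin_B0 J \<Gamma> \<phi> c' p ?u) ** ?P
      = (spinor_adj \<phi> c' p ** mfield J c' p ** ?P) ** spin_B0 J \<Gamma> \<phi> c p u"
    by (simp only: matrix_mul_assoc[symmetric] b)
  also have "\<dots> = (spinor_adj \<phi> c' p ** ?P) ** mfield J c p ** spin_B0 J \<Gamma> \<phi> c p u"
    by (simp only: matrix_mul_assoc[symmetric] k[OF c p, symmetric])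
  also have "\<dots> = ?P ** (spinor_adj \<phi> c p ** mfield J c p ** spin_B0 J \<Gamma> \<phi> c p u)"
    by (simp only: spinor_adj_jac matrix_mul_assoc)
  finally show ?thesis
    unfolding spin_T_def spinor_adj_jac(2) by (simp add: matrix_mult_scaleR_left matrix_mult_scaleR_right)
qed

lemma match_form_jac: "match_form J \<Gamma> \<phi> c' p (jac c c' p u) = match_form J \<Gamma> \<phi> c p u"
  unfolding match_form_def using trace_conj[OF spin_T_jac] det_jac[OF c p] by simp

lemma spin_t_jac: "spin_t J \<Gamma> \<phi> c' p (jac c c' p v) = spin_t J \<Gamma> \<phi> c p v"
proof -
  let ?P = "matrix (jac c c' p)"
  have "matrix (\<lambda>u. spin_T J \<Gamma> \<phi> c' p u *v jac c c' p v) ** ?P = ?P ** matrix (\<lambda>u. spin_T J \<Gamma> \<phi> c p u *v v)"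
    unfolding matrix_eq
  proof
    fix u
    have "spin_T J \<Gamma> \<phi> c' p (jac c c' p u) *v jac c c' p v = (spin_T J \<Gamma> \<phi> c' p (jac c c' p u) ** ?P) *v v"
      by (simp add: matrix_vector_mul_assoc[symmetric] matrix_mult_linear[OF linear_jac[OF c p]])
    also have "\<dots> = jac c c' p (spin_T J \<Gamma> \<phi> c p u *v v)"
      unfolding spin_T_jac by (simp add: matrix_vector_mul_assoc[symmetric] matrix_mult_linear[OF linear_jac[OF c p]])
    finally show "matrix (\<lambda>u. spin_T J \<Gamma> \<phi> c' p u *v jac c c' p v) ** ?P *v u
        = ?P ** matrix (\<lambda>u. spin_T J \<Gamma> \<phi> c p u *v v) *v u"
      by (simp add: matrix_vector_mul_assoc[symmetric] matrix_mult_linear[OF linear_jac[OF c p]]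
          matrix_mult_linear[OF linear_spin_T_vec[OF c(1) p(1)]] matrix_mult_linear[OF linear_spin_T_vec[OF c(2) p(2)]])
  qed
  then show ?thesis
    unfolding spin_t_def by (rule trace_conj) (use det_jac[OF c p] in simp)
qed

end

lemma smooth_spin_T:
  assumes c: "c \<in> atlas M"
  shows "smooth_in c (chart_dom c) (\<lambda>p. spin_T J \<Gamma> \<phi> c p u)"
proof -
  note o = openin_chart_dom[OF c]
  note \<Phi> = endo_smooth(2)[OF endomorphism_field_spinor c o] and J = endo_smooth(2)[OF endomorphism_field_J c o]
  note const = smooth_in_const[OF chart_openI[OF c o]]
  have adj: "smooth_in c (chart_dom c) (spinor_adj \<phi> c)"
    unfolding spinor_adj_def divide_inverse
    by (intro smooth_in_diff smooth_in_scaleR smooth_in_mult smooth_in_trace \<Phi> const)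
  have norm: "smooth_in c (chart_dom c) (spinor_norm \<phi> c)"
    unfolding spinor_norm_def by (intro smooth_in_trace smooth_in_matrix_mult adj \<Phi>)
  show ?thesis
    unfolding spin_T_def spin_B0_def
    by (intro smooth_in_scaleR smooth_in_inverse norm smooth_in_matrix_mult adj J \<Phi> smooth_in_diff const smooth_nabla c o)
      (use spinor_adj_facts(1)[OF c] in force)
qed

lemma one_form_match_form: "one_form M (match_form J \<Gamma> \<phi>)"
  unfolding one_form_def
  using linear_match_form match_form_jac smooth_in_trace[OF smooth_spin_T] by (auto simp: match_form_def)

lemma one_form_torsion_form: "one_form M (torsion_form J \<Gamma> \<phi>)"
  unfolding one_form_def
proof (intro conjI ballI allI)
  show "linear (torsion_form J \<Gamma> \<phi> c p)" if "c \<in> atlas M" "p \<in> chart_dom c" for c p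
    using linear_torsion_form that by blast
  show "torsion_form J \<Gamma> \<phi> c' p (jac c c' p u) = torsion_form J \<Gamma> \<phi> c p u"
    if "c \<in> atlas M" "c' \<in> atlas M" "p \<in> chart_dom c \<inter> chart_dom c'" for c c' p u
    using match_form_jac[of c c' p] spin_t_jac[of c c' p] that by (simp add: torsion_form_def)
  show "smooth_in c (chart_dom c) (\<lambda>p. torsion_form J \<Gamma> \<phi> c p u)" if c: "c \<in> atlas M" for c u
  proof -
    note const = smooth_in_const[OF chart_openI[OF c openin_chart_dom[OF c]]]
    show ?thesis
      unfolding torsion_form_def match_form_def spin_t_def
      by (intro smooth_in_mult smooth_in_diff smooth_in_trace smooth_in_matrix smooth_in_matrix_vector_mult
          smooth_spin_T[OF c] const)
  qed
qed

text \<open>Both minima are attained, at the connections \<open>kconn\<close> of the two global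
  forms. Comparison with these makes both sums of squares of \<open>A\<close> vanish, and linearity
  extends the equality from the basis to all vectors.\<close>

lemma minimizers_agree:
  assumes A: "unitary_connection M g J A" and cm: "closest_match M g J \<Gamma> \<phi> A"
    and tm: "torsion_minimized M g J \<Gamma> \<phi> A" and c: "c \<in> atlas M" "p \<in> chart_dom c"
  shows "match_form J \<Gamma> \<phi> c p v = torsion_form J \<Gamma> \<phi> c p v"
proof -
  obtain h where h: "shift_at M J \<Gamma> A c p h" using unitary_difference[OF A c] .
  obtain e :: "4 \<Rightarrow> real^4" and C1 C2 where e: "\<And>v. \<exists>w. v = (\<Sum>k\<in>UNIV. w k *\<^sub>R e k)"
    and n1: "\<And>A h. shift_at M J \<Gamma> A c p h \<Longrightarrow>
      tensor_inner g c p (spin_B M g J \<Gamma> \<phi> A c p) (spin_B M g J \<Gamma> \<phi> A c p)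
        = C1 + spinor_norm \<phi> c p * (\<Sum>j\<in>UNIV. (h (e j) - match_form J \<Gamma> \<phi> c p (e j))\<^sup>2)"
    and n2: "\<And>A h. shift_at M J \<Gamma> A c p h \<Longrightarrow>
      tensor_inner g c p (alt_part (spin_B M g J \<Gamma> \<phi> A) c p) (alt_part (spin_B M g J \<Gamma> \<phi> A) c p)
        = C2 + 3/8 * spinor_norm \<phi> c p * (\<Sum>j\<in>UNIV. (h (e j) - torsion_form J \<Gamma> \<phi> c p (e j))\<^sup>2)"
    using tensor_inner_shift[OF c] by blast
  have pos: "spinor_norm \<phi> c p > 0" by (rule spinor_adj_facts(1)[OF c])
  have zero: "x j = 0" if "r * (\<Sum>j\<in>UNIV. (x j)\<^sup>2) \<le> 0" "r > 0" for r and x :: "4 \<Rightarrow> real" and j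
  proof -
    have "(\<Sum>j\<in>UNIV. (x j)\<^sup>2) \<le> 0" using that by (simp add: mult_le_0_iff)
    then have "(\<Sum>j\<in>UNIV. (x j)\<^sup>2) = 0" by (intro antisym sum_nonneg) auto
    then show ?thesis by (simp add: sum_nonneg_eq_0_iff)
  qed
  have "tensor_norm g c p (spin_B M g J \<Gamma> \<phi> A c p)
      \<le> tensor_norm g c p (spin_B M g J \<Gamma> \<phi> (kconn J \<Gamma> (match_form J \<Gamma> \<phi>)) c p)"
    using cm c kconn_unitary[OF one_form_match_form] unfolding closest_match_def pointwise_minimal_def by blast
  then have m: "h (e j) - match_form J \<Gamma> \<phi> c p (e j) = 0" for j
    by (intro zero[of "spinor_norm \<phi> c p"]) (simp_all add: pos tensor_norm_def n1[OF h] n1[OF shift_at_kconn])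
  have "tensor_norm g c p (alt_part (spin_B M g J \<Gamma> \<phi> A) c p)
      \<le> tensor_norm g c p (alt_part (spin_B M g J \<Gamma> \<phi> (kconn J \<Gamma> (torsion_form J \<Gamma> \<phi>))) c p)"
    using tm c kconn_unitary[OF one_form_torsion_form] unfolding torsion_minimized_def pointwise_minimal_def by blast
  then have t: "h (e j) - torsion_form J \<Gamma> \<phi> c p (e j) = 0" for j
    by (intro zero[of "3/8 * spinor_norm \<phi> c p"]) (simp_all add: pos tensor_norm_def n2[OF h] n2[OF shift_at_kconn])
  show ?thesis
    by (rule linear_eq_on_basis[OF linear_match_form[OF c] linear_torsion_form[OF c] e])
      (use m t in \<open>metis right_minus_eq\<close>)
qed

lemma common_minimizer:
  assumes eq: "\<And>c p v. c \<in> atlas M \<Longrightarrow> p \<in> chart_dom c \<Longrightarrow> match_form J \<Gamma> \<phi> c p v = torsion_form J \<Gamma> \<phi> c p v"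
  defines "A \<equiv> kconn J \<Gamma> (match_form J \<Gamma> \<phi>)"
  shows "closest_match M g J \<Gamma> \<phi> A" "torsion_minimized M g J \<Gamma> \<phi> A"
proof -
  have *: "tensor_norm g c p (spin_B M g J \<Gamma> \<phi> A c p) \<le> tensor_norm g c p (spin_B M g J \<Gamma> \<phi> A' c p) \<and>
      tensor_norm g c p (alt_part (spin_B M g J \<Gamma> \<phi> A) c p) \<le> tensor_norm g c p (alt_part (spin_B M g J \<Gamma> \<phi> A') c p)"
    if c: "c \<in> atlas M" "p \<in> chart_dom c" and A': "unitary_connection M g J A'" for c p A'
  proof -
    obtain h' where h': "shift_at M J \<Gamma> A' c p h'" using unitary_difference[OF A' c] .
    have h: "shift_at M J \<Gamma> A c p (match_form J \<Gamma> \<phi> c p)" unfolding A_def by (rule shift_at_kconn)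
    obtain e :: "4 \<Rightarrow> real^4" and C1 C2 where "\<And>v. \<exists>w. v = (\<Sum>k\<in>UNIV. w k *\<^sub>R e k)"
      and n1: "\<And>A h. shift_at M J \<Gamma> A c p h \<Longrightarrow>
        tensor_inner g c p (spin_B M g J \<Gamma> \<phi> A c p) (spin_B M g J \<Gamma> \<phi> A c p)
          = C1 + spinor_norm \<phi> c p * (\<Sum>j\<in>UNIV. (h (e j) - match_form J \<Gamma> \<phi> c p (e j))\<^sup>2)"
      and n2: "\<And>A h. shift_at M J \<Gamma> A c p h \<Longrightarrow>
        tensor_inner g c p (alt_part (spin_B M g J \<Gamma> \<phi> A) c p) (alt_part (spin_B M g J \<Gamma> \<phi> A) c p)
          = C2 + 3/8 * spinor_norm \<phi> c p * (\<Sum>j\<in>UNIV. (h (e j) - torsion_form J \<Gamma> \<phi> c p (e j))\<^sup>2)"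
      using tensor_inner_shift[OF c] by blast
    have pos: "spinor_norm \<phi> c p > 0" by (rule spinor_adj_facts(1)[OF c])
    show ?thesis
      using pos by (simp add: tensor_norm_def n1[OF h] n1[OF h'] n2[OF h] n2[OF h'] eq[OF c] sum_nonneg)
  qed
  then show "closest_match M g J \<Gamma> \<phi> A" "torsion_minimized M g J \<Gamma> \<phi> A"
    unfolding closest_match_def torsion_minimized_def pointwise_minimal_def by blast+
qed


section \<open>Closedness of the pulled-back form and the equivalence\<close>

section \<open>Closedness\<close>

text \<open>The endomorphism that represents the pulled-back form through the metric (see
  \<open>pullback_eq\<close>), namely left multiplication by conj(q) i q in a U(2)-chart.\<close>

definition pullback_endo :: "'a chart \<Rightarrow> 'a \<Rightarrow> real^4^4" where
  "pullback_endo c p = spinor_adj \<phi> c p ** mfield J c p ** mfield \<phi> c p"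

lemma smooth_pullback_endo:
  assumes "c \<in> atlas M" "openin (top_space M) U"
  shows "smooth_in c U (pullback_endo c)"
  unfolding pullback_endo_def spinor_adj_def divide_inverse
  by (intro smooth_in_matrix_mult smooth_in_diff smooth_in_scaleR smooth_in_mult smooth_in_trace
      smooth_in_const chart_openI endo_smooth endomorphism_field_spinor endomorphism_field_J assms)

lemma pullback_eq:
  assumes c: "c \<in> atlas M" "p \<in> chart_dom c"
  shows "pullback \<phi> (fundamental_form g J) c p v w = g c p (pullback_endo c p *v v) w"
proof -
  have "pullback \<phi> (fundamental_form g J) c p v w
      = g c p (mfield J c p *v (mfield \<phi> c p *v v)) (mfield \<phi> c p *v w)"
    unfolding pullback_def fundamental_form_def J_apply[OF c, of "mfield \<phi> c p *v v"]
      spinor_apply[OF c, of v] spinor_apply[OF c, of w] ..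
  also have "\<dots> = g c p (pullback_endo c p *v v) w"
    by (simp add: metric_sym[OF c, of _ "_ *v w"] metric_spinor[OF c] metric_sym[OF c, of w] pullback_endo_def
        matrix_vector_mul_assoc matrix_mul_assoc)
  finally show ?thesis .
qed

lemma pullback_skew:
  assumes c: "c \<in> atlas M" "p \<in> chart_dom c"
  shows "pullback \<phi> (fundamental_form g J) c p v w = - pullback \<phi> (fundamental_form g J) c p w v"
  unfolding pullback_def fundamental_form_def
  using J_skew[OF c] metric_sym[OF c] by metis

text \<open>The square of \<open>pullback_endo\<close> is a negative multiple of the identity, so it
  is injective, and the image of \<open>v\<close> itself serves as \<open>w\<close>.\<close>

lemma pullback_nondegenerate:
  assumes c: "c \<in> atlas M" "p \<in> chart_dom c" and v: "v \<noteq> 0"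
  shows "\<exists>w. pullback \<phi> (fundamental_form g J) c p v w \<noteq> 0"
proof -
  let ?N = "spinor_norm \<phi> c p / 4"
  have N: "?N \<noteq> 0" using spinor_adj_facts(1)[OF c] by simp
  have "mfield \<phi> c p ** (spinor_adj \<phi> c p ** (mfield J c p ** X)) = ?N *\<^sub>R (mfield J c p ** X)" for X :: "real^4^4"
    by (simp add: matrix_mul_assoc spinor_adj_facts(3)[OF c] matrix_mult_scaleR_left)
  then have "spinor_adj \<phi> c p ** mfield J c p ** mfield \<phi> c p ** pullback_endo c p
      = - (?N *\<^sub>R (spinor_adj \<phi> c p ** mfield \<phi> c p))"
    by (simp add: pullback_endo_def matrix_mul_assoc[symmetric] matrix_mult_scaleR_right J_cancel[OF c] matrix_mult_minus_right)
  then have "spinor_adj \<phi> c p ** mfield J c p ** mfield \<phi> c p ** pullback_endo c p = - (?N * ?N) *\<^sub>R mat 1"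
    by (simp add: spinor_adj_facts(2)[OF c])
  from arg_cong[OF this, of "\<lambda>X. X *v v"]
  have "spinor_adj \<phi> c p ** mfield J c p ** mfield \<phi> c p *v (pullback_endo c p *v v) = - (?N * ?N) *\<^sub>R v"
    by (simp add: matrix_vector_mul_assoc matrix_vector_mult_scaleR_left
        matrix_vector_mult_minus_left)
  then have "pullback_endo c p *v v \<noteq> 0" using v N by auto
  then show ?thesis
    using metric_pos[OF c] unfolding pullback_eq[OF c] by (metis less_irrefl)
qed

text \<open>As the metric is parallel, the derivative falls on the endomorphism. The two
  \<Gamma>-terms are kept apart because they cancel in the cyclic sum.\<close>

lemma pd_pullback:
  assumes c: "c \<in> atlas M" "p \<in> chart_dom c"
  shows "pd c (\<lambda>x. pullback \<phi> (fundamental_form g J) c x v w) p u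
    = g c p (nabla \<Gamma> c (pullback_endo c) p u *v v) w
      + pullback \<phi> (fundamental_form g J) c p (\<Gamma> c p u v) w + pullback \<phi> (fundamental_form g J) c p v (\<Gamma> c p u w)"
proof -
  let ?D = "chart_dom c" and ?S = "pullback_endo c" and ?G = "gram g c" and ?L = "matrix (\<Gamma> c p u)"
  note o = openin_chart_dom[OF c(1)]
  note const = smooth_in_const[OF chart_openI[OF c(1) o]] and sG = smooth_metric(2)[OF c(1) o]
  have sS: "smooth_in c ?D ?S"
    by (rule smooth_pullback_endo[OF c(1) o])
  note s1 = smooth_in_matrix_vector_mult[OF sS const[of v]] and s2 = smooth_in_matrix_vector_mult[OF sG const[of w]]
  have "pd c (\<lambda>x. pullback \<phi> (fundamental_form g J) c x v w) p u = pd c (\<lambda>x. (?S x *v v) \<bullet> (?G x *v w)) p u"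
    by (rule fun_cong[OF pd_cong[OF smooth_in_inner[OF s1 s2] c(2,2)]])
      (simp add: pullback_eq[OF c(1)] metric_gram[OF c(1)])
  also have "\<dots> = (pd c ?S p u *v v) \<bullet> (?G p *v w) + (?S p *v v) \<bullet> ((transpose ?L ** ?G p + ?G p ** ?L) *v w)"
    by (simp add: pd_inner[OF c(2,2) s1 s2] pd_matrix_vector_mult[OF c(2,2) sS const]
        pd_matrix_vector_mult[OF c(2,2) sG const] pd_gram[OF c])
  also have "\<dots> = (pd c ?S p u *v v) \<bullet> (?G p *v w) + (?L *v (?S p *v v)) \<bullet> (?G p *v w)
      + (?S p *v v) \<bullet> (?G p *v (?L *v w))"
  proof -
    have "(?L *v (?S p *v v)) \<bullet> (?G p *v w) = (?S p *v v) \<bullet> (transpose ?L *v (?G p *v w))"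
      by (rule inner_matrix_vector)
    then have L: "(?L *v (?S p *v v)) \<bullet> (?G p *v w) = (?S p *v v) \<bullet> ((transpose ?L ** ?G p) *v w)"
      by (simp only: matrix_vector_mul_assoc[of "transpose ?L"])
    show ?thesis
      by (simp only: L matrix_vector_mult_add_rdistrib inner_add_right add.assoc matrix_vector_mul_assoc[of "?G p" ?L])
  qed
  also have "\<dots> = (nabla \<Gamma> c ?S p u *v v) \<bullet> (?G p *v w) + (?S p *v (?L *v v)) \<bullet> (?G p *v w)
      + (?S p *v v) \<bullet> (?G p *v (?L *v w))"
    unfolding nabla_def
    by (simp add: matrix_vector_mult_add_rdistrib matrix_vector_mult_diff_rdistrib inner_add_left inner_diff_left
        matrix_vector_mul_assoc)
  finally show ?thesis
    unfolding pullback_eq[OF c] metric_gram[OF c] Gamma_apply[OF c, of u v] Gamma_apply[OF c, of u w] .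
qed

text \<open>Both sides are conditions on the covariant derivative of \<open>pullback_endo\<close> at
  the single point \<open>p\<close>: closedness is the vanishing of its contraction, and it is a
  multiple of the trace-free part of \<open>spin_T\<close>.\<close>

lemma closed_at_iff:
  assumes c: "c \<in> atlas M" "p \<in> chart_dom c"
  shows "(\<forall>u v w. pd c (\<lambda>x. pullback \<phi> (fundamental_form g J) c x v w) p u
      + pd c (\<lambda>x. pullback \<phi> (fundamental_form g J) c x w u) p v
      + pd c (\<lambda>x. pullback \<phi> (fundamental_form g J) c x u v) p w = 0)
    \<longleftrightarrow> (\<forall>v. match_form J \<Gamma> \<phi> c p v = torsion_form J \<Gamma> \<phi> c p v)"
proof -
  let ?n = "spinor_norm \<phi> c p" and ?\<psi> = "pullback \<phi> (fundamental_form g J)" and ?NS = "nabla \<Gamma> c (pullback_endo c) p"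
  have n: "?n > 0" by (rule spinor_adj_facts(1)[OF c])
  obtain U E where E: "u2_chart M g J U E" and p: "p \<in> U" using u2_chart_exists[OF c] .
  note cp = c(1) p c(2)
  note oU = u2_openin[OF E]
  let ?E = "mfield E c p" and ?F = "matrix_inv (mfield E c p)"
  obtain q where sq: "smooth_in c U q"
    and q: "\<And>x. x \<in> U \<Longrightarrow> x \<in> chart_dom c \<Longrightarrow> mfield E c x ** mfield \<phi> c x = lmul (q x) ** mfield E c x"
    using u2_spinor_smooth[OF E c(1)] by blast
  define s where "s x = qmul (qcnj (q x)) (qmul qi (q x))" for x
  note sc = smooth_in_linear[OF bounded_linear_qcnj sq]
  note sqi = smooth_in_bilinear[OF bounded_bilinear_qmul smooth_in_const[OF chart_openI[OF c(1) oU], of qi] sq]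
  have ss: "smooth_in c U s" unfolding s_def by (rule smooth_in_bilinear[OF bounded_bilinear_qmul sc sqi])
  have sS: "smooth_in c U (pullback_endo c)" by (rule smooth_pullback_endo[OF c(1) oU])
  have lawS: "mfield E c x ** pullback_endo c x = lmul (s x) ** mfield E c x" if x: "x \<in> U" "x \<in> chart_dom c" for x
  proof -
    have "mfield E c x ** pullback_endo c x = lmul (qcnj (q x)) ** (mfield E c x ** mfield J c x) ** mfield \<phi> c x"
      by (simp add: pullback_endo_def matrix_mul_assoc spinor_adj_frame(1)[OF E c(1) x q[OF x]])
    also have "\<dots> = lmul (qcnj (q x)) ** lmul qi ** (mfield E c x ** mfield \<phi> c x)"
      by (simp add: u2_J[OF E c(1) x] matrix_mul_assoc)
    also have "\<dots> = lmul (s x) ** mfield E c x"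
      by (simp add: q[OF x] s_def matrix_mul_assoc lmul_mult qmul_assoc)
    finally show ?thesis .
  qed
  have "\<exists>a b. conn_forms \<Gamma> E c p u a b" for u using conn_forms_exist[OF E cp] by metis
  then obtain a b where ab: "\<And>u. conn_forms \<Gamma> E c p u (a u) (b u)" by metis
  have a: "a u \<in> imquat" for u using ab conn_forms_iff[OF E cp] by blast
  define \<beta> where "\<beta> u = pd c q p u + (qmul (a u) (q p) - qmul (q p) (a u))
      - (1/2) *\<^sub>R qmul (qmul qi (qmul (a u) qi - qmul qi (a u))) (q p)" for u
  define \<kappa> where "\<kappa> u = qmul (qcnj (q p)) (qmul qi (\<beta> u))" for u
  define \<sigma> where "\<sigma> u = pd c s p u + (qmul (a u) (s p) - qmul (s p) (a u))" for u
  have ds: "pd c s p u = qmul (qcnj (pd c q p u)) (qmul qi (q p)) + qmul (qcnj (q p)) (qmul qi (pd c q p u))" for u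
    unfolding s_def
    by (simp add: pd_bilinear[OF p c(2) bounded_bilinear_qmul sc sqi] pd_linear[OF p c(2) bounded_linear_qcnj sq]
        pd_bilinear[OF p c(2) bounded_bilinear_qmul smooth_in_const[OF chart_openI[OF c(1) oU], of qi] sq]
        bounded_bilinear.zero_left[OF bounded_bilinear_qmul])
  \<comment> \<open>Twice \<kappa> splits into the imaginary quaternion \<sigma>, which represents
    the derivative of \<open>pullback_endo\<close>, and a real part, which is what
    \<open>match_form\<close> measures.\<close>
  have id: "2 *\<^sub>R \<kappa> u = \<sigma> u + (2 * \<kappa> u $ 1) *\<^sub>R qone" "\<sigma> u \<in> imquat" for u
    unfolding imquat_iff
    using quat_derivative_identity[OF a, of "\<beta> u" "pd c q p u" u "q p" "s p" "\<sigma> u"]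
    by (simp_all only: \<beta>_def \<kappa>_def \<sigma>_def ds s_def)
  note sJ = endo_smooth(2)[OF endomorphism_field_J c(1) oU] and s\<Phi> = endo_smooth(2)[OF endomorphism_field_spinor c(1) oU]
  have ENS: "?E ** ?NS u = lmul (\<sigma> u) ** ?E" for u
    unfolding \<sigma>_def by (rule nabla_frame[OF E cp ab sS ss lawS])
  have ENJ: "?E ** nabla \<Gamma> c (mfield J c) p u = lmul (qmul (a u) qi - qmul qi (a u)) ** ?E" for u
    using nabla_frame[OF E cp ab sJ smooth_in_const[OF chart_openI[OF c(1) oU], of qi]] u2_J[OF E c(1)] by simp
  have ENP: "?E ** nabla \<Gamma> c (mfield \<phi> c) p u = lmul (pd c q p u + (qmul (a u) (q p) - qmul (q p) (a u))) ** ?E" for u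
    by (rule nabla_frame[OF E cp ab s\<Phi> sq q])
  have EB: "?E ** spin_B0 J \<Gamma> \<phi> c p u = lmul (\<beta> u) ** ?E" for u
  proof -
    have "?E ** (mfield J c p ** nabla \<Gamma> c (mfield J c) p u ** mfield \<phi> c p)
        = lmul qi ** (?E ** nabla \<Gamma> c (mfield J c) p u) ** mfield \<phi> c p"
      by (simp add: matrix_mul_assoc u2_J[OF E cp])
    also have "\<dots> = lmul qi ** lmul (qmul (a u) qi - qmul qi (a u)) ** (?E ** mfield \<phi> c p)"
      by (simp add: ENJ matrix_mul_assoc)
    also have "\<dots> = lmul (qmul (qmul qi (qmul (a u) qi - qmul qi (a u))) (q p)) ** ?E"
      by (simp only: q[OF cp(2,3)] matrix_mul_assoc lmul_mult)
    finally show ?thesis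
      unfolding spin_B0_def \<beta>_def lmul_diff[of "_ + _"] lmul_scaleR
      by (simp add: matrix_mult_diff_right matrix_mult_diff_left matrix_mult_scaleR_right matrix_mult_scaleR_left ENP)
  qed
  have ET: "?E ** spin_T J \<Gamma> \<phi> c p u = lmul (inverse ?n *\<^sub>R \<kappa> u) ** ?E" for u
  proof -
    have "?E ** (spinor_adj \<phi> c p ** mfield J c p ** spin_B0 J \<Gamma> \<phi> c p u)
        = lmul (qcnj (q p)) ** (?E ** mfield J c p) ** spin_B0 J \<Gamma> \<phi> c p u"
      by (simp add: matrix_mul_assoc spinor_adj_frame(1)[OF E cp q[OF cp(2,3)]])
    also have "\<dots> = lmul (qcnj (q p)) ** lmul qi ** (?E ** spin_B0 J \<Gamma> \<phi> c p u)"
      by (simp add: u2_J[OF E cp] matrix_mul_assoc)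
    also have "\<dots> = lmul (\<kappa> u) ** ?E"
      by (simp only: EB matrix_mul_assoc lmul_mult \<kappa>_def qmul_assoc)
    finally show ?thesis
      by (simp add: spin_T_def matrix_mult_scaleR_right matrix_mult_scaleR_left lmul_scaleR)
  qed
  have trT: "match_form J \<Gamma> \<phi> c p u = inverse ?n * (4 * \<kappa> u $ 1)" for u
  proof -
    have "trace (lmul (inverse ?n *\<^sub>R \<kappa> u)) = trace (spin_T J \<Gamma> \<phi> c p u)"
      by (rule trace_conj[OF ET[symmetric]]) (use u2_det[OF E cp] in simp)
    then show ?thesis unfolding match_form_def trace_lmul by simp
  qed
  \<comment> \<open>The real part of \<kappa> is the trace part of \<open>spin_T\<close>; removing
    it and clearing the normalization \<open>?n\<close> leaves 2 Im \<kappa> = \<sigma>.\<close>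
  have NS: "?NS u = (2 * ?n) *\<^sub>R (spin_T J \<Gamma> \<phi> c p u - (match_form J \<Gamma> \<phi> c p u / 4) *\<^sub>R mat 1)" for u
  proof (rule matrix_cancel_left[OF u2_inverse(2)[OF E cp]])
    have "\<sigma> u = 2 *\<^sub>R \<kappa> u - (2 * \<kappa> u $ 1) *\<^sub>R qone" using id(1)[of u] by simp
    then have l\<sigma>: "lmul (\<sigma> u) = 2 *\<^sub>R lmul (\<kappa> u) - (2 * \<kappa> u $ 1) *\<^sub>R mat 1"
      by (simp only: lmul_diff lmul_scaleR lmul_one)
    have nn: "2 * ?n * inverse ?n = 2" "2 * ?n * (inverse ?n * x) = 2 * x" for x
      using n by simp_all
    show "?E ** ?NS u = ?E ** ((2 * ?n) *\<^sub>R (spin_T J \<Gamma> \<phi> c p u - (match_form J \<Gamma> \<phi> c p u / 4) *\<^sub>R mat 1))"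
      by (simp add: ENS l\<sigma> nn matrix_mult_diff_left matrix_mult_diff_right matrix_mult_scaleR_left
          matrix_mult_scaleR_right ET lmul_scaleR trT scaleR_diff_right)
  qed
  have linNS: "linear ?NS"
    by (rule linear_nabla[OF c p sS])
  have lin\<sigma>: "linear (\<lambda>x. \<sigma> (?F *v x))"
  proof -
    have "lmul (\<sigma> u) = ?E ** ?NS u ** ?F" for u
      unfolding ENS by (simp add: matrix_mul_assoc[symmetric] u2_inverse[OF E cp])
    then have "\<sigma> u = (?E ** ?NS u ** ?F) *v qone" for u by (metis lmul_mult_vec qmul_one(2))
    then show ?thesis
      by (auto intro!: linearI simp: linear_add[OF linNS] linear_scale[OF linNS] matrix_vector_right_distrib
          matrix_vector_mult_scaleR matrix_ring matrix_vector_mult_add_rdistrib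
          matrix_vector_mult_scaleR_left)
  qed
  have gE: "g c p v w = (?E *v v) \<bullet> (?E *v w)" for v w
    unfolding metric_gram[OF c] u2_gram[OF E cp, symmetric] by (simp only: inner_matrix_vector matrix_vector_mul_assoc)
  have EF: "?E *v (?F *v x) = x" "?F *v (?E *v x) = x" for x
    by (simp_all add: matrix_vector_mul_assoc u2_inverse[OF E cp])
  have ENSv: "?E *v (?NS u *v v) = qmul (\<sigma> u) (?E *v v)" for u v
    by (simp add: matrix_vector_mul_assoc ENS) (simp add: matrix_vector_mul_assoc[symmetric])
  have cyc: "pd c (\<lambda>x. ?\<psi> c x v w) p u + pd c (\<lambda>x. ?\<psi> c x w u) p v + pd c (\<lambda>x. ?\<psi> c x u v) p w
      = qmul (\<sigma> u) (?E *v v) \<bullet> (?E *v w) + qmul (\<sigma> v) (?E *v w) \<bullet> (?E *v u) + qmul (\<sigma> w) (?E *v u) \<bullet> (?E *v v)" for u v w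
  proof -
    \<comment> \<open>Skewness of the form and the symmetry of \<Gamma> pair the six \<Gamma>-terms
      of the cyclic sum into cancelling couples.\<close>
    have "?\<psi> c p (\<Gamma> c p u v) w = - ?\<psi> c p w (\<Gamma> c p v u)" for u v w
      using pullback_skew[OF c, of "\<Gamma> c p u v" w] Gamma_sym[OF c, of u v] by simp
    then show ?thesis by (simp add: pd_pullback[OF c] gE ENSv)
  qed
  have "(\<forall>u v w. pd c (\<lambda>x. ?\<psi> c x v w) p u + pd c (\<lambda>x. ?\<psi> c x w u) p v + pd c (\<lambda>x. ?\<psi> c x u v) p w = 0)
      \<longleftrightarrow> (\<forall>x y z. qmul (\<sigma> (?F *v x)) y \<bullet> z + qmul (\<sigma> (?F *v y)) z \<bullet> x + qmul (\<sigma> (?F *v z)) x \<bullet> y = 0)"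
    (is "_ \<longleftrightarrow> (\<forall>x y z. ?R x y z = 0)")
  proof -
    have "(\<forall>u v w. pd c (\<lambda>x. ?\<psi> c x v w) p u + pd c (\<lambda>x. ?\<psi> c x w u) p v + pd c (\<lambda>x. ?\<psi> c x u v) p w = 0)
        \<longleftrightarrow> (\<forall>u v w. ?R (?E *v u) (?E *v v) (?E *v w) = 0)"
      unfolding cyc by (simp only: EF(2))
    also have "\<dots> \<longleftrightarrow> (\<forall>x y z. ?R x y z = 0)"
    proof (intro iffI allI)
      fix x y z assume "\<forall>u v w. ?R (?E *v u) (?E *v v) (?E *v w) = 0"
      from this[rule_format, of "?F *v x" "?F *v y" "?F *v z"] show "?R x y z = 0" by (simp only: EF(1))
    qed simp
    finally show ?thesis .
  qed
  also have "\<dots> \<longleftrightarrow> (\<forall>y. (\<Sum>k\<in>UNIV. qmul (\<sigma> (?F *v axis k 1)) y $ k) = 0)"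
    by (rule self_dual_closed_iff[OF lin\<sigma> id(2)])
  also have "\<dots> \<longleftrightarrow> (\<forall>v. trace (matrix (\<lambda>u. ?NS u *v v)) = 0)"
  proof -
    have lv: "linear (\<lambda>u. ?NS u *v v)" for v
      by (rule linearI) (simp_all add: linear_add[OF linNS] linear_scale[OF linNS] matrix_vector_mult_add_rdistrib
          matrix_vector_mult_scaleR_left)
    \<comment> \<open>The sum over k is the trace taken in the orthonormal basis
      \<open>?F *v axis k 1\<close>, hence the basis-free trace.\<close>
    have tr: "(\<Sum>k\<in>UNIV. qmul (\<sigma> (?F *v axis k 1)) (?E *v v) $ k) = trace (matrix (\<lambda>u. ?NS u *v v))" for v
    proof -
      have "(\<Sum>k\<in>UNIV. qmul (\<sigma> (?F *v axis k 1)) (?E *v v) $ k) = trace (?E ** matrix (\<lambda>u. ?NS u *v v) ** ?F)"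
        unfolding trace_def
      proof (intro sum.cong refl)
        fix k :: 4
        let ?M = "matrix (\<lambda>u. ?NS u *v v)"
        have "(?E ** ?M ** ?F) $ k $ k = ((?E ** ?M ** ?F) *v axis k 1) $ k"
          by (simp add: matrix_vector_mult_basis column_def)
        also have "\<dots> = (?E *v (?M *v (?F *v axis k 1))) $ k" by (simp only: matrix_vector_mul_assoc matrix_mul_assoc)
        also have "\<dots> = qmul (\<sigma> (?F *v axis k 1)) (?E *v v) $ k" by (simp only: matrix_mult_linear[OF lv] ENSv)
        finally show "qmul (\<sigma> (?F *v axis k 1)) (?E *v v) $ k = (?E ** ?M ** ?F) $ k $ k" ..
      qed
      also have "\<dots> = trace (?F ** (?E ** matrix (\<lambda>u. ?NS u *v v)))"
        by (rule trace_mul_sym)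
      also have "\<dots> = trace ((?F ** ?E) ** matrix (\<lambda>u. ?NS u *v v))"
        by (simp only: matrix_mul_assoc)
      finally show ?thesis by (simp add: u2_inverse[OF E cp])
    qed
    have *: "(\<Sum>k\<in>UNIV. qmul (\<sigma> (?F *v axis k 1)) y $ k) = trace (matrix (\<lambda>u. ?NS u *v (?F *v y)))" for y
      using tr[of "?F *v y"] by (simp only: EF(1))
    show ?thesis
    proof (intro iffI allI)
      fix v assume "\<forall>y. (\<Sum>k\<in>UNIV. qmul (\<sigma> (?F *v axis k 1)) y $ k) = 0"
      from this[rule_format, of "?E *v v"] show "trace (matrix (\<lambda>u. ?NS u *v v)) = 0"
        unfolding * by (simp only: EF(2))
    qed (simp add: *)
  qed
  also have "\<dots> \<longleftrightarrow> (\<forall>v. match_form J \<Gamma> \<phi> c p v = torsion_form J \<Gamma> \<phi> c p v)"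
  proof -
    let ?m = "match_form J \<Gamma> \<phi> c p"
    \<comment> \<open>Contracting the identity term in the form slot returns
      \<open>?m v / 4\<close>, since the form is evaluated on \<open>v\<close> itself.\<close>
    have tNS: "trace (matrix (\<lambda>u. ?NS u *v v)) = 2 * ?n * (spin_t J \<Gamma> \<phi> c p v - ?m v / 4)" for v
    proof -
      have "trace (matrix (\<lambda>u. ?NS u *v v))
          = (\<Sum>k\<in>UNIV. 2 * ?n * ((spin_T J \<Gamma> \<phi> c p (axis k 1) *v v) $ k - ?m (axis k 1) / 4 * v $ k))"
        by (simp add: trace_def matrix_def NS matrix_vector_mult_diff_rdistrib
            matrix_vector_mult_scaleR_left)
      also have "\<dots> = 2 * ?n * (spin_t J \<Gamma> \<phi> c p v - (\<Sum>k\<in>UNIV. v $ k * ?m (axis k 1)) / 4)"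
        by (simp add: spin_t_def trace_def matrix_def sum_distrib_left[symmetric] sum_subtractf sum_divide_distrib mult_ac)
      also have "(\<Sum>k\<in>UNIV. v $ k * ?m (axis k 1)) = ?m (\<Sum>k\<in>UNIV. v $ k *\<^sub>R axis k 1)"
        by (simp add: linear_sum[OF linear_match_form[OF c]] linear_scale[OF linear_match_form[OF c]])
      also have "(\<Sum>k\<in>UNIV. v $ k *\<^sub>R axis k 1) = v"
        by (simp add: vec_eq_iff forall_4 sum_4 axis_nth4)
      finally show ?thesis .
    qed
    \<comment> \<open>Here the constants meet: m = 4/3 (m - t) is equivalent to t = m/4, exactly the
      vanishing of the contraction.\<close>
    have "trace (matrix (\<lambda>u. ?NS u *v v)) = 0 \<longleftrightarrow> ?m v = torsion_form J \<Gamma> \<phi> c p v" for v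
      unfolding tNS torsion_form_def using n by auto
    then show ?thesis by simp
  qed
  finally show ?thesis .
qed

theorem symplectic_iff_minimizers:
  "symplectic M (pullback \<phi> (fundamental_form g J)) \<longleftrightarrow>
    (\<exists>A. unitary_connection M g J A \<and> closest_match M g J \<Gamma> \<phi> A \<and> torsion_minimized M g J \<Gamma> \<phi> A)"
proof -
  have "symplectic M (pullback \<phi> (fundamental_form g J)) \<longleftrightarrow>
      (\<forall>c\<in>atlas M. \<forall>p\<in>chart_dom c. \<forall>v. match_form J \<Gamma> \<phi> c p v = torsion_form J \<Gamma> \<phi> c p v)"
  proof -
    have "symplectic M (pullback \<phi> (fundamental_form g J)) \<longleftrightarrow> closed_form2 M (pullback \<phi> (fundamental_form g J))"
      using pullback_nondegenerate unfolding symplectic_def by blast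
    then show ?thesis
      unfolding closed_form2_def using closed_at_iff by (auto cong: ball_cong)
  qed
  also have "\<dots> \<longleftrightarrow> (\<exists>A. unitary_connection M g J A \<and> closest_match M g J \<Gamma> \<phi> A \<and> torsion_minimized M g J \<Gamma> \<phi> A)"
    using minimizers_agree common_minimizer kconn_unitary[OF one_form_match_form] by blast
  finally show ?thesis .
qed

end

theorem mainTheorem5:
  fixes M :: "'a manifold"
    and g :: "'a form2_field"
    and J :: "'a endo_field"
    and \<Gamma> :: "'a tensor12_field"
    and \<phi> :: "'a endo_field"
  assumes "oriented_manifold4 M"
    and "riemannian_metric M g"
    and "compatible_acs M g J"
    and "levi_civita M g \<Gamma>"
    and "plus_spinor M g \<phi>"
    and "nowhere_zero M \<phi>"
  shows "symplectic M (pullback \<phi> (fundamental_form g J)) \<longleftrightarrow>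
    (\<exists>A. unitary_connection M g J A \<and>
         closest_match M g J \<Gamma> \<phi> A \<and> torsion_minimized M g J \<Gamma> \<phi> A)"
proof -
  interpret spinor_manifold M g J \<Gamma> \<phi>
    using assms by unfold_locales
  show ?thesis by (rule symplectic_iff_minimizers)
qed

end
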